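(* Let $A$ be a commutative noetherian DG-ring. Assume that $\operatorname{amp}(A)<\infty$, and that the noetherian ring $\mathrm H^0(A)$ is J-1, that is, that the set $$\operatorname{Reg}(\mathrm H^0(A))=\{\bar{\mathfrak p}\in\operatorname{Spec}(\mathrm H^0(A)) \mid \mathrm H^0(A)_{\bar{\mathfrak p}}\text{ is a regular local ring}\}$$ is an open subset of $\operatorname{Spec}(\mathrm H^0(A))$. Then the set $$\operatorname{Reg}(A)=\{\bar{\mathfrak p}\in\operatorname{Spec}(\mathrm H^0(A)) \mid A_{\bar{\mathfrak p}}\text{ is quasi-isomorphic to a regular local ring}\}$$ is an open subset of $\operatorname{Spec}(\mathrm H^0(A))$.
   Context: A commutative DG-ring is a differential graded ring $A=\bigoplus_{n=-\infty}^{0}A^n$ (non-positive cohomological grading, differential of degree $+1$ satisfying the graded Leibniz rule) such that $b\cdot a=(-1)^{ij}a\cdot b$ for $a\in A^i$, $b\in A^j$, and $a\cdot a=0$ for $a\in A^i$ with $i$ odd. Then $\mathrm H^0(A)$ is a commutative ring and each $\mathrm H^n(A)$ is an $\mathrm H^0(A)$-module. $A$ is noetherian if $\mathrm H^0(A)$ is a noetherian ring and $\mathrm H^i(A)$ is a finitely generated $\mathrm H^0(A)$-module for all $i<0$. $\operatorname{amp}(A)=\sup\{n\mid\mathrm H^n(A)\ne0\}-\inf\{n\mid\mathrm H^n(A)\neq0\}$; $\operatorname{amp}(A)<\infty$ means $A$ has bounded cohomology, i.e. $\mathrm H^n(A)=0$ for all $n\ll0$. For $\bar{\mathfrak p}\in\operatorname{Spec}(\mathrm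 H^0(A))$, let $\pi:A^0\to\mathrm H^0(A)$ be the natural surjection and $\mathfrak p=\pi^{-1}(\bar{\mathfrak p})$; the localization is $A_{\bar{\mathfrak p}}:=A\otimes_{A^0}A^0_{\mathfrak p}$. It satisfies $\mathrm H^n(A_{\bar{\mathfrak p}})\cong\mathrm H^n(A)_{\bar{\mathfrak p}}$. A ring is regarded as a DG-ring concentrated in degree $0$. Spectra carry the Zariski topology. *)

theory Defs
  imports
    "HOL-Algebra.Ring_Divisibility"
    "HOL-Algebra.Free_Abelian_Groups"
    "HOL-Library.Extended_Real"
    "HOL-Analysis.Abstract_Topology"
begin

section \<open>Commutative rings: spectrum, dimension, regularity, localization\<close>

definition Spec :: "('a, 'm) ring_scheme \<Rightarrow> 'a set set" where
  "Spec R = {P. primeideal P R}"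

definition zariski :: "('a, 'm) ring_scheme \<Rightarrow> 'a set topology" where
  "zariski R = topology (\<lambda>U. \<exists>S \<subseteq> carrier R. U = {P \<in> Spec R. \<not> S \<subseteq> P})"

lemma istopology_zariski:
  assumes "cring R"
  shows "istopology (\<lambda>U. \<exists>S \<subseteq> carrier R. U = {P \<in> Spec R. \<not> S \<subseteq> P})"
  unfolding istopology_def
proof (intro conjI allI impI)
  fix U V
  assume "\<exists>S \<subseteq> carrier R. U = {P \<in> Spec R. \<not> S \<subseteq> P}"
     and "\<exists>S \<subseteq> carrier R. V = {P \<in> Spec R. \<not> S \<subseteq> P}"
  then obtain S T where S: "S \<subseteq> carrier R" "U = {P \<in> Spec R. \<not> S \<subseteq> P}"
    and T: "T \<subseteq> carrier R" "V = {P \<in> Spec R. \<not> T \<subseteq> P}" by auto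
  interpret cring R by fact
  let ?W = "{s \<otimes>\<^bsub>R\<^esub> t | s t. s \<in> S \<and> t \<in> T}"
  have "U \<inter> V = {P \<in> Spec R. \<not> ?W \<subseteq> P}"
  proof (intro equalityI subsetI)
    fix P assume "P \<in> U \<inter> V"
    then obtain s t where P: "primeideal P R" and st: "s \<in> S" "s \<notin> P" "t \<in> T" "t \<notin> P"
      using S T by (auto simp: Spec_def)
    then have "s \<otimes>\<^bsub>R\<^esub> t \<notin> P"
      using primeideal.I_prime[OF P, of s t] S T by auto
    then show "P \<in> {P \<in> Spec R. \<not> ?W \<subseteq> P}" using P st by (auto simp: Spec_def)
  next
    fix P assume "P \<in> {P \<in> Spec R. \<not> ?W \<subseteq> P}"
    then obtain s t where P: "primeideal P R" and st: "s \<in> S" "t \<in> T" "s \<otimes>\<^bsub>R\<^esub> t \<notin> P"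
      by (auto simp: Spec_def)
    interpret primeideal P R by fact
    have "s \<in> carrier R" "t \<in> carrier R" using st S T by auto
    then have "s \<notin> P" "t \<notin> P" using st I_l_closed I_r_closed by auto
    then show "P \<in> U \<inter> V" using P st S T by (auto simp: Spec_def)
  qed
  moreover have "?W \<subseteq> carrier R" using S T by auto
  ultimately show "\<exists>S \<subseteq> carrier R. U \<inter> V = {P \<in> Spec R. \<not> S \<subseteq> P}" by blast
next
  fix \<K> assume "\<forall>K\<in>\<K>. \<exists>S \<subseteq> carrier R. K = {P \<in> Spec R. \<not> S \<subseteq> P}"
  then obtain f where f: "\<And>K. K \<in> \<K> \<Longrightarrow> f K \<subseteq> carrier R"
      "\<And>K. K \<in> \<K> \<Longrightarrow> K = {P \<in> Spec R. \<not> f K \<subseteq> P}" by metis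
  have "P \<in> K \<longleftrightarrow> P \<in> Spec R \<and> \<not> f K \<subseteq> P" if "K \<in> \<K>" for P K
    by (subst f(2)[OF that]) simp
  then have "\<Union>\<K> = {P \<in> Spec R. \<not> (\<Union>K\<in>\<K>. f K) \<subseteq> P}" by auto
  moreover have "(\<Union>K\<in>\<K>. f K) \<subseteq> carrier R" using f(1) by auto
  ultimately show "\<exists>S \<subseteq> carrier R. \<Union>\<K> = {P \<in> Spec R. \<not> S \<subseteq> P}" by blast
qed

lemma openin_zariski:
  assumes "cring R"
  shows "openin (zariski R) U \<longleftrightarrow> (\<exists>S \<subseteq> carrier R. U = {P \<in> Spec R. \<not> S \<subseteq> P})"
  using istopology_zariski[OF assms] by (simp add: zariski_def)

definition krull_dim :: "('a, 'm) ring_scheme \<Rightarrow> enat" where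
  "krull_dim R = (SUP n \<in> {n. \<exists>P. (\<forall>i\<le>n. P i \<in> Spec R) \<and> (\<forall>i<n. P i \<subset> P (Suc i))}. enat n)"

definition regular_local_ring :: "('a, 'm) ring_scheme \<Rightarrow> bool" where
  "regular_local_ring R \<longleftrightarrow> cring R \<and> noetherian_ring R \<and> (\<exists>!M. maximalideal M R) \<and>
     (\<exists>S \<subseteq> carrier R. finite S \<and> enat (card S) = krull_dim R \<and> maximalideal (Idl\<^bsub>R\<^esub> S) R)"

text \<open>The fraction \<open>a / s\<close> in the localization of \<open>R\<close> at the prime \<open>P\<close>.\<close>
definition fraction :: "('a, 'm) ring_scheme \<Rightarrow> 'a set \<Rightarrow> 'a \<Rightarrow> 'a \<Rightarrow> ('a \<times> 'a) set" where
  "fraction R P a s = {(b, t). b \<in> carrier R \<and> t \<in> carrier R - P \<and>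
     (\<exists>u \<in> carrier R - P. u \<otimes>\<^bsub>R\<^esub> (a \<otimes>\<^bsub>R\<^esub> t) = u \<otimes>\<^bsub>R\<^esub> (b \<otimes>\<^bsub>R\<^esub> s))}"

definition localization :: "('a, 'm) ring_scheme \<Rightarrow> 'a set \<Rightarrow> ('a \<times> 'a) set ring" where
  "localization R P =
    \<lparr>carrier = {fraction R P a s | a s. a \<in> carrier R \<and> s \<in> carrier R - P},
     monoid.mult = (\<lambda>X Y. \<Union>x\<in>X. \<Union>y\<in>Y. fraction R P (fst x \<otimes>\<^bsub>R\<^esub> fst y) (snd x \<otimes>\<^bsub>R\<^esub> snd y)),
     one = fraction R P \<one>\<^bsub>R\<^esub> \<one>\<^bsub>R\<^esub>,
     ring.zero = fraction R P \<zero>\<^bsub>R\<^esub> \<one>\<^bsub>R\<^esub>,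
     add = (\<lambda>X Y. \<Union>x\<in>X. \<Union>y\<in>Y.
       fraction R P ((fst x \<otimes>\<^bsub>R\<^esub> snd y) \<oplus>\<^bsub>R\<^esub> (fst y \<otimes>\<^bsub>R\<^esub> snd x)) (snd x \<otimes>\<^bsub>R\<^esub> snd y))\<rparr>"

definition reg_locus :: "('a, 'm) ring_scheme \<Rightarrow> 'a set set" where
  "reg_locus R = {P \<in> Spec R. regular_local_ring (localization R P)}"

definition fin_gen_module :: "('r, 'm) ring_scheme \<Rightarrow> ('r, 'a, 'n) module_scheme \<Rightarrow> bool" where
  "fin_gen_module R M \<longleftrightarrow> module R M \<and>
     (\<exists>S \<subseteq> carrier M. finite S \<and>
       (\<forall>x \<in> carrier M. \<exists>c \<in> S \<rightarrow> carrier R. x = (\<Oplus>\<^bsub>M\<^esub>s\<in>S. c s \<odot>\<^bsub>M\<^esub> s)))"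


section \<open>Tensor products of algebras\<close>

text \<open>The ring \<open>B\<close> as an algebra along a ring homomorphism \<open>\<phi>\<close> into it.\<close>
definition algebra_via :: "('r \<Rightarrow> 'b) \<Rightarrow> ('b, 'n) ring_scheme \<Rightarrow> ('r, 'b) module" where
  "algebra_via \<phi> B =
    \<lparr>carrier = carrier B, monoid.mult = monoid.mult B, one = one B,
     ring.zero = ring.zero B, add = add B,
     smult = (\<lambda>r x. \<phi> r \<otimes>\<^bsub>B\<^esub> x)\<rparr>"

abbreviation tensor_free ::
    "('r, 'a, 'm) module_scheme \<Rightarrow> ('r, 'b, 'n) module_scheme \<Rightarrow> ('a \<times> 'b \<Rightarrow>\<^sub>0 int) monoid" where
  "tensor_free M N \<equiv> free_Abelian_group (carrier M \<times> carrier N)"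

text \<open>The subgroup of the free abelian group on \<open>M \<times> N\<close> that the tensor product over \<open>R\<close>
  divides out.\<close>
definition tensor_rel ::
    "('r, 'l) ring_scheme \<Rightarrow> ('r, 'a, 'm) module_scheme \<Rightarrow> ('r, 'b, 'n) module_scheme
      \<Rightarrow> ('a \<times> 'b \<Rightarrow>\<^sub>0 int) set" where
  "tensor_rel R M N = generate (tensor_free M N)
    ({frag_of (x \<oplus>\<^bsub>M\<^esub> x', y) - frag_of (x, y) - frag_of (x', y) | x x' y.
        x \<in> carrier M \<and> x' \<in> carrier M \<and> y \<in> carrier N} \<union>
     {frag_of (x, y \<oplus>\<^bsub>N\<^esub> y') - frag_of (x, y) - frag_of (x, y') | x y y'.
        x \<in> carrier M \<and> y \<in> carrier N \<and> y' \<in> carrier N} \<union>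
     {frag_of (r \<odot>\<^bsub>M\<^esub> x, y) - frag_of (x, r \<odot>\<^bsub>N\<^esub> y) | r x y.
        r \<in> carrier R \<and> x \<in> carrier M \<and> y \<in> carrier N})"

text \<open>The class of the formal sum \<open>c\<close>; thus \<open>x \<otimes> y\<close> is the class of \<open>frag_of (x, y)\<close>.\<close>
definition tensor_class ::
    "('r, 'l) ring_scheme \<Rightarrow> ('r, 'a, 'm) module_scheme \<Rightarrow> ('r, 'b, 'n) module_scheme
      \<Rightarrow> ('a \<times> 'b \<Rightarrow>\<^sub>0 int) \<Rightarrow> ('a \<times> 'b \<Rightarrow>\<^sub>0 int) set" where
  "tensor_class R M N c = tensor_rel R M N #>\<^bsub>tensor_free M N\<^esub> c"

definition tensor_ring ::
    "('r, 'l) ring_scheme \<Rightarrow> ('r, 'a, 'm) module_scheme \<Rightarrow> ('r, 'b, 'n) module_scheme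
      \<Rightarrow> ('a \<times> 'b \<Rightarrow>\<^sub>0 int) set ring" where
  "tensor_ring R M N =
    \<lparr>carrier = carrier (tensor_free M N Mod tensor_rel R M N),
     monoid.mult = (\<lambda>X Y. \<Union>c\<in>X. \<Union>c'\<in>Y. tensor_class R M N
       (frag_extend (\<lambda>(x, y). frag_extend (\<lambda>(x', y'). frag_of (x \<otimes>\<^bsub>M\<^esub> x', y \<otimes>\<^bsub>N\<^esub> y')) c') c)),
     one = tensor_class R M N (frag_of (\<one>\<^bsub>M\<^esub>, \<one>\<^bsub>N\<^esub>)),
     ring.zero = monoid.one (tensor_free M N Mod tensor_rel R M N),
     add = monoid.mult (tensor_free M N Mod tensor_rel R M N)\<rparr>"


section \<open>Commutative DG-rings\<close>

record 'a dg_ring = "'a ring" +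
  grade :: "int \<Rightarrow> 'a set"
  diff :: "'a \<Rightarrow> 'a"

text \<open>\<open>(-1)\<^sup>k x\<close>\<close>
definition sign_mult :: "('a, 'm) ring_scheme \<Rightarrow> int \<Rightarrow> 'a \<Rightarrow> 'a" where
  "sign_mult R k x = (if even k then x else \<ominus>\<^bsub>R\<^esub> x)"

locale comm_dg_ring = ring A for A :: "('a, 'm) dg_ring_scheme" (structure) +
  assumes grade_subgroup: "subgroup (grade A n) (add_monoid A)"
    and grade_direct_sum: "x \<in> carrier A \<Longrightarrow>
      \<exists>!f. (\<forall>n. f n \<in> grade A n) \<and> finite {n. f n \<noteq> \<zero>} \<and> x = (\<Oplus>n\<in>{n. f n \<noteq> \<zero>}. f n)"
    and grade_nonpos: "n > 0 \<Longrightarrow> grade A n = {\<zero>}"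
    and grade_one: "\<one> \<in> grade A 0"
    and grade_mult: "a \<in> grade A i \<Longrightarrow> b \<in> grade A j \<Longrightarrow> a \<otimes> b \<in> grade A (i + j)"
    and diff_hom: "diff A \<in> hom (add_monoid A) (add_monoid A)"
    and diff_grade: "a \<in> grade A n \<Longrightarrow> diff A a \<in> grade A (n + 1)"
    and diff_diff: "a \<in> carrier A \<Longrightarrow> diff A (diff A a) = \<zero>"
    and leibniz: "a \<in> grade A i \<Longrightarrow> b \<in> carrier A \<Longrightarrow>
      diff A (a \<otimes> b) = (diff A a \<otimes> b) \<oplus> sign_mult A i (a \<otimes> diff A b)"
    and graded_comm: "a \<in> grade A i \<Longrightarrow> b \<in> grade A j \<Longrightarrow> b \<otimes> a = sign_mult A (i * j) (a \<otimes> b)"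
    and odd_square: "a \<in> grade A i \<Longrightarrow> odd i \<Longrightarrow> a \<otimes> a = \<zero>"

definition degree0 :: "('a, 'm) dg_ring_scheme \<Rightarrow> 'a ring" where
  "degree0 A = \<lparr>carrier = grade A 0, monoid.mult = monoid.mult A, one = one A,
     ring.zero = ring.zero A, add = add A\<rparr>"

definition cocycles :: "('a, 'm) dg_ring_scheme \<Rightarrow> int \<Rightarrow> 'a set" where
  "cocycles A n = {a \<in> grade A n. diff A a = \<zero>\<^bsub>A\<^esub>}"

definition coboundaries :: "('a, 'm) dg_ring_scheme \<Rightarrow> int \<Rightarrow> 'a set" where
  "coboundaries A n = diff A ` grade A (n - 1)"

text \<open>Every element of degree \<open>0\<close> is a cocycle because \<open>A\<close> vanishes in degree \<open>1\<close>.\<close>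
definition H0 :: "('a, 'm) dg_ring_scheme \<Rightarrow> 'a set ring" where
  "H0 A = degree0 A Quot coboundaries A 0"

text \<open>The cohomology \<open>H\<^sup>n(A)\<close> as a module over \<open>H0 A\<close>. The fields \<open>mult\<close> and \<open>one\<close> have no
  meaning for \<open>n \<noteq> 0\<close>; the predicates for modules ignore them.\<close>
definition cohomology :: "('a, 'm) dg_ring_scheme \<Rightarrow> int \<Rightarrow> ('a set, 'a set) module" where
  "cohomology A n =
    \<lparr>carrier = {coboundaries A n +>\<^bsub>A\<^esub> z | z. z \<in> cocycles A n},
     monoid.mult = rcoset_mult A (coboundaries A n), one = coboundaries A n +>\<^bsub>A\<^esub> \<one>\<^bsub>A\<^esub>,
     ring.zero = coboundaries A n, add = set_add A,
     smult = rcoset_mult A (coboundaries A n)\<rparr>"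

lemma (in comm_dg_ring) grade_subset: "grade A n \<subseteq> carrier A"
  using subgroup.subset[OF grade_subgroup[of n]] by simp

lemma (in comm_dg_ring) cring_degree0: "cring (degree0 A)"
proof -
  have g: "\<And>x. x \<in> grade A 0 \<Longrightarrow> x \<in> carrier A" using grade_subset by auto
  have z: "\<zero> \<in> grade A 0" using subgroup.one_closed[OF grade_subgroup[of 0]] by simp
  have a: "x \<oplus> y \<in> grade A 0" if "x \<in> grade A 0" "y \<in> grade A 0" for x y
    using subgroup.m_closed[OF grade_subgroup[of 0]] that by simp
  have i: "\<ominus> x \<in> grade A 0" if "x \<in> grade A 0" for x
    using subgroup.m_inv_closed[OF grade_subgroup[of 0]] that by (simp add: a_inv_def)
  have m: "x \<otimes> y \<in> grade A 0" if "x \<in> grade A 0" "y \<in> grade A 0" for x y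
    using grade_mult[OF that] by simp
  have c: "x \<otimes> y = y \<otimes> x" if "x \<in> grade A 0" "y \<in> grade A 0" for x y
    using graded_comm[OF that] by (simp add: sign_mult_def)
  show ?thesis
  proof (rule cringI)
    show "abelian_group (degree0 A)"
      by (rule abelian_groupI)
         (auto simp: degree0_def g z a a_ac intro!: bexI[OF _ i] r_neg)
    show "Group.comm_monoid (degree0 A)"
      by (rule comm_monoidI) (auto simp: degree0_def g grade_one m m_assoc intro: c)
  qed (auto simp: degree0_def g l_distr)
qed

lemma (in comm_dg_ring) ideal_coboundaries: "ideal (coboundaries A 0) (degree0 A)"
proof -
  interpret D: cring "degree0 A" by (rule cring_degree0)
  interpret d: group_hom "add_monoid A" "add_monoid A" "diff A"
    using diff_hom by unfold_locales
  have g: "x \<in> grade A n \<Longrightarrow> x \<in> carrier A" for x n using grade_subset by auto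
  have d0: "diff A x = \<zero>" if "x \<in> grade A 0" for x
    using diff_grade[OF that] grade_nonpos[of 1] by simp
  have sub: "subgroup (coboundaries A 0) (add_monoid A)"
    unfolding coboundaries_def by (rule d.subgroup_img_is_subgroup) (rule grade_subgroup)
  have inc: "coboundaries A 0 \<subseteq> grade A 0"
    unfolding coboundaries_def using diff_grade[of _ "-1"] by auto
  have mult: "x \<otimes> b \<in> coboundaries A 0" if "b \<in> coboundaries A 0" "x \<in> grade A 0" for x b
  proof -
    obtain c where c: "c \<in> grade A (-1)" "b = diff A c" using \<open>b \<in> coboundaries A 0\<close>
      by (auto simp: coboundaries_def)
    have "diff A (x \<otimes> c) = x \<otimes> b"
      using leibniz[of x 0 c] that c g[OF c(1)] d0[OF that(2)] g[OF that(2)] inc g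
      by (auto simp: sign_mult_def)
    moreover have "x \<otimes> c \<in> grade A (0 - 1)" using grade_mult[OF that(2) c(1)] by simp
    ultimately show ?thesis unfolding coboundaries_def by (metis image_eqI)
  qed
  have "subgroup (coboundaries A 0) (add_monoid (degree0 A))"
  proof (rule group.subgroupI[OF D.add.group_axioms])
    fix x assume x: "x \<in> coboundaries A 0"
    then have "x \<oplus> \<ominus> x = \<zero>" "\<ominus> x \<in> coboundaries A 0"
      using inc g subgroup.m_inv_closed[OF sub x] by (auto simp: r_neg a_inv_def)
    moreover from this inc x have "\<ominus>\<^bsub>degree0 A\<^esub> x = \<ominus> x"
      by (intro D.minus_equality) (auto simp: degree0_def g l_neg)
    ultimately show "inv\<^bsub>add_monoid (degree0 A)\<^esub> x \<in> coboundaries A 0"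
      by (simp add: a_inv_def)
  qed (use inc sub subgroup.m_closed[OF sub] subgroup.one_closed[OF sub] in \<open>auto simp: degree0_def\<close>)
  moreover have "b \<otimes> x \<in> coboundaries A 0" if "b \<in> coboundaries A 0" "x \<in> grade A 0" for x b
    using graded_comm[of x 0 b 0] mult[OF that] that inc by (auto simp: sign_mult_def)
  ultimately show ?thesis
    by (intro idealI D.ring_axioms) (auto simp: degree0_def mult)
qed

lemma (in comm_dg_ring) cring_H0: "cring (H0 A)"
  unfolding H0_def by (rule ideal.quotient_is_cring[OF ideal_coboundaries cring_degree0])

lemma (in comm_dg_ring) H0_cohomology: "H0 A = ring.truncate (cohomology A 0)"
proof -
  have d0: "diff A x = \<zero>" if "x \<in> grade A 0" for x
    using diff_grade[OF that] grade_nonpos[of 1] by simp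
  then have "cocycles A 0 = grade A 0" by (auto simp: cocycles_def)
  then show ?thesis
    by (auto simp: H0_def FactRing_def cohomology_def ring.truncate_def degree0_def A_RCOSETS_defs
        a_r_coset_def r_coset_def rcoset_mult_def set_add_defs fun_eq_iff)
qed

lemma (in comm_dg_ring) subgroup_cocycles: "subgroup (cocycles A n) (add_monoid A)"
proof -
  interpret d: group_hom "add_monoid A" "add_monoid A" "diff A"
    using diff_hom by unfold_locales
  have "cocycles A n = grade A n \<inter> kernel (add_monoid A) (add_monoid A) (diff A)"
    using grade_subset by (auto simp: cocycles_def kernel_def)
  then show ?thesis
    using add.subgroups_Inter_pair[OF grade_subgroup d.subgroup_kernel] by simp
qed

lemma (in comm_dg_ring) subgroup_coboundaries: "subgroup (coboundaries A n) (add_monoid A)"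
proof -
  interpret d: group_hom "add_monoid A" "add_monoid A" "diff A"
    using diff_hom by unfold_locales
  show ?thesis
    unfolding coboundaries_def by (rule d.subgroup_img_is_subgroup) (rule grade_subgroup)
qed

lemma (in comm_dg_ring) coboundaries_cocycles: "coboundaries A n \<subseteq> cocycles A n"
  using diff_grade[of _ "n - 1"] diff_diff grade_subset by (auto simp: coboundaries_def cocycles_def)

lemma (in comm_dg_ring) module_cohomology: "module (H0 A) (cohomology A n)"
proof -
  interpret H: cring "H0 A" by (rule cring_H0)
  let ?B = "coboundaries A n"
  interpret B: abelian_subgroup ?B A
    by (rule abelian_subgroupI3)
       (auto intro!: additive_subgroup.intro subgroup_coboundaries abelian_group_axioms)
  note S = subgroup.subset[OF subgroup_coboundaries, simplified]
  have Zc: "\<And>z n. z \<in> cocycles A n \<Longrightarrow> z \<in> carrier A" using grade_subset by (auto simp: cocycles_def)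
  have dz: "\<And>z n. z \<in> cocycles A n \<Longrightarrow> diff A z = \<zero>" by (auto simp: cocycles_def)
  have Zadd: "\<And>y z. y \<in> cocycles A n \<Longrightarrow> z \<in> cocycles A n \<Longrightarrow> y \<oplus> z \<in> cocycles A n"
    using subgroup.m_closed[OF subgroup_cocycles] by simp
  have Z0: "\<zero> \<in> cocycles A n" using subgroup.one_closed[OF subgroup_cocycles] by simp
  have Zinv: "\<And>z. z \<in> cocycles A n \<Longrightarrow> \<ominus> z \<in> cocycles A n"
    using subgroup.m_inv_closed[OF subgroup_cocycles] by (simp add: a_inv_def)
  have Z: "cocycles A 0 = grade A 0"
    using diff_grade[of _ 0] grade_nonpos[of 1] by (auto simp: cocycles_def)
  have diff_zero: "diff A \<zero> = \<zero>"
    using dz[OF Z0] .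
  have Zm: "x \<otimes> z \<in> cocycles A n" if "x \<in> cocycles A 0" "z \<in> cocycles A n" for x z
    using leibniz[of x 0 z] grade_mult[of x 0 z n] that Zc[OF that(1)] Zc[OF that(2)]
    by (auto simp: cocycles_def sign_mult_def)
  have bm: "b \<otimes> z \<in> ?B" if "b \<in> coboundaries A 0" "z \<in> cocycles A n" for b z
  proof -
    obtain c where c: "c \<in> grade A (-1)" "b = diff A c" using \<open>b \<in> coboundaries A 0\<close> by (auto simp: coboundaries_def)
    have "c \<in> carrier A" using c grade_subset by auto
    moreover have "b \<in> carrier A" using that(1) subgroup.subset[OF subgroup_coboundaries, of 0] by auto
    ultimately have "diff A (c \<otimes> z) = b \<otimes> z"
      using leibniz[of c "-1" z] c that Zc[OF that(2)] dz[OF that(2)] S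
        subgroup.subset[OF subgroup_coboundaries, of 0]
      by (auto simp: sign_mult_def)
    moreover have "c \<otimes> z \<in> grade A (n - 1)"
      using grade_mult[of c "-1" z n] c that by (simp add: cocycles_def)
    ultimately show ?thesis unfolding coboundaries_def by (metis image_eqI)
  qed
  have mb: "x \<otimes> b \<in> ?B" if "b \<in> ?B" "x \<in> cocycles A 0" for x b
  proof -
    obtain c where c: "c \<in> grade A (n-1)" "b = diff A c" using \<open>b \<in> ?B\<close> by (auto simp: coboundaries_def)
    have "diff A (x \<otimes> c) = x \<otimes> b"
      using leibniz[of x 0 c] c that Z dz[OF that(2)] Zc[OF that(2)] grade_subset[of "n-1"] S
      by (auto simp: sign_mult_def)
    moreover have "x \<otimes> c \<in> grade A (n - 1)"
      using grade_mult[of x 0 c "n-1"] c that Z by simp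
    ultimately show ?thesis unfolding coboundaries_def by (metis image_eqI)
  qed
  have sm: "rcoset_mult A ?B (coboundaries A 0 +> x) (?B +> z) = ?B +> (x \<otimes> z)"
    if x: "x \<in> cocycles A 0" and z: "z \<in> cocycles A n" for x z
  proof -
    have "?B +> ((b \<oplus> x) \<otimes> (c \<oplus> z)) = ?B +> (x \<otimes> z)"
      if b: "b \<in> coboundaries A 0" and c: "c \<in> ?B" for b c
    proof -
      have car: "b \<in> carrier A" "c \<in> carrier A" "x \<in> carrier A" "z \<in> carrier A"
        using b c x z Zc coboundaries_cocycles by blast+
      have cz: "c \<oplus> z \<in> cocycles A n" using c z coboundaries_cocycles Zadd by blast
      have "(b \<oplus> x) \<otimes> (c \<oplus> z) = (b \<otimes> (c \<oplus> z) \<oplus> x \<otimes> c) \<oplus> x \<otimes> z"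
        using car by (simp add: l_distr r_distr a_ac)
      moreover have "b \<otimes> (c \<oplus> z) \<oplus> x \<otimes> c \<in> ?B"
        using bm[OF b cz] mb[OF c x] by (rule B.a_closed)
      ultimately have "(b \<oplus> x) \<otimes> (c \<oplus> z) \<in> ?B +> (x \<otimes> z)"
        by (auto simp: a_r_coset_def')
      then show ?thesis using B.a_repr_independence'[of "(b \<oplus> x) \<otimes> (c \<oplus> z)" "x \<otimes> z"] car by simp
    qed
    moreover have "coboundaries A 0 \<noteq> {}" "?B \<noteq> {}"
      using subgroup.one_closed[OF subgroup_coboundaries] by auto
    ultimately show ?thesis
      by (auto simp: rcoset_mult_def a_r_coset_def'[of A "coboundaries A 0" x] a_r_coset_def'[of A ?B z])
  qed
  have add: "(?B +> y) <+> (?B +> z) = ?B +> (y \<oplus> z)" if "y \<in> cocycles A n" "z \<in> cocycles A n" for y z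
    using B.a_rcos_sum[of y z] that Zc by auto
  have addH: "(coboundaries A 0 +> y) <+> (coboundaries A 0 +> z) = coboundaries A 0 +> (y \<oplus> z)"
    if "y \<in> cocycles A 0" "z \<in> cocycles A 0" for y z
  proof -
    interpret B0: abelian_subgroup "coboundaries A 0" A
      by (rule abelian_subgroupI3)
         (auto intro!: additive_subgroup.intro subgroup_coboundaries abelian_group_axioms)
    show ?thesis using B0.a_rcos_sum[of y z] that Zc by auto
  qed
  have mulH: "rcoset_mult A (coboundaries A 0) (coboundaries A 0 +> x) (coboundaries A 0 +> y)
      = coboundaries A 0 +> (x \<otimes> y)" if "x \<in> cocycles A 0" "y \<in> cocycles A 0" for x y
  proof -
    interpret I: ideal "coboundaries A 0" "degree0 A" by (rule ideal_coboundaries)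
    show ?thesis using I.rcoset_mult_add[of x y] that Z
      by (simp add: degree0_def rcoset_mult_def a_r_coset_def r_coset_def)
  qed
  have B0: "?B = ?B +> \<zero>" using S by (simp add: a_r_coset_def')
  have CH: "X \<in> carrier (H0 A) \<longleftrightarrow> (\<exists>x \<in> cocycles A 0. X = coboundaries A 0 +> x)" for X
    by (auto simp: H0_cohomology cohomology_def ring.truncate_def)
  have CM: "X \<in> carrier (cohomology A n) \<longleftrightarrow> (\<exists>x \<in> cocycles A n. X = ?B +> x)" for X
    by (auto simp: cohomology_def)
  have ops: "X \<oplus>\<^bsub>cohomology A n\<^esub> Y = X <+> Y" "\<zero>\<^bsub>cohomology A n\<^esub> = ?B +> \<zero>"
    "X \<odot>\<^bsub>cohomology A n\<^esub> Y = rcoset_mult A ?B X Y"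
    "X \<oplus>\<^bsub>H0 A\<^esub> Y = X <+> Y" "X \<otimes>\<^bsub>H0 A\<^esub> Y = rcoset_mult A (coboundaries A 0) X Y"
    "\<one>\<^bsub>H0 A\<^esub> = coboundaries A 0 +> \<one>" for X Y
    using B0 by (auto simp: H0_cohomology cohomology_def ring.truncate_def)
  have one: "\<one> \<in> cocycles A 0" using grade_one Z by simp
  have closed0: "x \<oplus> y \<in> cocycles A 0" "x \<otimes> y \<in> cocycles A 0"
    if "x \<in> cocycles A 0" "y \<in> cocycles A 0" for x y
    using that subgroup.m_closed[OF subgroup_cocycles, of x 0 y] grade_mult[of x 0 y 0] Z by auto
  show ?thesis
  proof (rule moduleI)
    show "abelian_group (cohomology A n)"
    proof (rule abelian_groupI)
      fix X assume "X \<in> carrier (cohomology A n)"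
      then obtain x where x: "x \<in> cocycles A n" "X = ?B +> x" by (auto simp: CM)
      have "(?B +> \<ominus> x) <+> X = ?B +> \<zero>" using x Zinv[of x] add[of "\<ominus> x" x] Zc by (simp add: l_neg)
      then show "\<exists>Y\<in>carrier (cohomology A n). Y \<oplus>\<^bsub>cohomology A n\<^esub> X = \<zero>\<^bsub>cohomology A n\<^esub>"
        unfolding ops using x Zinv CM by blast
    qed (auto simp: CM ops add Zadd Z0 a_ac Zc intro: Zadd Z0)
  qed (auto simp: CM CH ops add addH sm mulH Zadd Zm closed0 one Zc l_distr r_distr m_assoc
      H.is_cring intro!: Zm)
qed

definition dg_noetherian :: "('a, 'm) dg_ring_scheme \<Rightarrow> bool" where
  "dg_noetherian A \<longleftrightarrow>
     noetherian_ring (H0 A) \<and> (\<forall>i<0. fin_gen_module (H0 A) (cohomology A i))"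

definition cohomology_support :: "('a, 'm) dg_ring_scheme \<Rightarrow> int set" where
  "cohomology_support A = {n. carrier (cohomology A n) \<noteq> {\<zero>\<^bsub>cohomology A n\<^esub>}}"

text \<open>The suprema are taken in the extended reals, where the zero ring gets amplitude
  \<open>-\<infinity> - \<infinity> = -\<infinity>\<close>.\<close>
definition amp :: "('a, 'm) dg_ring_scheme \<Rightarrow> ereal" where
  "amp A = (SUP n \<in> cohomology_support A. ereal (of_int n))
         - (INF n \<in> cohomology_support A. ereal (of_int n))"


subsection \<open>Localization\<close>

text \<open>The DG-ring \<open>A \<otimes> B\<close> over \<open>A\<^sup>0\<close>, for a ring homomorphism \<open>\<phi>\<close> from \<open>A\<^sup>0\<close> to the
  ring \<open>B\<close>. No signs occur in the product because \<open>B\<close> sits in degree \<open>0\<close>.\<close>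
definition dg_base_change ::
    "('a, 'm) dg_ring_scheme \<Rightarrow> ('a \<Rightarrow> 'b) \<Rightarrow> ('b, 'n) ring_scheme
      \<Rightarrow> ('a \<times> 'b \<Rightarrow>\<^sub>0 int) set dg_ring" where
  "dg_base_change A \<phi> B =
    (let M = algebra_via (\<lambda>x. x) A; N = algebra_via \<phi> B; cls = tensor_class (degree0 A) M N in
     ring.extend (tensor_ring (degree0 A) M N)
      (dg_ring.fields
        (\<lambda>n. cls ` carrier (free_Abelian_group (grade A n \<times> carrier B)))
        (\<lambda>X. \<Union>c\<in>X. cls (frag_extend (\<lambda>(x, y). frag_of (diff A x, y)) c))))"

definition prime_preimage :: "('a, 'm) dg_ring_scheme \<Rightarrow> 'a set set \<Rightarrow> 'a set" where
  "prime_preimage A P = {a \<in> grade A 0. coboundaries A 0 +>\<^bsub>A\<^esub> a \<in> P}"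

type_synonym 'a dg_loc = "('a \<times> ('a \<times> 'a) set \<Rightarrow>\<^sub>0 int) set"

definition dg_localization :: "('a, 'm) dg_ring_scheme \<Rightarrow> 'a set set \<Rightarrow> 'a dg_loc dg_ring" where
  "dg_localization A P =
    (let p = prime_preimage A P in
     dg_base_change A (\<lambda>a. fraction (degree0 A) p a \<one>\<^bsub>A\<^esub>) (localization (degree0 A) p))"


subsection \<open>Quasi-isomorphism\<close>

definition dg_ring_hom ::
    "('a, 'm) dg_ring_scheme \<Rightarrow> ('b, 'n) dg_ring_scheme \<Rightarrow> ('a \<Rightarrow> 'b) set" where
  "dg_ring_hom A B = {f \<in> ring_hom A B. (\<forall>n. f ` grade A n \<subseteq> grade B n) \<and>
     (\<forall>a \<in> carrier A. f (diff A a) = diff B (f a))}"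

text \<open>The map induced by \<open>f\<close> on \<open>H\<^sup>n\<close>: the coset of \<open>z\<close> goes to the coset of \<open>f z\<close>.\<close>
definition cohomology_map ::
    "('b, 'n) dg_ring_scheme \<Rightarrow> int \<Rightarrow> ('a \<Rightarrow> 'b) \<Rightarrow> 'a set \<Rightarrow> 'b set" where
  "cohomology_map B n f X = (\<Union>z\<in>X. coboundaries B n +>\<^bsub>B\<^esub> f z)"

definition quasi_iso ::
    "('a, 'm) dg_ring_scheme \<Rightarrow> ('b, 'n) dg_ring_scheme \<Rightarrow> ('a \<Rightarrow> 'b) \<Rightarrow> bool" where
  "quasi_iso A B f \<longleftrightarrow> f \<in> dg_ring_hom A B \<and>
     (\<forall>n. bij_betw (cohomology_map B n f) (carrier (cohomology A n)) (carrier (cohomology B n)))"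

definition has_quasi_iso :: "'a dg_ring \<Rightarrow> 'b dg_ring \<Rightarrow> bool" where
  "has_quasi_iso A B \<longleftrightarrow> comm_dg_ring A \<and> comm_dg_ring B \<and> (\<exists>f. quasi_iso A B f)"

text \<open>Two DG-rings are quasi-isomorphic if a finite zigzag of quasi-isomorphisms of commutative
  DG-rings joins them. The DG-rings of the zigzag other than \<open>A\<close> range over those
  carried by subsets of the type \<open>'u\<close>, which serves as the universe.\<close>
definition quasi_isomorphic :: "'a dg_ring \<Rightarrow> 'u dg_ring \<Rightarrow> bool" where
  "quasi_isomorphic A B \<longleftrightarrow>
     (\<exists>C :: 'u dg_ring. (has_quasi_iso A C \<or> has_quasi_iso C A) \<and> equivclp has_quasi_iso C B)"

definition concentrated :: "('a, 'm) ring_scheme \<Rightarrow> 'a dg_ring" where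
  "concentrated R =
    \<lparr>carrier = carrier R, monoid.mult = monoid.mult R, one = one R,
     ring.zero = ring.zero R, add = add R,
     grade = (\<lambda>n. if n = 0 then carrier R else {\<zero>\<^bsub>R\<^esub>}), diff = (\<lambda>x. \<zero>\<^bsub>R\<^esub>)\<rparr>"

lemma comm_dg_ring_concentrated:
  assumes "cring R"
  shows "comm_dg_ring (concentrated R)"
proof -
  interpret cring R by fact
  have ring: "ring (concentrated R)"
    by (rule ringI; (rule abelian_groupI | rule monoidI)?)
       (auto simp: concentrated_def a_assoc a_comm m_assoc l_distr r_distr a_lcomm intro!: bexI[of _ "\<ominus>\<^bsub>R\<^esub> _"] r_neg)
  then interpret C: ring "concentrated R" .
  have c: "carrier (concentrated R) = carrier R" "mult (concentrated R) = mult R" "one (concentrated R) = one R"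
    "ring.zero (concentrated R) = \<zero>\<^bsub>R\<^esub>" "add (concentrated R) = add R"
    "grade (concentrated R) = (\<lambda>n. if n = 0 then carrier R else {\<zero>\<^bsub>R\<^esub>})"
    "diff (concentrated R) = (\<lambda>x. \<zero>\<^bsub>R\<^esub>)" by (simp_all add: concentrated_def)
  have z: "\<ominus>\<^bsub>concentrated R\<^esub> \<zero>\<^bsub>R\<^esub> = \<zero>\<^bsub>R\<^esub>"
    using C.minus_zero unfolding c .
  show ?thesis
  proof (rule comm_dg_ring.intro[OF ring], rule comm_dg_ring_axioms.intro)
    fix x assume x: "x \<in> carrier (concentrated R)"
    show "\<exists>!f. (\<forall>n. f n \<in> grade (concentrated R) n) \<and> finite {n. f n \<noteq> \<zero>\<^bsub>concentrated R\<^esub>} \<and>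
        x = (\<Oplus>\<^bsub>concentrated R\<^esub>n\<in>{n. f n \<noteq> \<zero>\<^bsub>concentrated R\<^esub>}. f n)"
    proof (rule ex1I[of _ "\<lambda>n. if n = 0 then x else \<zero>\<^bsub>R\<^esub>"])
      have "{n::int. (if n = 0 then x else \<zero>\<^bsub>R\<^esub>) \<noteq> \<zero>\<^bsub>R\<^esub>} = (if x = \<zero>\<^bsub>R\<^esub> then {} else {0})" by auto
      then show "(\<forall>n. (if n = 0 then x else \<zero>\<^bsub>R\<^esub>) \<in> grade (concentrated R) n) \<and>
        finite {n. (if n = (0::int) then x else \<zero>\<^bsub>R\<^esub>) \<noteq> \<zero>\<^bsub>concentrated R\<^esub>} \<and>
        x = (\<Oplus>\<^bsub>concentrated R\<^esub>n\<in>{n. (if n = (0::int) then x else \<zero>\<^bsub>R\<^esub>) \<noteq> \<zero>\<^bsub>concentrated R\<^esub>}. if n = 0 then x else \<zero>\<^bsub>R\<^esub>)"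
        using x C.finsum_empty C.finsum_insert[of "{}" 0 "\<lambda>n::int. if n = 0 then x else \<zero>\<^bsub>R\<^esub>"] by (auto simp: c)
    next
      fix f assume f: "(\<forall>n. f n \<in> grade (concentrated R) n) \<and> finite {n. f n \<noteq> \<zero>\<^bsub>concentrated R\<^esub>} \<and>
        x = (\<Oplus>\<^bsub>concentrated R\<^esub>n\<in>{n. f n \<noteq> \<zero>\<^bsub>concentrated R\<^esub>}. f n)"
      then have n: "f n = \<zero>\<^bsub>R\<^esub>" if "n \<noteq> 0" for n using that by (auto simp: c split: if_splits)
      have f0: "f 0 \<in> carrier R" using f by (auto simp: c split: if_splits)
      have "{n. f n \<noteq> \<zero>\<^bsub>R\<^esub>} = (if f 0 = \<zero>\<^bsub>R\<^esub> then {} else {0})" using n by (auto split: if_splits) metis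
      then have "x = f 0" using f f0 C.finsum_empty C.finsum_insert[of "{}" 0 f] by (auto simp: c split: if_splits)
      then show "f = (\<lambda>n. if n = 0 then x else \<zero>\<^bsub>R\<^esub>)" using n by auto
    qed
  next
    fix n :: int show "subgroup (grade (concentrated R) n) (add_monoid (concentrated R))"
      using C.add.subgroup_self C.add.triv_subgroup by (auto simp: c)
  qed (auto simp: c z hom_def sign_mult_def m_comm split: if_splits)
qed

text \<open>The regular local ring and the zigzag live in the universe \<open>'a dg_loc + 'v\<close>. The first
  summand ensures that there is room for the localization and for its cohomology; the type
  \<open>'v\<close> is arbitrary, so that the universe may be as large as desired.\<close>
definition dg_reg_locus :: "'v itself \<Rightarrow> ('a, 'm) dg_ring_scheme \<Rightarrow> 'a set set set" where
  "dg_reg_locus _ A = {P \<in> Spec (H0 A).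
     \<exists>R :: ('a dg_loc + 'v) ring. regular_local_ring R \<and>
       quasi_isomorphic (dg_localization A P) (concentrated R)}"

end

theory Submission
  imports Defs "HOL-Algebra.Weak_Morphisms"
begin

text \<open>The idea is that the regular locus of \<open>A\<close> is the regular locus of \<open>H\<^sup>0(A)\<close> intersected with
the set where all negative cohomology vanishes. The first set is open by the J-1 hypothesis, the
second by finiteness of the cohomology.

A DG-ring is quasi-isomorphic to a regular local ring exactly if its negative cohomology
vanishes and its \<open>H\<^sup>0\<close> is a regular local ring (\<open>quasi_isomorphic_regular_iff\<close>). Both conditions
are invariant under quasi-isomorphisms, hence along zigzags, and they hold for a regular
local ring in degree \<open>0\<close>. Conversely, as the grading is non-positive, the projection of a DG-ring
onto its \<open>H\<^sup>0\<close> is a map of DG-rings, and without negative cohomology it is a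
quasi-isomorphism.

For the localization at \<open>P\<close> these two conditions are read off from \<open>A\<close>, since cohomology commutes with
localization: \<open>H\<^sup>n\<close> of the localization vanishes if and only if every cocycle of degree \<open>n\<close> becomes a
coboundary after multiplication with some \<open>s\<close> outside the preimage of \<open>P\<close>
(\<open>L_cohomology_trivial_iff\<close>), and \<open>H\<^sup>0\<close> of the localization is the localization of \<open>H\<^sup>0(A)\<close> at \<open>P\<close>
(\<open>H0_L_iso\<close>). These computations take place in the DG-ring of fractions \<open>a / s\<close> with \<open>s\<close> of degree
\<open>0\<close>. The localization itself is a tensor product, that is, a quotient of a free abelian
group. Modulo the tensor relations every formal sum is a single \<open>x \<otimes> 1/s\<close>, so the relations are
precisely the kernel of the evaluation into fractions (\<open>tensor_eval_eq_zero_iff\<close>), and the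
tensor product is isomorphic to the DG-ring of fractions. This also shows that it is a commutative
DG-ring.

As \<open>H\<^sup>n(A)\<close> is finitely generated, the primes at which it vanishes are those that do not
contain its annihilator, and they form an open set (\<open>openin_vanishing_locus\<close>). Finite amplitude
leaves only finitely many negative \<open>n\<close> to consider, so the intersection stays open.\<close>

section \<open>Regularity is invariant under isomorphism\<close>

lemma ring_iso_image_ideal:
  assumes "ring R" "ring S" and h: "h \<in> ring_iso R S" and I: "ideal I R"
  shows "ideal (h ` I) S"
proof -
  interpret R: ring R by fact
  interpret S: ring S by fact
  interpret I: ideal I R by fact
  interpret h: ring_hom_ring R S h
    using h by (intro ring_hom_ringI2 assms) (simp add: ring_iso_def)
  have surj: "h ` carrier R = carrier S"
    using ring_iso_memE(5)[OF h] by (simp add: bij_betw_def)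
  interpret g: group_hom "add_monoid R" "add_monoid S" h
    by (rule h.a_group_hom)
  show ?thesis
  proof (rule idealI[OF \<open>ring S\<close>])
    show "subgroup (h ` I) (add_monoid S)"
      using I.a_subgroup by (rule g.subgroup_img_is_subgroup)
    fix a x assume "a \<in> h ` I" "x \<in> carrier S"
    then obtain b y where b: "b \<in> I" "a = h b" and y: "y \<in> carrier R" "x = h y"
      using surj by (metis imageE)
    have "x \<otimes>\<^bsub>S\<^esub> a = h (y \<otimes>\<^bsub>R\<^esub> b)" "a \<otimes>\<^bsub>S\<^esub> x = h (b \<otimes>\<^bsub>R\<^esub> y)"
      using b y I.Icarr by auto
    then show "x \<otimes>\<^bsub>S\<^esub> a \<in> h ` I" "a \<otimes>\<^bsub>S\<^esub> x \<in> h ` I"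
      using imageI[OF I.I_l_closed[OF b(1) y(1)], of h] imageI[OF I.I_r_closed[OF b(1) y(1)], of h]
      by simp_all
  qed
qed

lemma ring_iso_image_image:
  assumes "h \<in> ring_iso R S" "X \<subseteq> carrier R"
  shows "inv_into (carrier R) h ` h ` X = X"
  using assms ring_iso_memE(5)[OF assms(1)]
  by (simp add: bij_betw_def inv_into_image_cancel)

lemma ring_iso_image_mono_iff:
  assumes "h \<in> ring_iso R S" "X \<subseteq> carrier R" "Y \<subseteq> carrier R"
  shows "h ` X \<subseteq> h ` Y \<longleftrightarrow> X \<subseteq> Y"
proof
  assume "h ` X \<subseteq> h ` Y"
  then have "inv_into (carrier R) h ` h ` X \<subseteq> inv_into (carrier R) h ` h ` Y" by (rule image_mono)
  then show "X \<subseteq> Y" using ring_iso_image_image[OF assms(1)] assms by simp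
qed (rule image_mono)

text \<open>Taking images under an isomorphism is a bijection between the ideals of the two rings. The remaining
transport lemmas are consequences, since maximal, prime and generated ideals are described by the
inclusions among ideals or by membership.\<close>
lemma ring_iso_ideal_eq_image:
  assumes "ring R" "ring S" and h: "h \<in> ring_iso R S" and J: "ideal J S"
  obtains I where "ideal I R" "J = h ` I"
proof
  let ?g = "inv_into (carrier R) h"
  show "ideal (?g ` J) R"
    using ring_iso_image_ideal[OF \<open>ring S\<close> \<open>ring R\<close> ring_iso_set_sym[OF \<open>ring R\<close> h] J] .
  have "J \<subseteq> h ` carrier R"
    using ideal.Icarr[OF J] ring_iso_memE(5)[OF h] by (auto simp: bij_betw_def)
  then show "J = h ` ?g ` J" by (simp add: image_inv_into_cancel)
qed

lemma ring_iso_image_genideal: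
  assumes "ring R" "ring S" and h: "h \<in> ring_iso R S" and X: "X \<subseteq> carrier R"
  shows "h ` (Idl\<^bsub>R\<^esub> X) = Idl\<^bsub>S\<^esub> (h ` X)"
proof
  interpret R: ring R by fact
  interpret S: ring S by fact
  have hX: "h ` X \<subseteq> carrier S" using X ring_iso_memE(1)[OF h] by auto
  show "Idl\<^bsub>S\<^esub> (h ` X) \<subseteq> h ` (Idl\<^bsub>R\<^esub> X)"
    using ring_iso_image_ideal[OF assms(1-3) R.genideal_ideal[OF X]] R.genideal_self[OF X]
    by (intro S.genideal_minimal) auto
  obtain I where I: "ideal I R" "Idl\<^bsub>S\<^esub> (h ` X) = h ` I"
    using ring_iso_ideal_eq_image[OF assms(1-3) S.genideal_ideal[OF hX]] .
  have Ic: "I \<subseteq> carrier R" using ideal.Icarr[OF I(1)] by auto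
  have "X \<subseteq> I" using S.genideal_self[OF hX] ring_iso_image_mono_iff[OF h X Ic] I by simp
  then show "h ` (Idl\<^bsub>R\<^esub> X) \<subseteq> Idl\<^bsub>S\<^esub> (h ` X)"
    using R.genideal_minimal[OF I(1)] I(2) by auto
qed

lemma ring_iso_image_maximalideal:
  assumes "ring R" "ring S" and h: "h \<in> ring_iso R S" and M: "maximalideal M R"
  shows "maximalideal (h ` M) S"
proof -
  interpret M: maximalideal M R by fact
  have surj: "h ` carrier R = carrier S"
    using ring_iso_memE(5)[OF h] by (simp add: bij_betw_def)
  have inj: "h ` X = h ` Y \<longleftrightarrow> X = Y" if "X \<subseteq> carrier R" "Y \<subseteq> carrier R" for X Y
    using ring_iso_image_image[OF h that(1)] ring_iso_image_image[OF h that(2)] by metis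
  show ?thesis
  proof (rule maximalidealI)
    show "ideal (h ` M) S" by (rule ring_iso_image_ideal[OF assms(1-3) M.is_ideal])
    show "carrier S \<noteq> h ` M"
      using M.I_notcarr inj[of "carrier R" M] surj M.a_subset by blast
    fix J assume J: "ideal J S" "h ` M \<subseteq> J" "J \<subseteq> carrier S"
    obtain I where I: "ideal I R" "J = h ` I"
      using ring_iso_ideal_eq_image[OF assms(1-3) J(1)] .
    have Ic: "I \<subseteq> carrier R" using ideal.Icarr[OF I(1)] by auto
    then have "M \<subseteq> I" using J(2) I ring_iso_image_mono_iff[OF h _ Ic] M.Icarr by blast
    then show "J = h ` M \<or> J = carrier S" using M.I_maximal[OF I(1)] Ic I surj by auto
  qed
qed

lemma ring_iso_image_primeideal:
  assumes "cring R" "cring S" and h: "h \<in> ring_iso R S" and P: "primeideal P R"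
  shows "primeideal (h ` P) S"
proof -
  interpret R: cring R by fact
  interpret S: cring S by fact
  have g: "inv_into (carrier R) h \<in> ring_iso S R"
    by (rule ring_iso_set_sym[OF R.ring_axioms h])
  interpret g: ring_hom_ring S R "inv_into (carrier R) h"
    using g by (intro ring_hom_ringI2 R.ring_axioms S.ring_axioms) (simp add: ring_iso_def)
  have "{s \<in> carrier S. inv_into (carrier R) h s \<in> P} = h ` P"
  proof -
    have "P \<subseteq> carrier R" using ideal.Icarr[OF primeideal.axioms(1)[OF P]] by auto
    then show ?thesis using ring_iso_memE(5)[OF h]
      by (auto simp: bij_betw_def inv_into_f_f f_inv_into_f subset_iff image_iff) (metis f_inv_into_f)
  qed
  then show ?thesis using g.primeideal_vimage[OF S.is_cring P] by simp
qed

text \<open>A chain of primes is mapped to a chain of the same length. Applied to an isomorphism and to its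
inverse, this gives the equality of dimensions.\<close>
lemma krull_dim_le_of_ring_iso:
  assumes "cring R" "cring S" and h: "h \<in> ring_iso R S"
  shows "krull_dim R \<le> krull_dim S"
  unfolding krull_dim_def
proof (rule SUP_subset_mono, rule subsetI)
  fix n assume "n \<in> {n. \<exists>P. (\<forall>i\<le>n. P i \<in> Spec R) \<and> (\<forall>i<n. P i \<subset> P (Suc i))}"
  then obtain P where P: "\<And>i. i \<le> n \<Longrightarrow> P i \<in> Spec R" "\<And>i. i < n \<Longrightarrow> P i \<subset> P (Suc i)"
    by auto
  have c: "P i \<subseteq> carrier R" if "i \<le> n" for i
    using P(1)[OF that] ideal.Icarr[OF primeideal.axioms(1)] by (auto simp: Spec_def)
  have "h ` P i \<subset> h ` P (Suc i)" if "i < n" for i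
    using P(2)[OF that] c[of i] c[of "Suc i"] that ring_iso_image_mono_iff[OF h]
    by (simp add: less_le_not_le)
  moreover have "h ` P i \<in> Spec S" if "i \<le> n" for i
    using ring_iso_image_primeideal[OF assms] P(1)[OF that] by (simp add: Spec_def)
  ultimately show "n \<in> {n. \<exists>P. (\<forall>i\<le>n. P i \<in> Spec S) \<and> (\<forall>i<n. P i \<subset> P (Suc i))}"
    by (intro CollectI exI[of _ "\<lambda>i. h ` P i"]) auto
qed simp

lemma regular_local_ring_of_ring_iso:
  assumes R: "cring R" and S: "cring S" and iso: "R \<simeq> S" and reg: "regular_local_ring R"
  shows "regular_local_ring S"
proof -
  interpret R: cring R by fact
  interpret S: cring S by fact
  obtain h where h: "h \<in> ring_iso R S" using iso by (auto simp: is_ring_iso_def)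
  define g where "g = inv_into (carrier R) h"
  have g: "g \<in> ring_iso S R" unfolding g_def by (rule ring_iso_set_sym[OF R.ring_axioms h])
  have hc: "h ` X \<subseteq> carrier S" if "X \<subseteq> carrier R" for X
    using that ring_iso_memE(1)[OF h] by auto
  note RS = R.ring_axioms S.ring_axioms
  have "noetherian_ring S"
  proof (rule S.noetherian_ringI)
    fix J assume "ideal J S"
    then obtain I where I: "ideal I R" "J = h ` I" using ring_iso_ideal_eq_image[OF RS h] by metis
    obtain A where A: "A \<subseteq> carrier R" "finite A" "I = Idl\<^bsub>R\<^esub> A"
      using noetherian_ring.finetely_gen[of R I] reg I by (auto simp: regular_local_ring_def)
    show "\<exists>A\<subseteq>carrier S. finite A \<and> J = Idl\<^bsub>S\<^esub> A"
      using A I ring_iso_image_genideal[OF RS h A(1)] hc[OF A(1)] by (intro exI[of _ "h ` A"]) auto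
  qed
  moreover have "\<exists>!M. maximalideal M S"
  proof -
    obtain M where M: "maximalideal M R" and u: "\<And>N. maximalideal N R \<Longrightarrow> N = M"
      using reg by (auto simp: regular_local_ring_def)
    have "N = h ` M" if N: "maximalideal N S" for N
    proof -
      have "ideal N S" using N by (rule maximalideal.axioms)
      then obtain I where I: "ideal I R" "N = h ` I" using ring_iso_ideal_eq_image[OF RS h] by metis
      have "g ` N = I" unfolding g_def I(2)
        using ideal.Icarr[OF I(1)] by (intro ring_iso_image_image[OF h]) auto
      then have "I = M" using ring_iso_image_maximalideal[OF RS(2,1) g N] u by simp
      then show ?thesis using I by simp
    qed
    then show ?thesis using ring_iso_image_maximalideal[OF RS h M] by blast
  qed
  moreover have "\<exists>X\<subseteq>carrier S. finite X \<and> enat (card X) = krull_dim S \<and> maximalideal (Idl\<^bsub>S\<^esub> X) S"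
  proof -
    obtain X where X: "X \<subseteq> carrier R" "finite X" "enat (card X) = krull_dim R"
        "maximalideal (Idl\<^bsub>R\<^esub> X) R"
      using reg by (auto simp: regular_local_ring_def)
    have "card (h ` X) = card X"
      using ring_iso_memE(5)[OF h] X(1) by (intro card_image) (auto simp: bij_betw_def inj_on_subset)
    moreover have "krull_dim R = krull_dim S"
      using krull_dim_le_of_ring_iso[OF R S h] krull_dim_le_of_ring_iso[OF S R g] by simp
    ultimately show ?thesis
      using X hc[OF X(1)] ring_iso_image_genideal[OF RS h X(1)] ring_iso_image_maximalideal[OF RS h X(4)]
      by (intro exI[of _ "h ` X"]) auto
  qed
  ultimately show ?thesis using S by (simp add: regular_local_ring_def)
qed

lemma regular_local_ring_cong_ring_iso:
  assumes "cring R" "cring S" "R \<simeq> S"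
  shows "regular_local_ring R \<longleftrightarrow> regular_local_ring S"
  using regular_local_ring_of_ring_iso[OF assms] regular_local_ring_of_ring_iso[OF assms(2,1)]
    ring_iso_sym[OF cring.axioms(1)[OF assms(1)] assms(3)] by auto

section \<open>Localization at a central multiplicative set\<close>

text \<open>Three localizations occur below: that of \<open>A\<^sup>0\<close> at a prime, that of \<open>H\<^sup>0(A)\<close> at a prime, and that of
the whole of \<open>A\<close> at elements of degree \<open>0\<close>. The last ring is only graded commutative, but
elements of degree \<open>0\<close> are central in it. Fractions over a central multiplicative set treat all three at
once; in the commutative case the formulas are those for the localization at a prime with the
complement of the prime replaced by \<open>S\<close>.\<close>
definition loc_frac :: "('a, 'm) ring_scheme \<Rightarrow> 'a set \<Rightarrow> 'a \<Rightarrow> 'a \<Rightarrow> ('a \<times> 'a) set" where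
  "loc_frac R S a s = {(b, t). b \<in> carrier R \<and> t \<in> S \<and>
     (\<exists>u \<in> S. u \<otimes>\<^bsub>R\<^esub> (a \<otimes>\<^bsub>R\<^esub> t) = u \<otimes>\<^bsub>R\<^esub> (b \<otimes>\<^bsub>R\<^esub> s))}"

definition loc :: "('a, 'm) ring_scheme \<Rightarrow> 'a set \<Rightarrow> ('a \<times> 'a) set ring" where
  "loc R S =
    \<lparr>carrier = {loc_frac R S a s | a s. a \<in> carrier R \<and> s \<in> S},
     monoid.mult = (\<lambda>X Y. \<Union>x\<in>X. \<Union>y\<in>Y. loc_frac R S (fst x \<otimes>\<^bsub>R\<^esub> fst y) (snd x \<otimes>\<^bsub>R\<^esub> snd y)),
     one = loc_frac R S \<one>\<^bsub>R\<^esub> \<one>\<^bsub>R\<^esub>,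
     ring.zero = loc_frac R S \<zero>\<^bsub>R\<^esub> \<one>\<^bsub>R\<^esub>,
     add = (\<lambda>X Y. \<Union>x\<in>X. \<Union>y\<in>Y.
       loc_frac R S ((fst x \<otimes>\<^bsub>R\<^esub> snd y) \<oplus>\<^bsub>R\<^esub> (fst y \<otimes>\<^bsub>R\<^esub> snd x)) (snd x \<otimes>\<^bsub>R\<^esub> snd y))\<rparr>"

lemma fraction_eq_frac: "fraction R P = loc_frac R (carrier R - P)"
  by (simp add: fraction_def loc_frac_def fun_eq_iff)

lemma localization_eq_loc: "localization R P = loc R (carrier R - P)"
  by (simp add: localization_def loc_def fraction_eq_frac)

locale central_mult_set = ring R for R (structure) +
  fixes S
  assumes S_subset: "S \<subseteq> carrier R"
    and one_S: "\<one> \<in> S"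
    and mult_S: "s \<in> S \<Longrightarrow> t \<in> S \<Longrightarrow> s \<otimes> t \<in> S"
    and central: "s \<in> S \<Longrightarrow> x \<in> carrier R \<Longrightarrow> x \<otimes> s = s \<otimes> x"
begin

lemma S_carrier [simp]: "s \<in> S \<Longrightarrow> s \<in> carrier R"
  using S_subset by auto

lemmas S_closed [simp] = one_S mult_S

lemma central_left: "s \<in> S \<Longrightarrow> x \<in> carrier R \<Longrightarrow> y \<in> carrier R \<Longrightarrow> x \<otimes> (s \<otimes> y) = s \<otimes> (x \<otimes> y)"
  by (simp add: m_assoc[symmetric] central)

text \<open>As conditional permutative rules, these bring a product with at most one factor outside \<open>S\<close>
  into a normal form, exactly as the laws of a commutative monoid would.\<close>
lemmas central_ac = m_assoc central central[symmetric] central_left central_left[symmetric]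

lemma frac_self: "a \<in> carrier R \<Longrightarrow> s \<in> S \<Longrightarrow> (a, s) \<in> loc_frac R S a s"
  by (auto simp: loc_frac_def intro: one_S)

lemma frac_mem:
  assumes "x \<in> loc_frac R S a s"
  shows "fst x \<in> carrier R" "snd x \<in> S"
  using assms by (auto simp: loc_frac_def)

text \<open>Transitivity of the equivalence of fractions: the factor \<open>u v t\<close> is a common witness, because
\<open>a t = b s\<close> and \<open>b w = c t\<close> give \<open>a t w = c t s\<close>.\<close>
lemma frac_rel_trans:
  assumes abc: "a \<in> carrier R" "b \<in> carrier R" "c \<in> carrier R" and stw: "s \<in> S" "t \<in> S" "w \<in> S"
    and u: "u \<in> S" "u \<otimes> (a \<otimes> t) = u \<otimes> (b \<otimes> s)" and v: "v \<in> S" "v \<otimes> (b \<otimes> w) = v \<otimes> (c \<otimes> t)"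
  shows "(u \<otimes> (v \<otimes> t)) \<otimes> (a \<otimes> w) = (u \<otimes> (v \<otimes> t)) \<otimes> (c \<otimes> s)"
proof -
  have "(u \<otimes> (v \<otimes> t)) \<otimes> (a \<otimes> w) = (u \<otimes> (a \<otimes> t)) \<otimes> (v \<otimes> w)"
    using abc stw u(1) v(1) by (simp add: central_ac)
  also have "\<dots> = (v \<otimes> (b \<otimes> w)) \<otimes> (u \<otimes> s)"
    unfolding u(2) using abc stw u(1) v(1) by (simp add: central_ac)
  also have "\<dots> = (u \<otimes> (v \<otimes> t)) \<otimes> (c \<otimes> s)"
    unfolding v(2) using abc stw u(1) v(1) by (simp add: central_ac)
  finally show ?thesis .
qed

lemma frac_eq_iff:
  assumes ab: "a \<in> carrier R" "b \<in> carrier R" and st: "s \<in> S" "t \<in> S"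
  shows "loc_frac R S a s = loc_frac R S b t \<longleftrightarrow> (\<exists>u\<in>S. u \<otimes> (a \<otimes> t) = u \<otimes> (b \<otimes> s))"
proof
  assume "loc_frac R S a s = loc_frac R S b t"
  then have "(b, t) \<in> loc_frac R S a s" using frac_self[OF ab(2) st(2)] by simp
  then show "\<exists>u\<in>S. u \<otimes> (a \<otimes> t) = u \<otimes> (b \<otimes> s)" by (auto simp: loc_frac_def)
next
  assume "\<exists>u\<in>S. u \<otimes> (a \<otimes> t) = u \<otimes> (b \<otimes> s)"
  then obtain u where u: "u \<in> S" "u \<otimes> (a \<otimes> t) = u \<otimes> (b \<otimes> s)" by auto
  have "x \<in> loc_frac R S a s" if x: "x \<in> loc_frac R S b t" for x
  proof -
    obtain c w v where x: "x = (c, w)" "c \<in> carrier R" "w \<in> S" "v \<in> S" "v \<otimes> (b \<otimes> w) = v \<otimes> (c \<otimes> t)"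
      using x by (auto simp: loc_frac_def)
    have "u \<otimes> (v \<otimes> t) \<in> S" using u x st by simp
    then show ?thesis
      using frac_rel_trans[OF ab(1,2) x(2) st x(3) u x(4,5)] x by (auto simp: loc_frac_def)
  qed
  moreover have "x \<in> loc_frac R S b t" if x: "x \<in> loc_frac R S a s" for x
  proof -
    obtain c w v where x: "x = (c, w)" "c \<in> carrier R" "w \<in> S" "v \<in> S" "v \<otimes> (a \<otimes> w) = v \<otimes> (c \<otimes> s)"
      using x by (auto simp: loc_frac_def)
    have "u \<otimes> (v \<otimes> s) \<in> S" using u x st by simp
    then show ?thesis
      using frac_rel_trans[OF ab(2,1) x(2) st(2,1) x(3) u(1) u(2)[symmetric] x(4,5)] x
      by (auto simp: loc_frac_def)
  qed
  ultimately show "loc_frac R S a s = loc_frac R S b t" by auto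
qed

lemma frac_of_mem:
  assumes "x \<in> loc_frac R S a s" "a \<in> carrier R" "s \<in> S"
  shows "loc_frac R S (fst x) (snd x) = loc_frac R S a s"
proof -
  have "\<exists>u\<in>S. u \<otimes> (a \<otimes> snd x) = u \<otimes> (fst x \<otimes> s)" using assms(1) by (auto simp: loc_frac_def)
  then show ?thesis using frac_eq_iff[of a "fst x" s "snd x"] frac_mem[OF assms(1)] assms by simp
qed

lemma frac_cancel:
  assumes "a \<in> carrier R" "s \<in> S" "t \<in> S"
  shows "loc_frac R S (a \<otimes> t) (s \<otimes> t) = loc_frac R S a s"
  using assms by (subst frac_eq_iff) (auto intro!: bexI[of _ \<one>] simp: central_ac)

lemma mult_interchange:
  assumes "a \<in> carrier R" "b \<in> carrier R" "s \<in> S" "t \<in> S"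
  shows "(a \<otimes> s) \<otimes> (b \<otimes> t) = (a \<otimes> b) \<otimes> (s \<otimes> t)"
proof -
  have "s \<otimes> (b \<otimes> t) = b \<otimes> (s \<otimes> t)" using assms central_left[of s b t] by simp
  then show ?thesis using assms by (simp add: m_assoc)
qed

text \<open>The operations of the localization are unions over all representatives. If a term does not depend on
the representative, the union has one member and any representative computes it.\<close>
lemma UN_frac:
  assumes "a \<in> carrier R" "s \<in> S"
    and "\<And>b t. b \<in> carrier R \<Longrightarrow> t \<in> S \<Longrightarrow> loc_frac R S b t = loc_frac R S a s \<Longrightarrow> F (b, t) = F (a, s)"
  shows "(\<Union>x\<in>loc_frac R S a s. F x) = F (a, s)"
proof -
  have "F x = F (a, s)" if "x \<in> loc_frac R S a s" for x
    using assms(3)[OF frac_mem[OF that] frac_of_mem[OF that assms(1,2)]] by simp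
  then show ?thesis using frac_self[OF assms(1,2)] by blast
qed

lemma frac_mult_cong_left:
  assumes "a \<in> carrier R" "b \<in> carrier R" "c \<in> carrier R" "s \<in> S" "t \<in> S" "w \<in> S"
    and "loc_frac R S a s = loc_frac R S b t"
  shows "loc_frac R S (a \<otimes> c) (s \<otimes> w) = loc_frac R S (b \<otimes> c) (t \<otimes> w)"
proof -
  obtain u where u: "u \<in> S" "u \<otimes> (a \<otimes> t) = u \<otimes> (b \<otimes> s)"
    using assms by (auto simp: frac_eq_iff)
  have shift: "u \<otimes> ((x \<otimes> c) \<otimes> (r \<otimes> w)) = (u \<otimes> (x \<otimes> r)) \<otimes> (c \<otimes> w)"
    if "x \<in> carrier R" "r \<in> S" for x r
    using that assms(3,6) u(1) mult_interchange[of x c r w] m_assoc[of u "x \<otimes> r" "c \<otimes> w"] by simp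
  have "u \<otimes> ((a \<otimes> c) \<otimes> (t \<otimes> w)) = u \<otimes> ((b \<otimes> c) \<otimes> (s \<otimes> w))"
    using assms(1,2,4,5) shift u(2) by simp
  then show ?thesis using assms(1-6) u(1) by (subst frac_eq_iff) auto
qed

lemma frac_mult_cong_right:
  assumes "a \<in> carrier R" "b \<in> carrier R" "c \<in> carrier R" "s \<in> S" "t \<in> S" "w \<in> S"
    and "loc_frac R S a s = loc_frac R S b t"
  shows "loc_frac R S (c \<otimes> a) (w \<otimes> s) = loc_frac R S (c \<otimes> b) (w \<otimes> t)"
proof -
  obtain u where u: "u \<in> S" "u \<otimes> (a \<otimes> t) = u \<otimes> (b \<otimes> s)"
    using assms by (auto simp: frac_eq_iff)
  have shift: "u \<otimes> ((c \<otimes> x) \<otimes> (w \<otimes> r)) = (c \<otimes> w) \<otimes> (u \<otimes> (x \<otimes> r))"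
    if "x \<in> carrier R" "r \<in> S" for x r
    using that assms(3,6) u(1) mult_interchange[of c x w r] central_left[of u "c \<otimes> w" "x \<otimes> r"] by simp
  have "u \<otimes> ((c \<otimes> a) \<otimes> (w \<otimes> t)) = u \<otimes> ((c \<otimes> b) \<otimes> (w \<otimes> s))"
    using assms(1,2,4,5) shift u(2) by simp
  then show ?thesis using assms(1-6) u(1) by (subst frac_eq_iff) auto
qed

lemma frac_add_cong:
  assumes "a \<in> carrier R" "b \<in> carrier R" "c \<in> carrier R" "s \<in> S" "t \<in> S" "w \<in> S"
    and "loc_frac R S a s = loc_frac R S b t"
  shows "loc_frac R S (a \<otimes> w \<oplus> c \<otimes> s) (s \<otimes> w) = loc_frac R S (b \<otimes> w \<oplus> c \<otimes> t) (t \<otimes> w)"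
proof -
  obtain u where u: "u \<in> S" "u \<otimes> (a \<otimes> t) = u \<otimes> (b \<otimes> s)"
    using assms by (auto simp: frac_eq_iff)
  have "u \<otimes> ((a \<otimes> w \<oplus> c \<otimes> s) \<otimes> (t \<otimes> w)) = (u \<otimes> (a \<otimes> t)) \<otimes> (w \<otimes> w) \<oplus> u \<otimes> (c \<otimes> (s \<otimes> (t \<otimes> w)))"
    using assms(1-6) u(1) by (simp add: l_distr r_distr central_ac)
  also have "\<dots> = u \<otimes> ((b \<otimes> w \<oplus> c \<otimes> t) \<otimes> (s \<otimes> w))"
    unfolding u(2) using assms(1-6) u(1) by (simp add: l_distr r_distr central_ac)
  finally show ?thesis using assms(1-6) u(1) by (subst frac_eq_iff) auto
qed

lemma loc_carrier: "X \<in> carrier (loc R S) \<longleftrightarrow> (\<exists>a\<in>carrier R. \<exists>s\<in>S. X = loc_frac R S a s)"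
  by (auto simp: loc_def)

lemma frac_in_loc [simp]: "a \<in> carrier R \<Longrightarrow> s \<in> S \<Longrightarrow> loc_frac R S a s \<in> carrier (loc R S)"
  by (auto simp: loc_carrier)

lemma loc_mult:
  assumes "a \<in> carrier R" "b \<in> carrier R" "s \<in> S" "t \<in> S"
  shows "loc_frac R S a s \<otimes>\<^bsub>loc R S\<^esub> loc_frac R S b t = loc_frac R S (a \<otimes> b) (s \<otimes> t)"
proof -
  have right: "(\<Union>y\<in>loc_frac R S b t. loc_frac R S (c \<otimes> fst y) (w \<otimes> snd y)) = loc_frac R S (c \<otimes> b) (w \<otimes> t)"
    if "c \<in> carrier R" "w \<in> S" for c w
    by (subst UN_frac[where F = "\<lambda>y. loc_frac R S (c \<otimes> fst y) (w \<otimes> snd y)"], fact, fact)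
      (simp_all only: fst_conv snd_conv, rule frac_mult_cong_right, simp_all only: assms that)
  have left: "(\<Union>x\<in>loc_frac R S a s. loc_frac R S (fst x \<otimes> b) (snd x \<otimes> t)) = loc_frac R S (a \<otimes> b) (s \<otimes> t)"
    by (subst UN_frac[where F = "\<lambda>x. loc_frac R S (fst x \<otimes> b) (snd x \<otimes> t)"], fact, fact)
      (simp_all only: fst_conv snd_conv, rule frac_mult_cong_left, simp_all only: assms)
  have "loc_frac R S a s \<otimes>\<^bsub>loc R S\<^esub> loc_frac R S b t
      = (\<Union>x\<in>loc_frac R S a s. \<Union>y\<in>loc_frac R S b t. loc_frac R S (fst x \<otimes> fst y) (snd x \<otimes> snd y))"
    by (simp add: loc_def)
  also have "\<dots> = (\<Union>x\<in>loc_frac R S a s. loc_frac R S (fst x \<otimes> b) (snd x \<otimes> t))"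
    by (rule SUP_cong[OF refl], rule right) (rule frac_mem, assumption)+
  finally show ?thesis using left by simp
qed

lemma loc_add_general:
  assumes "a \<in> carrier R" "b \<in> carrier R" "s \<in> S" "t \<in> S"
  shows "loc_frac R S a s \<oplus>\<^bsub>loc R S\<^esub> loc_frac R S b t = loc_frac R S (a \<otimes> t \<oplus> b \<otimes> s) (s \<otimes> t)"
proof -
  have right: "(\<Union>y\<in>loc_frac R S b t. loc_frac R S (c \<otimes> snd y \<oplus> fst y \<otimes> w) (w \<otimes> snd y))
      = loc_frac R S (c \<otimes> t \<oplus> b \<otimes> w) (w \<otimes> t)" if c: "c \<in> carrier R" "w \<in> S" for c w
  proof -
    have swap: "loc_frac R S (c \<otimes> t' \<oplus> b' \<otimes> w) (w \<otimes> t') = loc_frac R S (c \<otimes> t \<oplus> b \<otimes> w) (w \<otimes> t)"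
      if b': "b' \<in> carrier R" "t' \<in> S" "loc_frac R S b' t' = loc_frac R S b t" for b' t'
    proof -
      have "c \<otimes> t' \<oplus> b' \<otimes> w = b' \<otimes> w \<oplus> c \<otimes> t'" "c \<otimes> t \<oplus> b \<otimes> w = b \<otimes> w \<oplus> c \<otimes> t"
        "w \<otimes> t' = t' \<otimes> w" "w \<otimes> t = t \<otimes> w"
        using b' c assms by (simp_all add: a_comm central[of t] central[of t'])
      then show ?thesis using frac_add_cong[of b' b c t' t w] b' c assms by (simp only:)
    qed
    show ?thesis
      by (subst UN_frac[where F = "\<lambda>y. loc_frac R S (c \<otimes> snd y \<oplus> fst y \<otimes> w) (w \<otimes> snd y)"], fact, fact)
        (simp_all only: fst_conv snd_conv, rule swap)
  qed
  have left: "(\<Union>x\<in>loc_frac R S a s. loc_frac R S (fst x \<otimes> t \<oplus> b \<otimes> snd x) (snd x \<otimes> t))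
      = loc_frac R S (a \<otimes> t \<oplus> b \<otimes> s) (s \<otimes> t)"
    by (subst UN_frac[where F = "\<lambda>x. loc_frac R S (fst x \<otimes> t \<oplus> b \<otimes> snd x) (snd x \<otimes> t)"], fact, fact)
      (simp_all only: fst_conv snd_conv, rule frac_add_cong, simp_all only: assms)
  have "loc_frac R S a s \<oplus>\<^bsub>loc R S\<^esub> loc_frac R S b t = (\<Union>x\<in>loc_frac R S a s. \<Union>y\<in>loc_frac R S b t.
        loc_frac R S (fst x \<otimes> snd y \<oplus> fst y \<otimes> snd x) (snd x \<otimes> snd y))"
    by (simp add: loc_def)
  also have "\<dots> = (\<Union>x\<in>loc_frac R S a s. loc_frac R S (fst x \<otimes> t \<oplus> b \<otimes> snd x) (snd x \<otimes> t))"
    by (rule SUP_cong[OF refl], rule right) (rule frac_mem, assumption)+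
  finally show ?thesis using left by simp
qed

lemma loc_add:
  assumes "a \<in> carrier R" "b \<in> carrier R" "s \<in> S"
  shows "loc_frac R S a s \<oplus>\<^bsub>loc R S\<^esub> loc_frac R S b s = loc_frac R S (a \<oplus> b) s"
  using assms frac_cancel[of "a \<oplus> b" s s] by (simp add: loc_add_general l_distr)

lemma loc_one: "\<one>\<^bsub>loc R S\<^esub> = loc_frac R S \<one> \<one>"
  by (simp add: loc_def)

lemma loc_zero: "s \<in> S \<Longrightarrow> \<zero>\<^bsub>loc R S\<^esub> = loc_frac R S \<zero> s"
  using one_S by (auto simp: loc_def frac_eq_iff)

text \<open>Common denominators reduce the laws of addition in the localization to those of \<open>R\<close>.\<close>
lemma common_denominator2:
  assumes "X \<in> carrier (loc R S)" "Y \<in> carrier (loc R S)"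
  obtains a b s where "a \<in> carrier R" "b \<in> carrier R" "s \<in> S" "X = loc_frac R S a s" "Y = loc_frac R S b s"
proof -
  obtain a s where a: "a \<in> carrier R" "s \<in> S" "X = loc_frac R S a s" using assms by (auto simp: loc_carrier)
  obtain b t where b: "b \<in> carrier R" "t \<in> S" "Y = loc_frac R S b t" using assms by (auto simp: loc_carrier)
  have "X = loc_frac R S (a \<otimes> t) (s \<otimes> t)" using a b by (simp add: frac_cancel)
  moreover have "Y = loc_frac R S (b \<otimes> s) (s \<otimes> t)"
    using a b frac_cancel[of b t s] central[of s t] by simp
  ultimately show ?thesis using that[of "a \<otimes> t" "b \<otimes> s" "s \<otimes> t"] a b by simp
qed

lemma common_denominator3:
  assumes "X \<in> carrier (loc R S)" "Y \<in> carrier (loc R S)" "Z \<in> carrier (loc R S)"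
  obtains a b c s where "a \<in> carrier R" "b \<in> carrier R" "c \<in> carrier R" "s \<in> S"
    "X = loc_frac R S a s" "Y = loc_frac R S b s" "Z = loc_frac R S c s"
proof -
  obtain a b s where a: "a \<in> carrier R" "b \<in> carrier R" "s \<in> S" "X = loc_frac R S a s" "Y = loc_frac R S b s"
    using common_denominator2[OF assms(1,2)] .
  obtain c t where c: "c \<in> carrier R" "t \<in> S" "Z = loc_frac R S c t" using assms by (auto simp: loc_carrier)
  have "X = loc_frac R S (a \<otimes> t) (s \<otimes> t)" "Y = loc_frac R S (b \<otimes> t) (s \<otimes> t)"
    using a c by (simp_all add: frac_cancel)
  moreover have "Z = loc_frac R S (c \<otimes> s) (s \<otimes> t)"
    using a c frac_cancel[of c t s] central[of s t] by simp
  ultimately show ?thesis using that[of "a \<otimes> t" "b \<otimes> t" "c \<otimes> s" "s \<otimes> t"] a c by simp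
qed

lemma ring_loc: "ring (loc R S)"
proof (rule ringI)
  show "abelian_group (loc R S)"
  proof (rule abelian_groupI)
    fix X Y assume "X \<in> carrier (loc R S)" "Y \<in> carrier (loc R S)"
    then obtain a b s where "a \<in> carrier R" "b \<in> carrier R" "s \<in> S" "X = loc_frac R S a s" "Y = loc_frac R S b s"
      by (rule common_denominator2)
    then show "X \<oplus>\<^bsub>loc R S\<^esub> Y \<in> carrier (loc R S)" "X \<oplus>\<^bsub>loc R S\<^esub> Y = Y \<oplus>\<^bsub>loc R S\<^esub> X"
      by (auto simp: loc_add a_comm)
  next
    show "\<zero>\<^bsub>loc R S\<^esub> \<in> carrier (loc R S)" by (simp add: loc_zero[of \<one>])
  next
    fix X Y Z assume "X \<in> carrier (loc R S)" "Y \<in> carrier (loc R S)" "Z \<in> carrier (loc R S)"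
    then obtain a b c s where "a \<in> carrier R" "b \<in> carrier R" "c \<in> carrier R" "s \<in> S"
      "X = loc_frac R S a s" "Y = loc_frac R S b s" "Z = loc_frac R S c s"
      by (rule common_denominator3)
    then show "X \<oplus>\<^bsub>loc R S\<^esub> Y \<oplus>\<^bsub>loc R S\<^esub> Z = X \<oplus>\<^bsub>loc R S\<^esub> (Y \<oplus>\<^bsub>loc R S\<^esub> Z)"
      by (simp add: loc_add a_assoc)
  next
    fix X assume "X \<in> carrier (loc R S)"
    then obtain a s where a: "a \<in> carrier R" "s \<in> S" "X = loc_frac R S a s" by (auto simp: loc_carrier)
    then show "\<zero>\<^bsub>loc R S\<^esub> \<oplus>\<^bsub>loc R S\<^esub> X = X" by (simp add: loc_zero[of s] loc_add)
    show "\<exists>Y\<in>carrier (loc R S). Y \<oplus>\<^bsub>loc R S\<^esub> X = \<zero>\<^bsub>loc R S\<^esub>"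
      using a by (intro bexI[of _ "loc_frac R S (\<ominus> a) s"]) (auto simp: loc_zero[of s] loc_add l_neg)
  qed
  show "Group.monoid (loc R S)"
  proof (rule monoidI)
    fix X Y assume "X \<in> carrier (loc R S)" "Y \<in> carrier (loc R S)"
    then show "X \<otimes>\<^bsub>loc R S\<^esub> Y \<in> carrier (loc R S)" by (auto simp: loc_carrier loc_mult)
        (use m_closed mult_S in blast)
  next
    show "\<one>\<^bsub>loc R S\<^esub> \<in> carrier (loc R S)" by (simp add: loc_one)
  qed (auto simp: loc_carrier loc_mult loc_one m_assoc)
  fix X Y Z assume "X \<in> carrier (loc R S)" "Y \<in> carrier (loc R S)" "Z \<in> carrier (loc R S)"
  then obtain a b c s where "a \<in> carrier R" "b \<in> carrier R" "c \<in> carrier R" "s \<in> S"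
    "X = loc_frac R S a s" "Y = loc_frac R S b s" "Z = loc_frac R S c s"
    by (rule common_denominator3)
  then show "(X \<oplus>\<^bsub>loc R S\<^esub> Y) \<otimes>\<^bsub>loc R S\<^esub> Z = X \<otimes>\<^bsub>loc R S\<^esub> Z \<oplus>\<^bsub>loc R S\<^esub> Y \<otimes>\<^bsub>loc R S\<^esub> Z"
    "Z \<otimes>\<^bsub>loc R S\<^esub> (X \<oplus>\<^bsub>loc R S\<^esub> Y) = Z \<otimes>\<^bsub>loc R S\<^esub> X \<oplus>\<^bsub>loc R S\<^esub> Z \<otimes>\<^bsub>loc R S\<^esub> Y"
    by (simp_all add: loc_add loc_mult l_distr r_distr)
qed

lemma loc_a_inv:
  assumes "a \<in> carrier R" "s \<in> S"
  shows "\<ominus>\<^bsub>loc R S\<^esub> loc_frac R S a s = loc_frac R S (\<ominus> a) s"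
proof -
  interpret L: ring "loc R S" by (rule ring_loc)
  show ?thesis using assms
    by (intro L.minus_equality) (auto simp: loc_add loc_zero[of s] l_neg)
qed

lemma frac_eq_zero_iff:
  assumes "a \<in> carrier R" "s \<in> S"
  shows "loc_frac R S a s = \<zero>\<^bsub>loc R S\<^esub> \<longleftrightarrow> (\<exists>u\<in>S. u \<otimes> a = \<zero>)"
  using assms by (simp add: loc_zero[of \<one>] frac_eq_iff)

end

text \<open>The map \<open>a / s \<mapsto> g a / \<sigma> s\<close>. As for the ring operations, a union over representatives takes
the place of a choice. The differential, the projections to the graded components and the
map to \<open>H\<^sup>0\<close> all pass to fractions in this way.\<close>
definition loc_map :: "('b, 'n) ring_scheme \<Rightarrow> 'b set \<Rightarrow> ('a \<Rightarrow> 'b) \<Rightarrow> ('a \<Rightarrow> 'b)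
    \<Rightarrow> ('a \<times> 'a) set \<Rightarrow> ('b \<times> 'b) set" where
  "loc_map R' S' g \<sigma> X = (\<Union>x\<in>X. loc_frac R' S' (g (fst x)) (\<sigma> (snd x)))"

text \<open>Linearity over \<open>\<sigma>\<close> turns the relation \<open>u b s = u a t\<close> between two fractions into the corresponding
relation between their images.\<close>
lemma loc_map_frac:
  assumes R: "central_mult_set R S" and R': "central_mult_set R' S'"
    and g: "\<And>x. x \<in> carrier R \<Longrightarrow> g x \<in> carrier R'"
    and \<sigma>: "\<And>s. s \<in> S \<Longrightarrow> \<sigma> s \<in> S'"
    and linear: "\<And>s x. s \<in> S \<Longrightarrow> x \<in> carrier R \<Longrightarrow> g (s \<otimes>\<^bsub>R\<^esub> x) = \<sigma> s \<otimes>\<^bsub>R'\<^esub> g x"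
    and as: "a \<in> carrier R" "s \<in> S"
  shows "loc_map R' S' g \<sigma> (loc_frac R S a s) = loc_frac R' S' (g a) (\<sigma> s)"
proof -
  interpret R: central_mult_set R S by fact
  interpret R': central_mult_set R' S' by fact
  have well_def: "loc_frac R' S' (g b) (\<sigma> t) = loc_frac R' S' (g a) (\<sigma> s)"
    if b: "b \<in> carrier R" "t \<in> S" "loc_frac R S b t = loc_frac R S a s" for b t
  proof -
    obtain u where u: "u \<in> S" "u \<otimes>\<^bsub>R\<^esub> (b \<otimes>\<^bsub>R\<^esub> s) = u \<otimes>\<^bsub>R\<^esub> (a \<otimes>\<^bsub>R\<^esub> t)"
      using b as by (auto simp: R.frac_eq_iff)
    have "u \<otimes>\<^bsub>R\<^esub> (s \<otimes>\<^bsub>R\<^esub> b) = u \<otimes>\<^bsub>R\<^esub> (t \<otimes>\<^bsub>R\<^esub> a)"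
      using u(2) by (simp only: R.central[OF as(2) b(1)] R.central[OF b(2) as(1)])
    then have "g (u \<otimes>\<^bsub>R\<^esub> (s \<otimes>\<^bsub>R\<^esub> b)) = g (u \<otimes>\<^bsub>R\<^esub> (t \<otimes>\<^bsub>R\<^esub> a))" by (rule arg_cong)
    moreover have "g (u \<otimes>\<^bsub>R\<^esub> (r \<otimes>\<^bsub>R\<^esub> x)) = \<sigma> u \<otimes>\<^bsub>R'\<^esub> (g x \<otimes>\<^bsub>R'\<^esub> \<sigma> r)"
      if "r \<in> S" "x \<in> carrier R" for r x
      using that u(1) by (simp only: linear R.S_carrier R.m_closed R'.central[OF \<sigma> g])
    ultimately have "\<sigma> u \<otimes>\<^bsub>R'\<^esub> (g b \<otimes>\<^bsub>R'\<^esub> \<sigma> s) = \<sigma> u \<otimes>\<^bsub>R'\<^esub> (g a \<otimes>\<^bsub>R'\<^esub> \<sigma> t)"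
      using b(1,2) as by simp
    then show ?thesis
      using \<sigma>[OF u(1)] R'.frac_eq_iff[OF g[OF b(1)] g[OF as(1)] \<sigma>[OF b(2)] \<sigma>[OF as(2)]] by blast
  qed
  show ?thesis
    unfolding loc_map_def
    by (subst R.UN_frac[where F = "\<lambda>x. loc_frac R' S' (g (fst x)) (\<sigma> (snd x))"], fact, fact)
      (simp_all only: fst_conv snd_conv, rule well_def)
qed

lemma (in cring) central_mult_set_prime_complement:
  assumes "primeideal P R"
  shows "central_mult_set R (carrier R - P)"
proof -
  interpret P: primeideal P R by fact
  have "\<one> \<notin> P" using P.I_notcarr P.one_imp_carrier by auto
  then show ?thesis
    by unfold_locales (auto simp: m_comm dest: P.I_prime)
qed

lemma cring_localization:
  assumes "cring R" "primeideal P R"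
  shows "cring (localization R P)"
proof -
  interpret R: cring R by fact
  interpret L: central_mult_set R "carrier R - P"
    by (rule R.central_mult_set_prime_complement[OF assms(2)])
  interpret Q: ring "loc R (carrier R - P)" by (rule L.ring_loc)
  have "cring (loc R (carrier R - P))"
    by unfold_locales (auto simp: L.loc_carrier L.loc_mult R.m_comm)
  then show ?thesis by (simp add: localization_eq_loc)
qed

section \<open>Graded components\<close>

definition component :: "('a, 'm) dg_ring_scheme \<Rightarrow> 'a \<Rightarrow> int \<Rightarrow> 'a" where
  "component A x = (THE f. (\<forall>n. f n \<in> grade A n) \<and> finite {n. f n \<noteq> \<zero>\<^bsub>A\<^esub>} \<and>
     x = (\<Oplus>\<^bsub>A\<^esub>n\<in>{n. f n \<noteq> \<zero>\<^bsub>A\<^esub>}. f n))"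

context comm_dg_ring
begin

lemma grade_carrier: "x \<in> grade A n \<Longrightarrow> x \<in> carrier A"
  using grade_subset by auto

lemma grade_zero [simp]: "\<zero> \<in> grade A n"
  using subgroup.one_closed[OF grade_subgroup[of n]] by simp

lemma grade_add: "x \<in> grade A n \<Longrightarrow> y \<in> grade A n \<Longrightarrow> x \<oplus> y \<in> grade A n"
  using subgroup.m_closed[OF grade_subgroup[of n]] by simp

lemma grade_a_inv: "x \<in> grade A n \<Longrightarrow> \<ominus> x \<in> grade A n"
  using subgroup.m_inv_closed[OF grade_subgroup[of n]] by (simp add: a_inv_def)

lemma component_spec:
  assumes "x \<in> carrier A"
  shows "\<forall>n. component A x n \<in> grade A n" "finite {n. component A x n \<noteq> \<zero>}"
    "x = (\<Oplus>n\<in>{n. component A x n \<noteq> \<zero>}. component A x n)"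
  using theI'[OF grade_direct_sum[OF assms], folded component_def] by blast+

lemma component_grade: "x \<in> carrier A \<Longrightarrow> component A x n \<in> grade A n"
  using component_spec(1) by blast

lemma finsum_support:
  assumes "finite F" "{n. f n \<noteq> \<zero>} \<subseteq> F" "\<And>n. f n \<in> carrier A"
  shows "(\<Oplus>n\<in>{n. f n \<noteq> \<zero>}. f n) = (\<Oplus>n\<in>F. f n)"
  using assms by (intro add.finprod_mono_neutral_cong_left) auto

lemma component_eqI:
  assumes f: "\<And>n. f n \<in> grade A n" and "finite F" "{n. f n \<noteq> \<zero>} \<subseteq> F" and x: "x = (\<Oplus>n\<in>F. f n)"
  shows "component A x = f"
proof -
  have c: "f n \<in> carrier A" for n using f grade_carrier by blast
  then have "x \<in> carrier A" unfolding x by (intro finsum_closed) auto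
  moreover have "x = (\<Oplus>n\<in>{n. f n \<noteq> \<zero>}. f n)" using finsum_support[OF assms(2,3) c] x by simp
  ultimately show ?thesis
    using the1_equality[OF grade_direct_sum, of x f] f finite_subset[OF assms(3,2)]
    by (simp add: component_def)
qed

lemma component_add:
  assumes x: "x \<in> carrier A" and y: "y \<in> carrier A"
  shows "component A (x \<oplus> y) n = component A x n \<oplus> component A y n"
proof -
  define F where "F = {n. component A x n \<noteq> \<zero>} \<union> {n. component A y n \<noteq> \<zero>}"
  have F: "finite F" using component_spec(2)[OF x] component_spec(2)[OF y] by (simp add: F_def)
  have c: "component A z n \<in> carrier A" if "z \<in> carrier A" for z n
    using component_grade[OF that] grade_carrier by blast
  have sum: "z = (\<Oplus>n\<in>F. component A z n)" if "z \<in> {x, y}" for z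
    using component_spec(3)[of z] finsum_support[OF F, of "component A z"] that x y c
    by (auto simp: F_def)
  have "x \<oplus> y = (\<Oplus>n\<in>F. component A x n) \<oplus> (\<Oplus>n\<in>F. component A y n)"
    using sum[of x] sum[of y] by simp
  also have "\<dots> = (\<Oplus>n\<in>F. component A x n \<oplus> component A y n)"
    using c x y by (intro finsum_addf[symmetric]) auto
  finally have "component A (x \<oplus> y) = (\<lambda>n. component A x n \<oplus> component A y n)"
    using F component_grade x y by (intro component_eqI[of _ F]) (auto simp: F_def intro: grade_add)
  then show ?thesis by simp
qed

lemma component_homogeneous:
  assumes "x \<in> grade A n"
  shows "component A x m = (if m = n then x else \<zero>)"
proof -
  have "component A x = (\<lambda>m. if m = n then x else \<zero>)"
    using assms grade_carrier[OF assms] finsum_insert[of "{}" n "\<lambda>m. if m = n then x else \<zero>"]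
    by (intro component_eqI[of _ "{n}"]) auto
  then show ?thesis by simp
qed

lemma component_zero: "component A \<zero> n = \<zero>"
  by (simp add: component_homogeneous[of \<zero> 0])

text \<open>Every element is a finite sum of homogeneous ones, so an additive property only has to be
checked on homogeneous elements.\<close>
lemma homogeneous_induct [consumes 1, case_names homogeneous add]:
  assumes x: "x \<in> carrier A"
    and homogeneous: "\<And>n a. a \<in> grade A n \<Longrightarrow> P a"
    and add: "\<And>a b. a \<in> carrier A \<Longrightarrow> b \<in> carrier A \<Longrightarrow> P a \<Longrightarrow> P b \<Longrightarrow> P (a \<oplus> b)"
  shows "P x"
proof -
  have c: "component A x n \<in> carrier A" for n
    using component_grade[OF x] grade_carrier by blast
  have "P (\<Oplus>n\<in>F. component A x n)" if "finite F" for F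
    using that
  proof (induction F)
    case empty
    then show ?case using homogeneous[of \<zero> 0] by simp
  next
    case (insert n F)
    then show ?case using c homogeneous[OF component_grade[OF x, of n]] by (auto intro!: add)
  qed
  then show ?thesis using component_spec(2,3)[OF x] by metis
qed

lemma component_mult_homogeneous:
  assumes "x \<in> carrier A" and a: "a \<in> grade A j"
  shows "component A (x \<otimes> a) n = component A x (n - j) \<otimes> a"
  using assms(1)
proof (induction rule: homogeneous_induct)
  case (homogeneous i x)
  then show ?case
    using component_homogeneous[OF grade_mult[OF homogeneous a]] component_homogeneous[OF homogeneous]
      grade_carrier[OF a] by auto
next
  case (add x y)
  then show ?case
    using component_grade[THEN grade_carrier] grade_carrier[OF a] by (simp add: l_distr component_add)
qed

text \<open>The sign in graded commutativity is trivial if one of the degrees is \<open>0\<close>.\<close>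
lemma degree0_central:
  assumes s: "s \<in> grade A 0" and "x \<in> carrier A"
  shows "x \<otimes> s = s \<otimes> x"
  using assms(2)
proof (induction rule: homogeneous_induct)
  case (homogeneous i x)
  then show ?case using graded_comm[OF s homogeneous] by (simp add: sign_mult_def)
next
  case (add x y)
  then show ?case using grade_carrier[OF s] by (simp add: l_distr r_distr)
qed

lemma diff_closed [simp]: "x \<in> carrier A \<Longrightarrow> diff A x \<in> carrier A"
  using diff_hom by (auto simp: hom_def)

lemma diff_add: "x \<in> carrier A \<Longrightarrow> y \<in> carrier A \<Longrightarrow> diff A (x \<oplus> y) = diff A x \<oplus> diff A y"
  using diff_hom by (auto simp: hom_def)

lemma diff_zero [simp]: "diff A \<zero> = \<zero>"
  using diff_add[of \<zero> \<zero>] by simp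

lemma diff_degree0: "x \<in> grade A 0 \<Longrightarrow> diff A x = \<zero>"
  using diff_grade[of x 0] grade_nonpos[of 1] by simp

text \<open>An element of degree \<open>0\<close> is a cocycle, so the Leibniz rule makes the differential linear over
\<open>A\<^sup>0\<close>. This lets the differential pass to fractions with denominators in degree \<open>0\<close>.\<close>
lemma diff_degree0_mult:
  assumes "s \<in> grade A 0" "x \<in> carrier A"
  shows "diff A (s \<otimes> x) = s \<otimes> diff A x"
  using assms leibniz[OF assms] by (simp add: diff_degree0 sign_mult_def grade_carrier)

end

section \<open>Cohomology and quasi-isomorphisms\<close>

context comm_dg_ring
begin

lemma cocycles_carrier: "z \<in> cocycles A n \<Longrightarrow> z \<in> carrier A"
  using grade_carrier by (auto simp: cocycles_def)

lemma coboundaries_carrier: "z \<in> coboundaries A n \<Longrightarrow> z \<in> carrier A"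
  using coboundaries_cocycles cocycles_carrier by blast

lemma cocycles_0: "cocycles A 0 = grade A 0"
  by (auto simp: cocycles_def diff_degree0)

lemma abelian_subgroup_coboundaries: "abelian_subgroup (coboundaries A n) A"
  by (rule abelian_subgroupI3)
    (auto intro!: additive_subgroup.intro subgroup_coboundaries abelian_group_axioms)

lemma coboundaries_coset_eq_iff:
  assumes "x \<in> carrier A" "y \<in> carrier A"
  shows "coboundaries A n +> x = coboundaries A n +> y \<longleftrightarrow> x \<ominus> y \<in> coboundaries A n"
proof -
  interpret B: abelian_subgroup "coboundaries A n" A by (rule abelian_subgroup_coboundaries)
  have "x \<in> coboundaries A n +> y \<longleftrightarrow> x \<ominus> y \<in> coboundaries A n"
    using B.a_rcos_module[OF assms(2,1)] by (simp add: a_minus_def)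
  then show ?thesis
    using B.a_repr_independence'[of x y] B.a_rcos_self[OF assms(1)] assms by auto
qed

lemma cohomology_carrier: "carrier (cohomology A n) = (\<lambda>z. coboundaries A n +> z) ` cocycles A n"
  by (auto simp: cohomology_def)

lemma cohomology_trivial_iff:
  "carrier (cohomology A n) = {\<zero>\<^bsub>cohomology A n\<^esub>} \<longleftrightarrow> cocycles A n \<subseteq> coboundaries A n"
proof -
  interpret B: abelian_subgroup "coboundaries A n" A by (rule abelian_subgroup_coboundaries)
  have zero: "\<zero>\<^bsub>cohomology A n\<^esub> = coboundaries A n +> \<zero>"
    using B.a_subset by (simp add: cohomology_def)
  have "\<zero> \<in> cocycles A n" using subgroup.one_closed[OF subgroup_cocycles] by simp
  then have "carrier (cohomology A n) = {\<zero>\<^bsub>cohomology A n\<^esub>} \<longleftrightarrow>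
      (\<forall>z\<in>cocycles A n. coboundaries A n +> z = coboundaries A n +> \<zero>)"
    unfolding zero cohomology_carrier by auto
  also have "\<dots> \<longleftrightarrow> (\<forall>z\<in>cocycles A n. z \<in> coboundaries A n)"
    using cocycles_carrier by (intro ball_cong refl) (simp add: coboundaries_coset_eq_iff a_minus_def)
  finally show ?thesis by auto
qed

lemma cocycles_pos: "n > 0 \<Longrightarrow> cocycles A n \<subseteq> coboundaries A n"
  using subgroup.one_closed[OF subgroup_coboundaries[of n]] by (auto simp: cocycles_def grade_nonpos)

lemma H0_carrier: "X \<in> carrier (H0 A) \<longleftrightarrow> (\<exists>x\<in>grade A 0. X = coboundaries A 0 +> x)"
  by (auto simp: H0_cohomology cohomology_def ring.truncate_def cocycles_0)

lemma H0_coset: "x \<in> grade A 0 \<Longrightarrow> coboundaries A 0 +> x \<in> carrier (H0 A)"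
  by (auto simp: H0_carrier)

lemma H0_add:
  assumes "x \<in> grade A 0" "y \<in> grade A 0"
  shows "(coboundaries A 0 +> x) \<oplus>\<^bsub>H0 A\<^esub> (coboundaries A 0 +> y) = coboundaries A 0 +> (x \<oplus> y)"
proof -
  interpret B: abelian_subgroup "coboundaries A 0" A by (rule abelian_subgroup_coboundaries)
  show ?thesis using B.a_rcos_sum[of x y] assms grade_carrier
    by (simp add: H0_cohomology cohomology_def ring.truncate_def)
qed

lemma H0_mult:
  assumes "x \<in> grade A 0" "y \<in> grade A 0"
  shows "(coboundaries A 0 +> x) \<otimes>\<^bsub>H0 A\<^esub> (coboundaries A 0 +> y) = coboundaries A 0 +> (x \<otimes> y)"
proof -
  interpret I: ideal "coboundaries A 0" "degree0 A" by (rule ideal_coboundaries)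
  show ?thesis using I.rcoset_mult_add[of x y] assms
    by (simp add: H0_def FactRing_def degree0_def rcoset_mult_def a_r_coset_def r_coset_def)
qed

lemma H0_one: "\<one>\<^bsub>H0 A\<^esub> = coboundaries A 0 +> \<one>"
  by (simp add: H0_cohomology cohomology_def ring.truncate_def)

lemma H0_zero: "\<zero>\<^bsub>H0 A\<^esub> = coboundaries A 0 +> \<zero>"
proof -
  interpret B: abelian_subgroup "coboundaries A 0" A by (rule abelian_subgroup_coboundaries)
  show ?thesis using B.a_subset by (simp add: H0_cohomology cohomology_def ring.truncate_def)
qed

end

lemma cohomology_map_coset:
  assumes A: "comm_dg_ring A" and B: "comm_dg_ring B" and f: "f \<in> dg_ring_hom A B"
    and z: "z \<in> cocycles A n"
  shows "f z \<in> cocycles B n"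
    "cohomology_map B n f (coboundaries A n +>\<^bsub>A\<^esub> z) = coboundaries B n +>\<^bsub>B\<^esub> f z"
proof -
  interpret A: comm_dg_ring A by fact
  interpret B: comm_dg_ring B by fact
  interpret BB: abelian_subgroup "coboundaries B n" B by (rule B.abelian_subgroup_coboundaries)
  interpret AB: abelian_subgroup "coboundaries A n" A by (rule A.abelian_subgroup_coboundaries)
  interpret f: ring_hom_ring A B f
    using f by (intro ring_hom_ringI2 A.ring_axioms B.ring_axioms) (simp add: dg_ring_hom_def)
  have grade: "f x \<in> grade B m" if "x \<in> grade A m" for x m
    using f that by (auto simp: dg_ring_hom_def)
  have diff: "f (diff A x) = diff B (f x)" if "x \<in> carrier A" for x
    using f that by (auto simp: dg_ring_hom_def)
  show "f z \<in> cocycles B n"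
    using z grade diff[of z] A.cocycles_carrier[OF z] by (auto simp: cocycles_def)
  have zc: "z \<in> carrier A" "f z \<in> carrier B" using A.cocycles_carrier[OF z] by auto
  have "coboundaries B n +>\<^bsub>B\<^esub> f x = coboundaries B n +>\<^bsub>B\<^esub> f z" if "x \<in> coboundaries A n +>\<^bsub>A\<^esub> z" for x
  proof -
    obtain b where b: "b \<in> coboundaries A n" "x = b \<oplus>\<^bsub>A\<^esub> z" using \<open>x \<in> _\<close> by (auto simp: a_r_coset_def')
    then have bc: "b \<in> carrier A" using A.coboundaries_carrier by blast
    have "f b \<in> coboundaries B n"
      using b(1) grade diff A.grade_carrier by (auto simp: coboundaries_def)
    moreover have "f x \<ominus>\<^bsub>B\<^esub> f z = f b"
      using b bc zc by (simp add: a_minus_def B.a_assoc B.r_neg)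
    ultimately show ?thesis using b bc zc by (simp add: B.coboundaries_coset_eq_iff)
  qed
  moreover have "z \<in> coboundaries A n +>\<^bsub>A\<^esub> z" using AB.a_rcos_self zc by simp
  ultimately show "cohomology_map B n f (coboundaries A n +>\<^bsub>A\<^esub> z) = coboundaries B n +>\<^bsub>B\<^esub> f z"
    unfolding cohomology_map_def by blast
qed

text \<open>Vanishing of \<open>H\<^sup>n\<close> means that its carrier has one element, which a bijection preserves.\<close>
lemma quasi_iso_cohomology_trivial_iff:
  assumes A: "comm_dg_ring A" and B: "comm_dg_ring B" and f: "quasi_iso A B f"
  shows "cocycles A n \<subseteq> coboundaries A n \<longleftrightarrow> cocycles B n \<subseteq> coboundaries B n"
proof -
  have bij: "bij_betw (cohomology_map B n f) (carrier (cohomology A n)) (carrier (cohomology B n))"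
    using f by (simp add: quasi_iso_def)
  have singleton: "cocycles C n \<subseteq> coboundaries C n \<longleftrightarrow> is_singleton (carrier (cohomology C n))"
    if "comm_dg_ring C" for C :: "('x, 'y) dg_ring_scheme"
  proof -
    interpret C: comm_dg_ring C by fact
    interpret M: module "H0 C" "cohomology C n" by (rule C.module_cohomology)
    show ?thesis using M.zero_closed C.cohomology_trivial_iff[of n]
      by (auto simp: is_singleton_def)
  qed
  have "is_singleton (carrier (cohomology A n)) \<longleftrightarrow> is_singleton (carrier (cohomology B n))"
    using bij_betw_same_card[OF bij] by (simp add: is_singleton_altdef)
  then show ?thesis using singleton[OF A] singleton[OF B] by simp
qed

lemma quasi_iso_H0_iso:
  assumes A: "comm_dg_ring A" and B: "comm_dg_ring B" and f: "quasi_iso A B f"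
  shows "H0 A \<simeq> H0 B"
proof -
  interpret A: comm_dg_ring A by fact
  interpret B: comm_dg_ring B by fact
  have hom: "f \<in> dg_ring_hom A B" and
    bij: "bij_betw (cohomology_map B 0 f) (carrier (cohomology A 0)) (carrier (cohomology B 0))"
    using f by (simp_all add: quasi_iso_def)
  note coset = cohomology_map_coset[OF A B hom, where n = 0, unfolded A.cocycles_0 B.cocycles_0]
  have fm: "f (x \<otimes>\<^bsub>A\<^esub> y) = f x \<otimes>\<^bsub>B\<^esub> f y" "f (x \<oplus>\<^bsub>A\<^esub> y) = f x \<oplus>\<^bsub>B\<^esub> f y" "f \<one>\<^bsub>A\<^esub> = \<one>\<^bsub>B\<^esub>"
    if "x \<in> grade A 0" "y \<in> grade A 0" for x y
    using hom that A.grade_carrier by (auto simp: dg_ring_hom_def ring_hom_def)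
  have "cohomology_map B 0 f \<in> ring_iso (H0 A) (H0 B)"
  proof (rule ring_iso_memI)
    show "bij_betw (cohomology_map B 0 f) (carrier (H0 A)) (carrier (H0 B))"
      using bij by (simp add: A.H0_cohomology B.H0_cohomology ring.truncate_def)
    show "cohomology_map B 0 f \<one>\<^bsub>H0 A\<^esub> = \<one>\<^bsub>H0 B\<^esub>"
      using fm(3)[OF A.grade_one A.grade_one] by (simp add: A.H0_one B.H0_one coset(2) A.grade_one)
  qed (auto simp: A.H0_carrier A.H0_add A.H0_mult B.H0_add B.H0_mult coset B.H0_coset fm
        A.grade_add A.grade_mult[of _ 0 _ 0, simplified])
  then show ?thesis by (auto simp: is_ring_iso_def)
qed

section \<open>Formality of DG-rings without negative cohomology\<close>

lemma concentrated_simps: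
  "carrier (concentrated R) = carrier R" "mult (concentrated R) = mult R" "one (concentrated R) = one R"
  "ring.zero (concentrated R) = ring.zero R" "add (concentrated R) = add R"
  "grade (concentrated R) n = (if n = 0 then carrier R else {\<zero>\<^bsub>R\<^esub>})"
  "diff (concentrated R) x = \<zero>\<^bsub>R\<^esub>"
  by (simp_all add: concentrated_def)

lemma coboundaries_concentrated: "ring R \<Longrightarrow> coboundaries (concentrated R) n = {\<zero>\<^bsub>R\<^esub>}"
  using ring.ring_simprules(2)[of R] by (auto simp: coboundaries_def concentrated_simps)

lemma cocycles_concentrated: "cocycles (concentrated R) n = (if n = 0 then carrier R else {\<zero>\<^bsub>R\<^esub>})"
  by (auto simp: cocycles_def concentrated_simps)

lemma coset_concentrated:
  assumes "ring R" "x \<in> carrier R"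
  shows "coboundaries (concentrated R) n +>\<^bsub>concentrated R\<^esub> x = {x}"
proof -
  interpret ring R by fact
  show ?thesis using assms
    by (simp add: coboundaries_concentrated a_r_coset_def' concentrated_simps)
qed

text \<open>In degree \<open>0\<close> the only coboundary is \<open>0\<close>, so \<open>H\<^sup>0\<close> is the quotient by the zero ideal.\<close>
lemma H0_concentrated_iso:
  fixes R :: "'a ring"
  assumes "ring R"
  shows "H0 (concentrated R) \<simeq> R"
proof -
  have "degree0 (concentrated R) = R" by (simp add: degree0_def concentrated_def)
  then show ?thesis
    using ring.FactRing_zeroideal(1)[OF assms] by (simp add: H0_def coboundaries_concentrated assms)
qed

text \<open>The projection of the whole DG-ring, not only of its degree \<open>0\<close> part: components of negative degree
are discarded.\<close>
definition H0_projection :: "('a, 'm) dg_ring_scheme \<Rightarrow> 'a \<Rightarrow> 'a set" where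
  "H0_projection A x = coboundaries A 0 +>\<^bsub>A\<^esub> component A x 0"

context comm_dg_ring
begin

text \<open>Multiplicativity is where the grading being non-positive enters: a product of homogeneous
elements has degree \<open>0\<close> only if both factors do, so discarding negative components respects products.\<close>
lemma H0_projection_ring_hom: "H0_projection A \<in> ring_hom A (H0 A)"
proof (rule ring_hom_memI)
  interpret H: cring "H0 A" by (rule cring_H0)
  have closed: "H0_projection A x \<in> carrier (H0 A)" if "x \<in> carrier A" for x
    unfolding H0_projection_def by (intro H0_coset component_grade that)
  show "H0_projection A x \<in> carrier (H0 A)" if "x \<in> carrier A" for x by (rule closed[OF that])
  show "H0_projection A \<one> = \<one>\<^bsub>H0 A\<^esub>"
    by (simp add: H0_projection_def component_homogeneous[OF grade_one] H0_one)
  have add: "H0_projection A (x \<oplus> y) = H0_projection A x \<oplus>\<^bsub>H0 A\<^esub> H0_projection A y"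
    if "x \<in> carrier A" "y \<in> carrier A" for x y
    using that component_grade by (simp add: H0_projection_def component_add H0_add)
  then show "H0_projection A (x \<oplus> y) = H0_projection A x \<oplus>\<^bsub>H0 A\<^esub> H0_projection A y"
    if "x \<in> carrier A" "y \<in> carrier A" for x y using that .
  show "H0_projection A (x \<otimes> y) = H0_projection A x \<otimes>\<^bsub>H0 A\<^esub> H0_projection A y"
    if x: "x \<in> carrier A" and "y \<in> carrier A" for x y
    using that(2)
  proof (induction rule: homogeneous_induct)
    case (homogeneous n a)
    have xa: "component A (x \<otimes> a) 0 = component A x (0 - n) \<otimes> a"
      by (rule component_mult_homogeneous[OF x homogeneous])
    show ?case
    proof (cases "n = 0")
      case True
      then show ?thesis
        using xa H0_mult[OF component_grade[OF x], of a] homogeneous component_homogeneous[of a 0 0]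
        by (simp add: H0_projection_def)
    next
      case False
      then have "component A (x \<otimes> a) 0 = \<zero>"
        using xa component_grade[OF x, of "- n"] grade_nonpos[of "- n"] grade_nonpos[of n] homogeneous
          grade_carrier[OF homogeneous] component_grade[OF x, THEN grade_carrier]
        by (cases "n < 0") auto
      moreover have "component A a 0 = \<zero>" using component_homogeneous[OF homogeneous] False by simp
      ultimately show ?thesis
        using closed[OF x] by (simp add: H0_projection_def H0_zero[symmetric])
    qed
  next
    case (add a b)
    then show ?case
      using \<open>\<And>x y. x \<in> carrier A \<Longrightarrow> y \<in> carrier A \<Longrightarrow> H0_projection A (x \<oplus> y) = _\<close> x closed
      by (simp add: r_distr H.r_distr)
  qed
qed

text \<open>Only the component of degree \<open>-1\<close> contributes to degree \<open>0\<close> of the differential, and its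
contribution is a coboundary.\<close>
lemma H0_projection_diff:
  assumes "x \<in> carrier A"
  shows "H0_projection A (diff A x) = \<zero>\<^bsub>H0 A\<^esub>"
  using assms
proof (induction rule: homogeneous_induct)
  case (homogeneous n a)
  show ?case
  proof (cases "n = -1")
    case True
    then have d: "diff A a \<in> grade A 0" "diff A a \<in> coboundaries A 0"
      using homogeneous diff_grade[OF homogeneous] by (auto simp: coboundaries_def)
    then show ?thesis
      using component_homogeneous[OF d(1), of 0] grade_carrier[OF d(1)]
      by (simp add: H0_projection_def H0_zero coboundaries_coset_eq_iff a_minus_def)
  next
    case False
    then show ?thesis
      using component_homogeneous[OF diff_grade[OF homogeneous], of 0]
      by (simp add: H0_projection_def H0_zero)
  qed
next
  interpret H: cring "H0 A" by (rule cring_H0)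
  case (add a b)
  then show ?case using ring_hom_memE(3)[OF H0_projection_ring_hom] by (simp add: diff_add)
qed

text \<open>The ring \<open>H\<^sup>0(A)\<close> is replaced by an isomorphic copy \<open>R\<close>, because a zigzag has to stay in a given
universe. In degree \<open>0\<close> the induced map is \<open>\<iota>\<close> up to the identification of \<open>x\<close> with its coset
\<open>{x}\<close>; in all other degrees both sides vanish.\<close>
lemma quasi_iso_concentrated:
  fixes R :: "'r ring"
  assumes trivial: "\<And>n. n < 0 \<Longrightarrow> cocycles A n \<subseteq> coboundaries A n"
    and R: "cring R" and \<iota>: "\<iota> \<in> ring_iso (H0 A) R"
  shows "quasi_iso A (concentrated R) (\<iota> \<circ> H0_projection A)"
proof -
  interpret H: cring "H0 A" by (rule cring_H0)
  interpret R: cring R by fact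
  let ?f = "\<iota> \<circ> H0_projection A"
  have C: "comm_dg_ring (concentrated R)" by (rule comm_dg_ring_concentrated[OF R])
  interpret C: comm_dg_ring "concentrated R" by (rule C)
  interpret \<iota>: ring_hom_ring "H0 A" R \<iota>
    using \<iota> by (intro ring_hom_ringI2 H.ring_axioms R.ring_axioms) (simp add: ring_iso_def)
  have hom: "?f \<in> ring_hom A R"
    using ring_hom_trans[OF H0_projection_ring_hom, of \<iota> R] \<iota> by (simp add: ring_iso_def)
  have graded: "?f x \<in> grade (concentrated R) n" if "x \<in> grade A n" for x n
    using ring_hom_memE(1)[OF hom grade_carrier[OF that]] component_homogeneous[OF that, of 0]
    by (auto simp: concentrated_simps H0_projection_def H0_zero[symmetric])
  have "?f \<in> ring_hom A (concentrated R)"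
    using hom by (simp add: ring_hom_def concentrated_simps)
  moreover have "?f ` grade A n \<subseteq> grade (concentrated R) n" for n
    using graded by blast
  ultimately have f: "?f \<in> dg_ring_hom A (concentrated R)"
    using H0_projection_diff by (simp add: dg_ring_hom_def concentrated_simps)
  note coset = cohomology_map_coset(2)[OF comm_dg_ring_axioms C f]
  have "bij_betw (cohomology_map (concentrated R) n ?f) (carrier (cohomology A n))
      (carrier (cohomology (concentrated R) n))" for n
  proof (cases "n = 0")
    case True
    have f0: "?f z = \<iota> (coboundaries A 0 +> z)" if "z \<in> grade A 0" for z
      using component_homogeneous[OF that, of 0] by (simp add: H0_projection_def)
    have c: "cohomology_map (concentrated R) 0 ?f X = {\<iota> X}" if X: "X \<in> carrier (H0 A)" for X
    proof -
      obtain z where z: "z \<in> grade A 0" "X = coboundaries A 0 +> z" using X by (auto simp: H0_carrier)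
      have "\<iota> X \<in> carrier R" using X by simp
      then show ?thesis
        using coset[of z 0] z f0[OF z(1)] coset_concentrated[OF R.ring_axioms, of "\<iota> X" 0]
        by (simp add: cocycles_0)
    qed
    have "bij_betw (\<lambda>X. {\<iota> X}) (carrier (H0 A)) ((\<lambda>x. {x}) ` carrier R)"
      using bij_betw_trans[OF ring_iso_memE(5)[OF \<iota>], of "\<lambda>x. {x}" "(\<lambda>x. {x}) ` carrier R"]
      by (simp add: bij_betw_def comp_def)
    then have "bij_betw (cohomology_map (concentrated R) 0 ?f) (carrier (H0 A)) ((\<lambda>x. {x}) ` carrier R)"
      using bij_betw_cong[of "carrier (H0 A)" "cohomology_map (concentrated R) 0 ?f" "\<lambda>X. {\<iota> X}"] c by simp
    moreover have "carrier (cohomology (concentrated R) 0) = (\<lambda>x. {x}) ` carrier R"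
      using coset_concentrated[OF R.ring_axioms]
      by (simp add: C.cohomology_carrier cocycles_concentrated)
    ultimately show ?thesis
      using True by (simp add: H0_cohomology ring.truncate_def)
  next
    case False
    then have "cocycles A n \<subseteq> coboundaries A n" using trivial[of n] cocycles_pos[of n] by linarith
    then have A: "carrier (cohomology A n) = {coboundaries A n +> \<zero>}"
      using cohomology_trivial_iff[of n] abelian_subgroup.a_rcos_const[OF abelian_subgroup_coboundaries, of \<zero> n]
        subgroup.one_closed[OF subgroup_coboundaries[of n]]
      by (simp add: cohomology_def)
    have z: "\<zero> \<in> cocycles A n" using subgroup.one_closed[OF subgroup_cocycles] by simp
    have "carrier (cohomology (concentrated R) n) = {{\<zero>\<^bsub>R\<^esub>}}"
      using False coset_concentrated[OF R.ring_axioms R.zero_closed]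
      by (simp add: C.cohomology_carrier cocycles_concentrated)
    moreover have "cohomology_map (concentrated R) n ?f (coboundaries A n +> \<zero>) = {\<zero>\<^bsub>R\<^esub>}"
      using coset[OF z] coset_concentrated[OF R.ring_axioms R.zero_closed] component_zero
      by (simp add: H0_projection_def H0_zero[symmetric])
    ultimately show ?thesis using A by (simp add: bij_betw_def)
  qed
  then show ?thesis using f by (simp add: quasi_iso_def)
qed

end

definition acyclic_regular :: "('a, 'm) dg_ring_scheme \<Rightarrow> bool" where
  "acyclic_regular A \<longleftrightarrow> (\<forall>n<0. cocycles A n \<subseteq> coboundaries A n) \<and> regular_local_ring (H0 A)"

text \<open>The property is stated through cohomology alone, which makes it invariant in both directions of a
quasi-isomorphism and therefore along zigzags.\<close>
lemma acyclic_regular_cong: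
  assumes "has_quasi_iso A B"
  shows "acyclic_regular A \<longleftrightarrow> acyclic_regular B"
proof -
  obtain f where f: "quasi_iso A B f" and AB: "comm_dg_ring A" "comm_dg_ring B"
    using assms by (auto simp: has_quasi_iso_def)
  show ?thesis
    using quasi_iso_cohomology_trivial_iff[OF AB f]
      regular_local_ring_cong_ring_iso[OF comm_dg_ring.cring_H0[OF AB(1)] comm_dg_ring.cring_H0[OF AB(2)]
        quasi_iso_H0_iso[OF AB f]]
    by (simp add: acyclic_regular_def)
qed

lemma acyclic_regular_concentrated:
  fixes R :: "'a ring"
  assumes "cring R"
  shows "acyclic_regular (concentrated R) \<longleftrightarrow> regular_local_ring R"
  using regular_local_ring_cong_ring_iso[OF
      comm_dg_ring.cring_H0[OF comm_dg_ring_concentrated[OF assms]] assms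
      H0_concentrated_iso[OF cring.axioms(1)[OF assms]]]
  by (simp add: acyclic_regular_def cocycles_concentrated coboundaries_concentrated
      cring.axioms(1)[OF assms])

text \<open>The intermediate DG-rings of a zigzag live in the universe \<open>'a + 'v\<close>. For the backward direction
no zigzag is needed beyond one arrow: \<open>A\<close> projects onto a copy of its \<open>H\<^sup>0\<close>.\<close>
lemma quasi_isomorphic_regular_iff:
  fixes A :: "'a dg_ring"
  assumes A: "comm_dg_ring A"
  shows "(\<exists>R :: ('a + 'v) ring. regular_local_ring R \<and> quasi_isomorphic A (concentrated R))
    \<longleftrightarrow> acyclic_regular A"
proof
  assume "\<exists>R :: ('a + 'v) ring. regular_local_ring R \<and> quasi_isomorphic A (concentrated R)"
  then obtain R :: "('a + 'v) ring" and C :: "('a + 'v) dg_ring" where R: "regular_local_ring R"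
    and AC: "has_quasi_iso A C \<or> has_quasi_iso C A" and CR: "equivclp has_quasi_iso C (concentrated R)"
    by (auto simp: quasi_isomorphic_def)
  from CR have "acyclic_regular C \<longleftrightarrow> acyclic_regular (concentrated R)"
  proof (induction rule: equivclp_induct)
    case (step B D)
    then show ?case using acyclic_regular_cong[of B D] acyclic_regular_cong[of D B] by blast
  qed simp
  moreover have "acyclic_regular (concentrated R)"
    using R acyclic_regular_concentrated[of R] by (simp add: regular_local_ring_def)
  ultimately show "acyclic_regular A"
    using AC acyclic_regular_cong[of A C] acyclic_regular_cong[of C A] by blast
next
  assume reg: "acyclic_regular A"
  interpret comm_dg_ring A by fact
  interpret H: cring "H0 A" by (rule cring_H0)
  \<comment> \<open>Elements of \<open>H\<^sup>0(A)\<close> are cosets and hence sets over \<open>'a\<close>. Choosing a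
      representative of each coset embeds them into \<open>'a\<close>, so that the universe has room for the copy.\<close>
  define e :: "'a set \<Rightarrow> 'a + 'v" where "e X = Inl (SOME x. x \<in> X)" for X
  have "inj_on e (carrier (H0 A))"
  proof (rule inj_onI)
    fix X Y assume X: "X \<in> carrier (H0 A)" and Y: "Y \<in> carrier (H0 A)" and eq: "e X = e Y"
    obtain x y where x: "x \<in> grade A 0" "X = coboundaries A 0 +>\<^bsub>A\<^esub> x"
      and y: "y \<in> grade A 0" "Y = coboundaries A 0 +>\<^bsub>A\<^esub> y"
      using X Y by (auto simp: H0_carrier)
    interpret B: abelian_subgroup "coboundaries A 0" A by (rule abelian_subgroup_coboundaries)
    have "x \<in> X" "y \<in> Y" using x y B.a_rcos_self grade_carrier by auto
    then have "(SOME x. x \<in> X) \<in> X" "(SOME y. y \<in> Y) \<in> Y" by (auto intro: someI)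
    then obtain z where "z \<in> X" "z \<in> Y" using eq by (auto simp: e_def)
    then show "X = Y"
      using B.a_repr_independence'[of z x] B.a_repr_independence'[of z y] x y grade_carrier by auto
  qed
  then have e: "e \<in> ring_iso (H0 A) (image_ring e (H0 A))" by (rule inj_imp_image_ring_iso)
  let ?R = "image_ring e (H0 A)"
  have "cring (?R\<lparr>ring.zero := e \<zero>\<^bsub>H0 A\<^esub>\<rparr>)" by (rule H.ring_iso_imp_img_cring[OF e])
  then have R: "cring ?R" by (simp add: image_ring_zero[symmetric])
  have "quasi_iso A (concentrated ?R) (e \<circ> H0_projection A)"
    using reg by (intro quasi_iso_concentrated[OF _ R e]) (simp add: acyclic_regular_def)
  then have "has_quasi_iso A (concentrated ?R)"
    using A comm_dg_ring_concentrated[OF R] by (auto simp: has_quasi_iso_def)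
  moreover have "regular_local_ring ?R"
    using acyclic_regular_cong[OF \<open>has_quasi_iso A (concentrated ?R)\<close>] acyclic_regular_concentrated[OF R] reg
    by simp
  ultimately show "\<exists>R :: ('a + 'v) ring. regular_local_ring R \<and> quasi_isomorphic A (concentrated R)"
    by (auto simp: quasi_isomorphic_def intro!: exI[of _ ?R] exI[of _ "concentrated ?R"])
qed

section \<open>Transport of structure along an isomorphism of DG-rings\<close>

text \<open>Here \<open>T\<close> carries operations of which nothing is known except that a bijection \<open>v\<close> matches them with
those of the DG-ring \<open>L\<close>. This is the situation of the tensor product, whose operations are defined
on cosets.\<close>
locale dg_transport = L: comm_dg_ring L for L :: "('b, 'n) dg_ring_scheme" +
  fixes T :: "('a, 'm) dg_ring_scheme" and v
  assumes bij: "bij_betw v (carrier T) (carrier L)"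
    and mult_closed: "x \<in> carrier T \<Longrightarrow> y \<in> carrier T \<Longrightarrow> x \<otimes>\<^bsub>T\<^esub> y \<in> carrier T"
    and v_mult: "x \<in> carrier T \<Longrightarrow> y \<in> carrier T \<Longrightarrow> v (x \<otimes>\<^bsub>T\<^esub> y) = v x \<otimes>\<^bsub>L\<^esub> v y"
    and add_closed: "x \<in> carrier T \<Longrightarrow> y \<in> carrier T \<Longrightarrow> x \<oplus>\<^bsub>T\<^esub> y \<in> carrier T"
    and v_add: "x \<in> carrier T \<Longrightarrow> y \<in> carrier T \<Longrightarrow> v (x \<oplus>\<^bsub>T\<^esub> y) = v x \<oplus>\<^bsub>L\<^esub> v y"
    and one_closed: "\<one>\<^bsub>T\<^esub> \<in> carrier T" and v_one: "v \<one>\<^bsub>T\<^esub> = \<one>\<^bsub>L\<^esub>"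
    and zero_closed: "\<zero>\<^bsub>T\<^esub> \<in> carrier T" and v_zero: "v \<zero>\<^bsub>T\<^esub> = \<zero>\<^bsub>L\<^esub>"
    and diff_closed: "x \<in> carrier T \<Longrightarrow> diff T x \<in> carrier T"
    and v_diff: "x \<in> carrier T \<Longrightarrow> v (diff T x) = diff L (v x)"
    and grade_iff: "x \<in> grade T n \<longleftrightarrow> x \<in> carrier T \<and> v x \<in> grade L n"
begin

lemma v_closed: "x \<in> carrier T \<Longrightarrow> v x \<in> carrier L"
  using bij by (auto simp: bij_betw_def)

lemma v_inj: "x \<in> carrier T \<Longrightarrow> y \<in> carrier T \<Longrightarrow> v x = v y \<Longrightarrow> x = y"
  using bij by (auto simp: bij_betw_def inj_on_def)

lemma v_surj:
  assumes "z \<in> carrier L" obtains x where "x \<in> carrier T" "v x = z"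
  using assms bij imageE[of z v "carrier T"] by (auto simp: bij_betw_def)

lemma ring_T: "ring T"
proof (rule ringI)
  show "abelian_group T"
  proof (rule abelian_groupI)
    fix x assume x: "x \<in> carrier T"
    obtain y where y: "y \<in> carrier T" "v y = \<ominus>\<^bsub>L\<^esub> v x"
      using v_surj L.a_inv_closed[OF v_closed[OF x]] by metis
    have "y \<oplus>\<^bsub>T\<^esub> x = \<zero>\<^bsub>T\<^esub>"
      using x y v_closed by (intro v_inj) (auto simp: add_closed zero_closed v_add v_zero L.l_neg)
    then show "\<exists>y\<in>carrier T. y \<oplus>\<^bsub>T\<^esub> x = \<zero>\<^bsub>T\<^esub>" using y by blast
  qed (auto simp: add_closed zero_closed v_add v_zero v_closed L.a_ac intro!: v_inj)
  show "Group.monoid T"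
    by (rule monoidI)
      (auto simp: mult_closed one_closed v_mult v_one v_closed L.m_assoc intro!: v_inj)
qed (auto simp: add_closed mult_closed v_add v_mult v_closed L.l_distr L.r_distr intro!: v_inj)

sublocale T: ring T by (rule ring_T)

sublocale v: ring_hom_ring T L v
  by (intro ring_hom_ringI T.ring_axioms L.ring_axioms) (auto simp: v_closed v_mult v_add v_one)

lemma v_sign_mult: "x \<in> carrier T \<Longrightarrow> v (sign_mult T k x) = sign_mult L k (v x)"
  by (simp add: sign_mult_def)

lemma sign_mult_closed: "x \<in> carrier T \<Longrightarrow> sign_mult T k x \<in> carrier T"
  by (simp add: sign_mult_def)

text \<open>The decomposition of \<open>x\<close> is the preimage of that of \<open>v x\<close>; it is unique because \<open>v\<close> carries any
decomposition of \<open>x\<close> to the one of \<open>v x\<close>.\<close>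
lemma grade_direct_sum:
  assumes x: "x \<in> carrier T"
  shows "\<exists>!f. (\<forall>n. f n \<in> grade T n) \<and> finite {n. f n \<noteq> \<zero>\<^bsub>T\<^esub>} \<and>
    x = (\<Oplus>\<^bsub>T\<^esub>n\<in>{n. f n \<noteq> \<zero>\<^bsub>T\<^esub>}. f n)"
proof -
  have "\<exists>y. y \<in> carrier T \<and> v y = component L (v x) n" for n
    using v_surj L.grade_carrier[OF L.component_grade[OF v_closed[OF x]]] by metis
  then obtain f where f: "\<And>n. f n \<in> carrier T" "\<And>n. v (f n) = component L (v x) n" by metis
  have zero_iff: "y = \<zero>\<^bsub>T\<^esub> \<longleftrightarrow> v y = \<zero>\<^bsub>L\<^esub>" if "y \<in> carrier T" for y
    using that v_inj[OF that zero_closed] v_zero by auto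
  let ?N = "{n. f n \<noteq> \<zero>\<^bsub>T\<^esub>}"
  have N: "?N = {n. component L (v x) n \<noteq> \<zero>\<^bsub>L\<^esub>}" using zero_iff f by auto
  show ?thesis
  proof (rule ex1I[of _ f], intro conjI allI)
    show "f n \<in> grade T n" for n
      using f L.component_grade[OF v_closed[OF x]] by (simp add: grade_iff)
    show "finite ?N" unfolding N by (rule L.component_spec(2)[OF v_closed[OF x]])
    have "v (\<Oplus>\<^bsub>T\<^esub>n\<in>?N. f n) = (\<Oplus>\<^bsub>L\<^esub>n\<in>?N. component L (v x) n)"
      using f v.hom_finsum[of f ?N] by (simp add: comp_def Pi_def)
    also have "\<dots> = v x" unfolding N using L.component_spec(3)[OF v_closed[OF x]] by (rule sym)
    finally show "x = (\<Oplus>\<^bsub>T\<^esub>n\<in>?N. f n)"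
      using f x by (intro v_inj) (auto intro!: T.finsum_closed)
  next
    fix h assume h: "(\<forall>n. h n \<in> grade T n) \<and> finite {n. h n \<noteq> \<zero>\<^bsub>T\<^esub>} \<and>
        x = (\<Oplus>\<^bsub>T\<^esub>n\<in>{n. h n \<noteq> \<zero>\<^bsub>T\<^esub>}. h n)"
    then have hc: "h n \<in> carrier T" "v (h n) \<in> grade L n" for n by (auto simp: grade_iff)
    have "v x = (\<Oplus>\<^bsub>L\<^esub>n\<in>{n. h n \<noteq> \<zero>\<^bsub>T\<^esub>}. v (h n))"
      using h hc v.hom_finsum[of h "{n. h n \<noteq> \<zero>\<^bsub>T\<^esub>}"] by (simp add: comp_def Pi_def)
    moreover have "{n. v (h n) \<noteq> \<zero>\<^bsub>L\<^esub>} \<subseteq> {n. h n \<noteq> \<zero>\<^bsub>T\<^esub>}" using zero_iff hc by auto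
    ultimately have "component L (v x) = (\<lambda>n. v (h n))"
      using h hc by (intro L.component_eqI[of _ "{n. h n \<noteq> \<zero>\<^bsub>T\<^esub>}"]) auto
    then have "v (h n) = v (f n)" for n using f by simp
    then show "h = f" using v_inj[OF hc(1) f(1)] by blast
  qed
qed

lemma comm_dg_ring_T: "comm_dg_ring T"
proof (rule comm_dg_ring.intro[OF ring_T], rule comm_dg_ring_axioms.intro)
  fix n show "subgroup (grade T n) (add_monoid T)"
  proof (rule group.subgroupI[OF T.add.group_axioms])
    have "\<zero>\<^bsub>T\<^esub> \<in> grade T n" by (simp add: grade_iff)
    then show "grade T n \<noteq> {}" by blast
  qed (auto simp: grade_iff a_inv_def[symmetric] L.grade_a_inv L.grade_add)
next
  fix x assume "x \<in> carrier T"
  then show "\<exists>!f. (\<forall>n. f n \<in> grade T n) \<and> finite {n. f n \<noteq> \<zero>\<^bsub>T\<^esub>} \<and>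
      x = (\<Oplus>\<^bsub>T\<^esub>n\<in>{n. f n \<noteq> \<zero>\<^bsub>T\<^esub>}. f n)"
    by (rule grade_direct_sum)
next
  fix n :: int assume "n > 0"
  then show "grade T n = {\<zero>\<^bsub>T\<^esub>}"
    by (auto simp: grade_iff L.grade_nonpos intro: v_inj)
next
  show "\<one>\<^bsub>T\<^esub> \<in> grade T 0" by (simp add: grade_iff L.grade_one)
next
  fix a i b j assume "a \<in> grade T i" "b \<in> grade T j"
  then show "a \<otimes>\<^bsub>T\<^esub> b \<in> grade T (i + j)" "b \<otimes>\<^bsub>T\<^esub> a = sign_mult T (i * j) (a \<otimes>\<^bsub>T\<^esub> b)"
    using L.graded_comm[of "v a" i "v b" j]
    by (auto simp: grade_iff L.grade_mult v_sign_mult sign_mult_closed intro!: v_inj)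
next
  show "diff T \<in> hom (add_monoid T) (add_monoid T)"
    by (auto simp: hom_def diff_closed v_diff v_closed L.diff_add intro!: v_inj)
next
  fix a i b assume "a \<in> grade T i" "b \<in> carrier T"
  then show "diff T (a \<otimes>\<^bsub>T\<^esub> b) = (diff T a \<otimes>\<^bsub>T\<^esub> b) \<oplus>\<^bsub>T\<^esub> sign_mult T i (a \<otimes>\<^bsub>T\<^esub> diff T b)"
    using L.leibniz[of "v a" i "v b"]
    by (auto simp: grade_iff v_sign_mult sign_mult_closed diff_closed v_diff v_closed intro!: v_inj)
next
  fix a and i :: int assume "a \<in> grade T i" "odd i"
  then show "a \<otimes>\<^bsub>T\<^esub> a = \<zero>\<^bsub>T\<^esub>"
    using L.odd_square[of "v a" i] by (auto simp: grade_iff intro!: v_inj)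
qed (auto simp: grade_iff diff_closed v_diff v_closed L.diff_grade L.diff_diff intro: v_inj)

lemma v_coboundaries: "x \<in> coboundaries T n \<longleftrightarrow> x \<in> carrier T \<and> v x \<in> coboundaries L n"
proof
  assume "x \<in> coboundaries T n"
  then show "x \<in> carrier T \<and> v x \<in> coboundaries L n"
    by (auto simp: coboundaries_def grade_iff diff_closed v_diff)
next
  assume x: "x \<in> carrier T \<and> v x \<in> coboundaries L n"
  then obtain y where y: "y \<in> grade L (n - 1)" "v x = diff L y" by (auto simp: coboundaries_def)
  obtain z where z: "z \<in> carrier T" "v z = y" using v_surj L.grade_carrier[OF y(1)] by metis
  then have "x = diff T z" using x y by (intro v_inj) (auto simp: diff_closed v_diff)
  then show "x \<in> coboundaries T n" using y z by (auto simp: coboundaries_def grade_iff)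
qed

lemma quasi_iso_v: "quasi_iso T L v"
proof -
  interpret C: comm_dg_ring T by (rule comm_dg_ring_T)
  have f: "v \<in> dg_ring_hom T L"
    by (auto simp: dg_ring_hom_def ring_hom_def v_diff grade_iff)
  note coset = cohomology_map_coset[OF comm_dg_ring_T L.comm_dg_ring_axioms f]
  have "bij_betw (cohomology_map L n v) (carrier (cohomology T n)) (carrier (cohomology L n))" for n
    unfolding bij_betw_def
  proof
    show "inj_on (cohomology_map L n v) (carrier (cohomology T n))"
    proof (rule inj_onI)
      fix X Y assume X: "X \<in> carrier (cohomology T n)" and Y: "Y \<in> carrier (cohomology T n)"
        and eq: "cohomology_map L n v X = cohomology_map L n v Y"
      obtain x y where x: "x \<in> cocycles T n" "X = coboundaries T n +>\<^bsub>T\<^esub> x"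
        and y: "y \<in> cocycles T n" "Y = coboundaries T n +>\<^bsub>T\<^esub> y"
        using X Y by (auto simp: C.cohomology_carrier)
      have c: "x \<in> carrier T" "y \<in> carrier T" using x y C.cocycles_carrier by auto
      have "v x \<ominus>\<^bsub>L\<^esub> v y \<in> coboundaries L n"
        using eq coset(2)[OF x(1)] coset(2)[OF y(1)] x y c
        by (simp add: L.coboundaries_coset_eq_iff)
      then have "x \<ominus>\<^bsub>T\<^esub> y \<in> coboundaries T n"
        using c by (simp add: v_coboundaries a_minus_def)
      then show "X = Y" using x y c by (simp add: C.coboundaries_coset_eq_iff)
    qed
    show "cohomology_map L n v ` carrier (cohomology T n) = carrier (cohomology L n)"
    proof
      show "cohomology_map L n v ` carrier (cohomology T n) \<subseteq> carrier (cohomology L n)"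
        using coset by (auto simp: C.cohomology_carrier L.cohomology_carrier)
      show "carrier (cohomology L n) \<subseteq> cohomology_map L n v ` carrier (cohomology T n)"
      proof
        fix Z assume "Z \<in> carrier (cohomology L n)"
        then obtain z where z: "z \<in> cocycles L n" "Z = coboundaries L n +>\<^bsub>L\<^esub> z"
          by (auto simp: L.cohomology_carrier)
        obtain x where x: "x \<in> carrier T" "v x = z" using v_surj L.cocycles_carrier[OF z(1)] by metis
        have "v (diff T x) = v \<zero>\<^bsub>T\<^esub>" using z x by (simp add: v_diff cocycles_def)
        then have "diff T x = \<zero>\<^bsub>T\<^esub>" using x by (intro v_inj) (auto simp: diff_closed)
        then have "x \<in> cocycles T n" using x z by (simp add: cocycles_def grade_iff)
        then show "Z \<in> cohomology_map L n v ` carrier (cohomology T n)"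
          using coset(2)[of x n] x z by (auto simp: C.cohomology_carrier)
      qed
    qed
  qed
  then show ?thesis using f by (simp add: quasi_iso_def)
qed

end

section \<open>Localization of a DG-ring by fractions\<close>

lemma (in abelian_group) additive_finsum:
  assumes g: "\<And>x. x \<in> carrier G \<Longrightarrow> g x \<in> carrier G"
    and add: "\<And>x y. x \<in> carrier G \<Longrightarrow> y \<in> carrier G \<Longrightarrow> g (x \<oplus> y) = g x \<oplus> g y"
    and "finite F" "\<And>n. n \<in> F \<Longrightarrow> f n \<in> carrier G"
  shows "g (\<Oplus>n\<in>F. f n) = (\<Oplus>n\<in>F. g (f n))"
proof -
  have zero: "g \<zero> = \<zero>"
    using add[of \<zero> \<zero>] g[of \<zero>] by (simp add: add.l_cancel_one)
  show ?thesis
    using assms(3,4) by (induction F) (auto simp: zero g add Pi_def)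
qed

text \<open>Applying the projection \<open>p m\<close> to a decomposition of \<open>x\<close> isolates its \<open>m\<close>-th member, so the members are
determined by \<open>x\<close>. For fractions this replaces the comparison of two decompositions over
different denominators.\<close>
lemma (in abelian_group) direct_sum_of_projections:
  fixes G' :: "int \<Rightarrow> 'a set"
  assumes sub: "\<And>n. G' n \<subseteq> carrier G"
    and closed: "\<And>n y. y \<in> carrier G \<Longrightarrow> p n y \<in> carrier G"
    and add: "\<And>n y z. y \<in> carrier G \<Longrightarrow> z \<in> carrier G \<Longrightarrow> p n (y \<oplus> z) = p n y \<oplus> p n z"
    and proj: "\<And>m n y. y \<in> G' n \<Longrightarrow> p m y = (if m = n then y else \<zero>)"
    and f: "\<And>n. f n \<in> G' n" and F: "finite F" "{n. f n \<noteq> \<zero>} \<subseteq> F" and x: "x = (\<Oplus>n\<in>F. f n)"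
  shows "\<exists>!f. (\<forall>n. f n \<in> G' n) \<and> finite {n. f n \<noteq> \<zero>} \<and> x = (\<Oplus>n\<in>{n. f n \<noteq> \<zero>}. f n)"
proof (rule ex1I[of _ f])
  have fc: "f n \<in> carrier G" for n using f sub by blast
  have "(\<Oplus>n\<in>{n. f n \<noteq> \<zero>}. f n) = (\<Oplus>n\<in>F. f n)"
    using F fc by (intro add.finprod_mono_neutral_cong_left) auto
  then show "(\<forall>n. f n \<in> G' n) \<and> finite {n. f n \<noteq> \<zero>} \<and> x = (\<Oplus>n\<in>{n. f n \<noteq> \<zero>}. f n)"
    using f x finite_subset[OF F(2,1)] by simp
  have component: "p m x = h m"
    if h: "\<forall>n. h n \<in> G' n" "finite E" "{n. h n \<noteq> \<zero>} \<subseteq> E" "x = (\<Oplus>n\<in>E. h n)" for h m E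
  proof -
    have hc: "h n \<in> carrier G" for n using h(1) sub by blast
    have "p m x = (\<Oplus>n\<in>E. p m (h n))"
      unfolding h(4) using closed add hc h(2) by (intro additive_finsum) auto
    also have "\<dots> = (\<Oplus>n\<in>E. if m = n then h m else \<zero>)"
    proof (intro finsum_cong')
      show "p m (h n) = (if m = n then h m else \<zero>)" for n using proj[of "h n" n m] h(1) by auto
    qed (use hc in auto)
    also have "\<dots> = h m"
    proof (cases "m \<in> E")
      case False
      then have "h m = \<zero>" using h(3) by auto
      then have "(if m = n then h m else \<zero>) = \<zero>" for n by (cases "m = n") auto
      then show ?thesis using \<open>h m = \<zero>\<close> by simp
    qed (simp add: finsum_singleton h(2) hc)
    finally show ?thesis .
  qed
  fix h assume "(\<forall>n. h n \<in> G' n) \<and> finite {n. h n \<noteq> \<zero>} \<and> x = (\<Oplus>n\<in>{n. h n \<noteq> \<zero>}. h n)"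
  then have "p m x = h m" for m using component[of h "{n. h n \<noteq> \<zero>}" m] by auto
  moreover have "p m x = f m" for m using component[of f F m] f F x by auto
  ultimately show "h = f" by (simp add: fun_eq_iff)
qed

text \<open>The DG-ring of fractions \<open>a / s\<close> with \<open>s\<close> in \<open>S\<close>, of degree that of \<open>a\<close> and with differential
\<open>d (a / s) = d a / s\<close>.\<close>
definition dg_loc :: "('a, 'm) dg_ring_scheme \<Rightarrow> 'a set \<Rightarrow> ('a \<times> 'a) set dg_ring" where
  "dg_loc A S = ring.extend (loc A S) (dg_ring.fields
     (\<lambda>n. {loc_frac A S a s | a s. a \<in> grade A n \<and> s \<in> S}) (loc_map A S (diff A) (\<lambda>s. s)))"

lemma dg_loc_simps:
  "carrier (dg_loc A S) = carrier (loc A S)" "mult (dg_loc A S) = mult (loc A S)"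
  "one (dg_loc A S) = one (loc A S)" "ring.zero (dg_loc A S) = ring.zero (loc A S)"
  "add (dg_loc A S) = add (loc A S)"
  "grade (dg_loc A S) n = {loc_frac A S a s | a s. a \<in> grade A n \<and> s \<in> S}"
  "diff (dg_loc A S) = loc_map A S (diff A) (\<lambda>s. s)"
  by (simp_all add: dg_loc_def ring.extend_def dg_ring.fields_def loc_def)

lemma a_inv_cong:
  assumes "carrier R = carrier R'" "add R = add R'" "ring.zero R = ring.zero R'"
  shows "a_inv R = a_inv R'"
  using assms by (simp add: a_inv_def m_inv_def fun_eq_iff)

lemma ring_cong:
  assumes "ring R'" "carrier R = carrier R'" "mult R = mult R'" "one R = one R'" "add R = add R'"
    "ring.zero R = ring.zero R'"
  shows "ring R"
proof -
  interpret ring R' by fact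
  show ?thesis
    by (rule ringI; (rule abelian_groupI | rule monoidI)?)
      (auto simp: assms(2-) a_ac m_assoc l_distr r_distr intro!: bexI[of _ "\<ominus>\<^bsub>R'\<^esub> _"] l_neg)
qed

locale degree0_mult_set = comm_dg_ring +
  fixes S
  assumes S_degree0: "S \<subseteq> grade A 0"
    and one_in_S: "\<one> \<in> S"
    and mult_in_S: "s \<in> S \<Longrightarrow> t \<in> S \<Longrightarrow> s \<otimes> t \<in> S"

sublocale degree0_mult_set \<subseteq> central_mult_set A S
  using S_degree0 grade_carrier one_in_S mult_in_S degree0_central by unfold_locales auto

context degree0_mult_set
begin

abbreviation L where "L \<equiv> dg_loc A S"

lemma S_grade [simp]: "s \<in> S \<Longrightarrow> s \<in> grade A 0"
  using S_degree0 by auto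

lemma ring_L: "ring L"
  by (rule ring_cong[OF ring_loc]) (simp_all add: dg_loc_simps)

lemma L_carrier: "X \<in> carrier L \<longleftrightarrow> (\<exists>a\<in>carrier A. \<exists>s\<in>S. X = loc_frac A S a s)"
  by (simp add: dg_loc_simps loc_carrier)

lemma L_grade: "X \<in> grade L n \<longleftrightarrow> (\<exists>a\<in>grade A n. \<exists>s\<in>S. X = loc_frac A S a s)"
  by (auto simp: dg_loc_simps)

lemma frac_in_L_grade: "a \<in> grade A n \<Longrightarrow> s \<in> S \<Longrightarrow> loc_frac A S a s \<in> grade L n"
  by (auto simp: dg_loc_simps)

lemma L_mult:
  "a \<in> carrier A \<Longrightarrow> b \<in> carrier A \<Longrightarrow> s \<in> S \<Longrightarrow> t \<in> S \<Longrightarrow>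
    loc_frac A S a s \<otimes>\<^bsub>L\<^esub> loc_frac A S b t = loc_frac A S (a \<otimes> b) (s \<otimes> t)"
  by (simp add: dg_loc_simps loc_mult)

lemma L_add:
  "a \<in> carrier A \<Longrightarrow> b \<in> carrier A \<Longrightarrow> s \<in> S \<Longrightarrow>
    loc_frac A S a s \<oplus>\<^bsub>L\<^esub> loc_frac A S b s = loc_frac A S (a \<oplus> b) s"
  by (simp add: dg_loc_simps loc_add)

lemma L_zero: "s \<in> S \<Longrightarrow> \<zero>\<^bsub>L\<^esub> = loc_frac A S \<zero> s"
  by (simp add: dg_loc_simps loc_zero)

lemma L_one: "\<one>\<^bsub>L\<^esub> = loc_frac A S \<one> \<one>"
  by (simp add: dg_loc_simps loc_one)

lemma L_a_inv: "a \<in> carrier A \<Longrightarrow> s \<in> S \<Longrightarrow> \<ominus>\<^bsub>L\<^esub> loc_frac A S a s = loc_frac A S (\<ominus> a) s"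
  using loc_a_inv by (simp add: a_inv_cong[of L "loc A S"] dg_loc_simps)

lemma L_sign_mult:
  "a \<in> carrier A \<Longrightarrow> s \<in> S \<Longrightarrow> sign_mult L k (loc_frac A S a s) = loc_frac A S (sign_mult A k a) s"
  by (simp add: sign_mult_def L_a_inv)

lemma sign_mult_closed: "a \<in> carrier A \<Longrightarrow> sign_mult A k a \<in> carrier A"
  by (simp add: sign_mult_def)

text \<open>An \<open>S\<close>-linear map acts on numerators and leaves denominators alone.\<close>
lemma L_map:
  assumes "\<And>x. x \<in> carrier A \<Longrightarrow> g x \<in> carrier A"
    and "\<And>s x. s \<in> S \<Longrightarrow> x \<in> carrier A \<Longrightarrow> g (s \<otimes> x) = s \<otimes> g x"
    and "a \<in> carrier A" "s \<in> S"
  shows "loc_map A S g (\<lambda>s. s) (loc_frac A S a s) = loc_frac A S (g a) s"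
  using assms by (intro loc_map_frac[of A S A S g "\<lambda>s. s"] central_mult_set_axioms) auto

lemma L_diff:
  "a \<in> carrier A \<Longrightarrow> s \<in> S \<Longrightarrow> diff L (loc_frac A S a s) = loc_frac A S (diff A a) s"
  by (simp add: dg_loc_simps L_map diff_degree0_mult)

lemma component_degree0_mult:
  assumes "s \<in> grade A 0" "x \<in> carrier A"
  shows "component A (s \<otimes> x) n = s \<otimes> component A x n"
  using component_mult_homogeneous[OF assms(2,1)] degree0_central[OF assms(1)] assms(2)
    component_grade[OF assms(2), THEN grade_carrier] by simp

lemma frac_finsum:
  assumes "finite F" "\<And>n. n \<in> F \<Longrightarrow> f n \<in> carrier A" "s \<in> S"
  shows "loc_frac A S (\<Oplus>n\<in>F. f n) s = (\<Oplus>\<^bsub>L\<^esub>n\<in>F. loc_frac A S (f n) s)"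
proof -
  interpret L: ring L by (rule ring_L)
  show ?thesis
    using assms(1,2)
    by (induction F) (auto simp: L_zero[OF assms(3)] L_add[symmetric] assms(3) Pi_def dg_loc_simps(1))
qed

lemma L_common_denominator:
  assumes "X \<in> grade L m" "Y \<in> grade L n"
  obtains a b s where "a \<in> grade A m" "b \<in> grade A n" "s \<in> S" "X = loc_frac A S a s" "Y = loc_frac A S b s"
proof -
  obtain a s b t where X: "a \<in> grade A m" "s \<in> S" "X = loc_frac A S a s"
    and Y: "b \<in> grade A n" "t \<in> S" "Y = loc_frac A S b t"
    using assms by (auto simp: L_grade)
  have "X = loc_frac A S (a \<otimes> t) (s \<otimes> t)" "Y = loc_frac A S (b \<otimes> s) (s \<otimes> t)"
    using X Y grade_carrier frac_cancel[of a s t] frac_cancel[of b t s] central[of s t] by auto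
  moreover have "a \<otimes> t \<in> grade A m" "b \<otimes> s \<in> grade A n"
    using X Y grade_mult[of a m t 0] grade_mult[of b n s 0] by simp_all
  ultimately show ?thesis using that[of "a \<otimes> t" "b \<otimes> s" "s \<otimes> t"] mult_in_S[OF X(2) Y(2)] by blast
qed

text \<open>Each axiom is checked on numerators over a common denominator, or over the product of the
denominators. Only the uniqueness in the direct sum decomposition needs more: there the
projections to graded components, extended to fractions, are used.\<close>
lemma comm_dg_ring_L: "comm_dg_ring L"
proof -
  interpret L: ring L by (rule ring_L)
  have gc: "X \<in> carrier L" if "X \<in> grade L n" for X n
    using that grade_carrier by (auto simp: L_carrier L_grade)
  show ?thesis
  proof (rule comm_dg_ring.intro[OF ring_L], rule comm_dg_ring_axioms.intro)
    fix n show "subgroup (grade L n) (add_monoid L)"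
    proof (rule group.subgroupI[OF L.add.group_axioms])
      show "grade L n \<subseteq> carrier (add_monoid L)" using gc by auto
      have "loc_frac A S \<zero> \<one> \<in> grade L n"
        by (rule frac_in_L_grade[OF grade_zero one_in_S])
      then show "grade L n \<noteq> {}" using empty_iff by force
      fix X assume "X \<in> grade L n"
      then show "inv\<^bsub>add_monoid L\<^esub> X \<in> grade L n"
        using grade_a_inv grade_carrier L_a_inv by (fastforce simp: L_grade a_inv_def[symmetric])
      fix Y assume "Y \<in> grade L n"
      with \<open>X \<in> grade L n\<close> obtain a b s where
        "a \<in> grade A n" "b \<in> grade A n" "s \<in> S" "X = loc_frac A S a s" "Y = loc_frac A S b s"
        by (rule L_common_denominator)
      then show "X \<otimes>\<^bsub>add_monoid L\<^esub> Y \<in> grade L n"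
        using grade_carrier grade_add by (auto simp: L_add L_grade)
    qed
  next
    fix X assume "X \<in> carrier L"
    then obtain x s where x: "x \<in> carrier A" "s \<in> S" "X = loc_frac A S x s" by (auto simp: L_carrier)
    let ?p = "\<lambda>n. loc_map A S (\<lambda>y. component A y n) (\<lambda>s. s)"
    have cc: "component A y n \<in> carrier A" if "y \<in> carrier A" for y n
      using component_grade[OF that] grade_carrier by blast
    have p: "?p n (loc_frac A S y t) = loc_frac A S (component A y n) t" if "y \<in> carrier A" "t \<in> S" for n y t
      using that cc by (intro L_map[where g = "\<lambda>y. component A y n"]) (simp_all add: component_degree0_mult)
    show "\<exists>!f. (\<forall>n. f n \<in> grade L n) \<and> finite {n. f n \<noteq> \<zero>\<^bsub>L\<^esub>} \<and> X = (\<Oplus>\<^bsub>L\<^esub>n\<in>{n. f n \<noteq> \<zero>\<^bsub>L\<^esub>}. f n)"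
    proof (rule L.direct_sum_of_projections[where p = ?p and f = "\<lambda>n. loc_frac A S (component A x n) s"
          and F = "{n. component A x n \<noteq> \<zero>}"])
      show "grade L n \<subseteq> carrier L" for n using gc by auto
      show "loc_frac A S (component A x n) s \<in> grade L n" for n
        by (rule frac_in_L_grade[OF component_grade[OF x(1)] x(2)])
      show "finite {n. component A x n \<noteq> \<zero>}" by (rule component_spec(2)[OF x(1)])
      show "{n. loc_frac A S (component A x n) s \<noteq> \<zero>\<^bsub>L\<^esub>} \<subseteq> {n. component A x n \<noteq> \<zero>}"
        by (intro Collect_mono) (metis L_zero[OF x(2)])
      show "X = (\<Oplus>\<^bsub>L\<^esub>n\<in>{n. component A x n \<noteq> \<zero>}. loc_frac A S (component A x n) s)"
        unfolding x(3) frac_finsum[OF component_spec(2)[OF x(1)] cc[OF x(1)] x(2), symmetric]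
        using component_spec(3)[OF x(1)] by (rule arg_cong)
    next
      fix n Y assume "Y \<in> carrier L"
      then obtain y t where "y \<in> carrier A" "t \<in> S" "Y = loc_frac A S y t" by (auto simp: L_carrier)
      then show "?p n Y \<in> carrier L" by (simp add: p cc dg_loc_simps(1))
      fix Z assume "Z \<in> carrier L"
      with \<open>Y \<in> carrier L\<close> obtain y z t where
        "y \<in> carrier A" "z \<in> carrier A" "t \<in> S" "Y = loc_frac A S y t" "Z = loc_frac A S z t"
        unfolding dg_loc_simps by (rule common_denominator2)
      then show "?p n (Y \<oplus>\<^bsub>L\<^esub> Z) = ?p n Y \<oplus>\<^bsub>L\<^esub> ?p n Z"
        by (simp add: L_add p cc component_add)
    next
      fix m n Y assume "Y \<in> grade L n"
      then obtain y t where "y \<in> grade A n" "t \<in> S" "Y = loc_frac A S y t" by (auto simp: L_grade)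
      then show "?p m Y = (if m = n then Y else \<zero>\<^bsub>L\<^esub>)"
        using component_homogeneous[of y n m] grade_carrier L_zero by (simp add: p)
    qed
  next
    fix n :: int assume "n > 0"
    then have "grade L n = (\<lambda>s. loc_frac A S \<zero> s) ` S" by (auto simp: dg_loc_simps(6) grade_nonpos)
    also have "\<dots> = (\<lambda>s. \<zero>\<^bsub>L\<^esub>) ` S" by (intro image_cong refl L_zero[symmetric])
    also have "\<dots> = {\<zero>\<^bsub>L\<^esub>}" using one_in_S by (intro image_constant)
    finally show "grade L n = {\<zero>\<^bsub>L\<^esub>}" .
  next
    show "\<one>\<^bsub>L\<^esub> \<in> grade L 0" unfolding L_one by (rule frac_in_L_grade[OF grade_one one_in_S])
  next
    fix X i Y j assume "X \<in> grade L i" "Y \<in> grade L j"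
    then obtain a b s where "a \<in> grade A i" "b \<in> grade A j" "s \<in> S" "X = loc_frac A S a s" "Y = loc_frac A S b s"
      by (rule L_common_denominator)
    then show "X \<otimes>\<^bsub>L\<^esub> Y \<in> grade L (i + j)"
      by (simp add: L_mult grade_carrier frac_in_L_grade grade_mult)
  next
    show "diff L \<in> hom (add_monoid L) (add_monoid L)"
    proof (rule homI)
      fix X assume "X \<in> carrier (add_monoid L)"
      then have X: "X \<in> carrier (loc A S)" by (simp add: dg_loc_simps)
      then obtain y t where "y \<in> carrier A" "t \<in> S" "X = loc_frac A S y t" by (auto simp: loc_carrier)
      then show "diff L X \<in> carrier (add_monoid L)" by (simp add: L_diff dg_loc_simps(1))
      fix Y assume "Y \<in> carrier (add_monoid L)"
      then have "Y \<in> carrier (loc A S)" by (simp add: dg_loc_simps)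
      with X obtain y z t where
        "y \<in> carrier A" "z \<in> carrier A" "t \<in> S" "X = loc_frac A S y t" "Y = loc_frac A S z t"
        by (rule common_denominator2)
      then show "diff L (X \<otimes>\<^bsub>add_monoid L\<^esub> Y) = diff L X \<otimes>\<^bsub>add_monoid L\<^esub> diff L Y"
        by (simp add: L_add L_diff diff_add)
    qed
  next
    fix X n assume "X \<in> grade L n"
    then obtain a s where "a \<in> grade A n" "s \<in> S" "X = loc_frac A S a s" by (auto simp: L_grade)
    then show "diff L X \<in> grade L (n + 1)"
      by (simp add: L_diff grade_carrier frac_in_L_grade diff_grade)
  next
    fix X assume "X \<in> carrier L"
    then obtain a s where "a \<in> carrier A" "s \<in> S" "X = loc_frac A S a s" by (auto simp: L_carrier)
    then show "diff L (diff L X) = \<zero>\<^bsub>L\<^esub>" by (simp add: L_diff diff_diff L_zero[of s])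
  next
    fix X i Y assume "X \<in> grade L i" "Y \<in> carrier L"
    then obtain a s b t where X: "a \<in> grade A i" "s \<in> S" "X = loc_frac A S a s"
      and Y: "b \<in> carrier A" "t \<in> S" "Y = loc_frac A S b t" by (auto simp: L_grade L_carrier)
    then show "diff L (X \<otimes>\<^bsub>L\<^esub> Y) = (diff L X \<otimes>\<^bsub>L\<^esub> Y) \<oplus>\<^bsub>L\<^esub> sign_mult L i (X \<otimes>\<^bsub>L\<^esub> diff L Y)"
      using grade_carrier[OF X(1)] leibniz[OF X(1) Y(1)]
      by (simp add: L_mult L_diff L_sign_mult L_add sign_mult_closed)
  next
    fix X i Y j assume "X \<in> grade L i" "Y \<in> grade L j"
    then obtain a b s where X: "a \<in> grade A i" "b \<in> grade A j" "s \<in> S" "X = loc_frac A S a s" "Y = loc_frac A S b s"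
      by (rule L_common_denominator)
    then show "Y \<otimes>\<^bsub>L\<^esub> X = sign_mult L (i * j) (X \<otimes>\<^bsub>L\<^esub> Y)"
      using graded_comm[OF X(1,2)] by (simp add: L_mult L_sign_mult grade_carrier[OF X(1)] grade_carrier[OF X(2)])
  next
    fix X and i :: int assume "X \<in> grade L i" "odd i"
    then obtain a s where "a \<in> grade A i" "s \<in> S" "X = loc_frac A S a s" by (auto simp: L_grade)
    then show "X \<otimes>\<^bsub>L\<^esub> X = \<zero>\<^bsub>L\<^esub>"
      using odd_square[OF _ \<open>odd i\<close>] L_zero[OF mult_in_S[of s s]] by (simp add: L_mult grade_carrier)
  qed
qed

end

section \<open>The tensor product as a DG-ring of fractions\<close>

text \<open>Membership in the free abelian group of formal sums is treated as an abstract closure property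
instead of being unfolded to an inclusion of supports.\<close>
declare carrier_free_Abelian_group_iff [simp del] frag_of_in_free_Abelian_group [simp del]

context degree0_mult_set
begin

text \<open>The tensor product \<open>T = A \<otimes> S\<^sup>-\<^sup>1 A\<^sup>0\<close> over \<open>A\<^sup>0\<close> is the quotient of the group \<open>F\<close> of formal sums by
  \<open>rel\<close>; the class map is \<open>cls\<close>.\<close>
abbreviation D where "D \<equiv> degree0 A"
abbreviation B where "B \<equiv> loc D S"
abbreviation incl where "incl \<equiv> \<lambda>a. loc_frac D S a \<one>"
abbreviation A_mod where "A_mod \<equiv> algebra_via (\<lambda>x. x) A"
abbreviation B_mod where "B_mod \<equiv> algebra_via incl B"
abbreviation F where "F \<equiv> tensor_free A_mod B_mod"
abbreviation rel where "rel \<equiv> tensor_rel D A_mod B_mod"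
abbreviation cls where "cls \<equiv> tensor_class D A_mod B_mod"
abbreviation T where "T \<equiv> dg_base_change A incl B"

lemma degree0_simps:
  "carrier D = grade A 0" "mult D = mult A" "one D = \<one>" "ring.zero D = \<zero>" "add D = add A"
  by (simp_all add: degree0_def)

lemma central_mult_set_degree0: "central_mult_set D S"
proof -
  interpret D: cring D by (rule cring_degree0)
  show ?thesis
    using one_in_S mult_in_S S_degree0 degree0_central grade_carrier
    by unfold_locales (auto simp: degree0_simps)
qed

sublocale D: central_mult_set D S
  by (rule central_mult_set_degree0)

text \<open>The action \<open>x \<cdot> (a / s) = (x a) / s\<close> of the localization of \<open>A\<^sup>0\<close>. It is biadditive and
balanced over \<open>A\<^sup>0\<close>, and so it induces a map from the tensor product to the fractions.\<close>
definition scalar_action :: "'a \<Rightarrow> ('a \<times> 'a) set \<Rightarrow> ('a \<times> 'a) set" where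
  "scalar_action x = loc_map A S (\<lambda>a. x \<otimes> a) (\<lambda>s. s)"

lemma scalar_action_frac:
  assumes "x \<in> carrier A" "a \<in> grade A 0" "s \<in> S"
  shows "scalar_action x (loc_frac D S a s) = loc_frac A S (x \<otimes> a) s"
  unfolding scalar_action_def using assms
  by (intro loc_map_frac[OF central_mult_set_degree0 central_mult_set_axioms])
    (auto simp: degree0_simps grade_carrier central_left)

lemma B_carrier: "\<beta> \<in> carrier B \<longleftrightarrow> (\<exists>a\<in>grade A 0. \<exists>s\<in>S. \<beta> = loc_frac D S a s)"
  by (simp add: D.loc_carrier degree0_simps)

lemma frac_in_B: "a \<in> grade A 0 \<Longrightarrow> s \<in> S \<Longrightarrow> loc_frac D S a s \<in> carrier B"
  using D.frac_in_loc by (simp add: degree0_simps)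

lemma scalar_action_closed: "x \<in> carrier A \<Longrightarrow> \<beta> \<in> carrier B \<Longrightarrow> scalar_action x \<beta> \<in> carrier L"
  by (auto simp: B_carrier scalar_action_frac dg_loc_simps(1) grade_carrier)

lemma scalar_action_add_left:
  "x \<in> carrier A \<Longrightarrow> y \<in> carrier A \<Longrightarrow> \<beta> \<in> carrier B \<Longrightarrow> scalar_action (x \<oplus> y) \<beta> = scalar_action x \<beta> \<oplus>\<^bsub>L\<^esub> scalar_action y \<beta>"
  by (auto simp: B_carrier scalar_action_frac L_add grade_carrier l_distr)

lemma scalar_action_add_right:
  assumes "x \<in> carrier A" "\<beta> \<in> carrier B" "\<gamma> \<in> carrier B"
  shows "scalar_action x (\<beta> \<oplus>\<^bsub>B\<^esub> \<gamma>) = scalar_action x \<beta> \<oplus>\<^bsub>L\<^esub> scalar_action x \<gamma>"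
proof -
  obtain a b s where "a \<in> grade A 0" "b \<in> grade A 0" "s \<in> S" "\<beta> = loc_frac D S a s" "\<gamma> = loc_frac D S b s"
    using D.common_denominator2[OF assms(2,3)] by (auto simp: degree0_simps)
  then show ?thesis
    using assms(1) D.loc_add[of a b s]
    by (simp add: scalar_action_frac L_add grade_carrier grade_add r_distr degree0_simps)
qed

lemma scalar_action_balanced:
  assumes "r \<in> grade A 0" "x \<in> carrier A" "\<beta> \<in> carrier B"
  shows "scalar_action (r \<otimes> x) \<beta> = scalar_action x (incl r \<otimes>\<^bsub>B\<^esub> \<beta>)"
proof -
  obtain a s where "a \<in> grade A 0" "s \<in> S" "\<beta> = loc_frac D S a s"
    using assms(3) by (auto simp: B_carrier)
  then show ?thesis
    using assms(1,2) D.loc_mult[of r a \<one> s] grade_mult[of r 0 a 0] one_in_S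
    by (simp add: scalar_action_frac grade_carrier degree0_simps degree0_central[of r x, symmetric] m_assoc)
qed

lemma scalar_action_mult:
  assumes "x \<in> carrier A" "y \<in> carrier A" "\<beta> \<in> carrier B" "\<gamma> \<in> carrier B"
  shows "scalar_action (x \<otimes> y) (\<beta> \<otimes>\<^bsub>B\<^esub> \<gamma>) = scalar_action x \<beta> \<otimes>\<^bsub>L\<^esub> scalar_action y \<gamma>"
proof -
  obtain a s where a: "a \<in> grade A 0" "s \<in> S" "\<beta> = loc_frac D S a s"
    using assms(3) by (auto simp: B_carrier)
  obtain b t where b: "b \<in> grade A 0" "t \<in> S" "\<gamma> = loc_frac D S b t"
    using assms(4) by (auto simp: B_carrier)
  have "y \<otimes> (a \<otimes> b) = a \<otimes> (y \<otimes> b)"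
    using assms a(1) b(1) grade_carrier degree0_central[OF a(1), of y] by (simp add: m_assoc[symmetric])
  then have "(x \<otimes> y) \<otimes> (a \<otimes> b) = (x \<otimes> a) \<otimes> (y \<otimes> b)"
    using assms a b grade_carrier by (simp add: m_assoc)
  then show ?thesis
    using assms a b D.loc_mult[of a b s t] grade_mult[of a 0 b 0] mult_in_S
    by (simp add: scalar_action_frac L_mult grade_carrier degree0_simps)
qed

lemma scalar_action_diff:
  assumes "x \<in> carrier A" "\<beta> \<in> carrier B"
  shows "scalar_action (diff A x) \<beta> = diff L (scalar_action x \<beta>)"
proof -
  obtain a s where a: "a \<in> grade A 0" "s \<in> S" "\<beta> = loc_frac D S a s"
    using assms by (auto simp: B_carrier)
  have "diff A (x \<otimes> a) = diff A x \<otimes> a"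
    using assms a grade_carrier diff_degree0_mult[OF a(1) assms(1)] degree0_central[OF a(1)] by simp
  then show ?thesis using assms a grade_carrier by (simp add: scalar_action_frac L_diff)
qed

lemma F_carrier: "c \<in> carrier F \<longleftrightarrow> Poly_Mapping.keys c \<subseteq> carrier A \<times> carrier B"
  by (simp add: algebra_via_def carrier_free_Abelian_group_iff)

text \<open>The additive extension of the action to formal sums, \<open>\<Sum> n\<^sub>i (x\<^sub>i, \<beta>\<^sub>i) \<mapsto> \<Sum> n\<^sub>i x\<^sub>i \<cdot> \<beta>\<^sub>i\<close>, chosen by
the universal property of the free abelian group. Outside the group its value is arbitrary.\<close>
definition tensor_eval :: "('a \<times> ('a \<times> 'a) set \<Rightarrow>\<^sub>0 int) \<Rightarrow> ('a \<times> 'a) set" where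
  "tensor_eval = (SOME h. h \<in> hom F (add_monoid L) \<and> (\<forall>x\<in>carrier A. \<forall>\<beta>\<in>carrier B. h (frag_of (x, \<beta>)) = scalar_action x \<beta>))"

lemma tensor_eval_spec:
  shows "tensor_eval \<in> hom F (add_monoid L)"
    and "x \<in> carrier A \<Longrightarrow> \<beta> \<in> carrier B \<Longrightarrow> tensor_eval (frag_of (x, \<beta>)) = scalar_action x \<beta>"
proof -
  interpret L: comm_dg_ring L by (rule comm_dg_ring_L)
  have "case_prod scalar_action ` (carrier A \<times> carrier B) \<subseteq> carrier (add_monoid L)"
    using scalar_action_closed by auto
  then obtain h where "h \<in> hom (free_Abelian_group (carrier A \<times> carrier B)) (add_monoid L)"
    "\<And>x. x \<in> carrier A \<times> carrier B \<Longrightarrow> h (frag_of x) = case_prod scalar_action x"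
    using comm_group.free_Abelian_group_universal[OF L.a_comm_group] by metis
  then have "\<exists>h. h \<in> hom F (add_monoid L) \<and> (\<forall>x\<in>carrier A. \<forall>\<beta>\<in>carrier B. h (frag_of (x, \<beta>)) = scalar_action x \<beta>)"
    by (intro exI[of _ h]) (auto simp: algebra_via_def)
  from someI_ex[OF this, folded tensor_eval_def]
  show "tensor_eval \<in> hom F (add_monoid L)"
    and "x \<in> carrier A \<Longrightarrow> \<beta> \<in> carrier B \<Longrightarrow> tensor_eval (frag_of (x, \<beta>)) = scalar_action x \<beta>"
    by auto
qed

lemma F_zero [simp]: "0 \<in> carrier F" unfolding F_carrier by simp

lemma F_add [simp]: "c \<in> carrier F \<Longrightarrow> c' \<in> carrier F \<Longrightarrow> c + c' \<in> carrier F"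
  using keys_add[of c c'] unfolding F_carrier by blast

lemma F_minus [simp]: "c \<in> carrier F \<Longrightarrow> - c \<in> carrier F"
  unfolding F_carrier by simp

lemma F_diff [simp]: "c \<in> carrier F \<Longrightarrow> c' \<in> carrier F \<Longrightarrow> c - c' \<in> carrier F"
  using F_add[of c "- c'"] by simp

lemma F_frag_of [simp]: "x \<in> carrier A \<Longrightarrow> \<beta> \<in> carrier B \<Longrightarrow> frag_of (x, \<beta>) \<in> carrier F"
  unfolding F_carrier by simp

lemma tensor_eval_closed: "c \<in> carrier F \<Longrightarrow> tensor_eval c \<in> carrier L"
  using tensor_eval_spec(1) by (auto simp: hom_def)

lemma tensor_eval_add: "c \<in> carrier F \<Longrightarrow> c' \<in> carrier F \<Longrightarrow> tensor_eval (c + c') = tensor_eval c \<oplus>\<^bsub>L\<^esub> tensor_eval c'"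
  using hom_mult[OF tensor_eval_spec(1), of c c'] by (simp)

lemma tensor_eval_zero: "tensor_eval 0 = \<zero>\<^bsub>L\<^esub>"
proof -
  interpret L: ring L by (rule ring_L)
  show ?thesis using tensor_eval_add[of 0 0] tensor_eval_closed[of 0] L.add.l_cancel_one[of "tensor_eval 0" "tensor_eval 0"] by simp
qed

lemma tensor_eval_diff:
  assumes "c \<in> carrier F" "c' \<in> carrier F"
  shows "tensor_eval (c - c') = tensor_eval c \<ominus>\<^bsub>L\<^esub> tensor_eval c'"
proof -
  interpret L: ring L by (rule ring_L)
  have "tensor_eval c = tensor_eval (c - c') \<oplus>\<^bsub>L\<^esub> tensor_eval c'"
    using tensor_eval_add[of "c - c'" c'] assms by simp
  then show ?thesis
    using tensor_eval_closed assms by (simp add: a_minus_def L.minus_eq L.a_assoc L.r_neg)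
qed

lemma F_induct [consumes 1, case_names zero diff frag]:
  assumes "c \<in> carrier F" "P 0"
    and "\<And>c c'. c \<in> carrier F \<Longrightarrow> c' \<in> carrier F \<Longrightarrow> P c \<Longrightarrow> P c' \<Longrightarrow> P (c - c')"
    and "\<And>x \<beta>. x \<in> carrier A \<Longrightarrow> \<beta> \<in> carrier B \<Longrightarrow> P (frag_of (x, \<beta>))"
  shows "P c"
  using assms(1)[unfolded F_carrier] assms(2)
proof (rule free_Abelian_group_induct)
  show "P (c - c')" if "Poly_Mapping.keys c \<subseteq> carrier A \<times> carrier B"
    "Poly_Mapping.keys c' \<subseteq> carrier A \<times> carrier B" "P c" "P c'" for c c'
    using assms(3)[of c c'] that unfolding F_carrier by blast
qed (use assms(4) in auto)

definition tensor_relators :: "('a \<times> ('a \<times> 'a) set \<Rightarrow>\<^sub>0 int) set" where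
  "tensor_relators =
    {frag_of (x \<oplus> x', y) - frag_of (x, y) - frag_of (x', y) | x x' y.
        x \<in> carrier A \<and> x' \<in> carrier A \<and> y \<in> carrier B} \<union>
     {frag_of (x, y \<oplus>\<^bsub>B\<^esub> y') - frag_of (x, y) - frag_of (x, y') | x y y'.
        x \<in> carrier A \<and> y \<in> carrier B \<and> y' \<in> carrier B} \<union>
     {frag_of (r \<otimes> x, y) - frag_of (x, incl r \<otimes>\<^bsub>B\<^esub> y) | r x y.
        r \<in> grade A 0 \<and> x \<in> carrier A \<and> y \<in> carrier B}"

lemma rel_eq_generate: "rel = generate F tensor_relators"
  by (simp add: tensor_rel_def tensor_relators_def algebra_via_def degree0_simps)

lemma B_closed:
  assumes "y \<in> carrier B" "y' \<in> carrier B"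
  shows "y \<oplus>\<^bsub>B\<^esub> y' \<in> carrier B" "y \<otimes>\<^bsub>B\<^esub> y' \<in> carrier B"
  using assms ring.ring_simprules(1,5)[OF D.ring_loc] by auto

lemma incl_closed: "r \<in> grade A 0 \<Longrightarrow> incl r \<in> carrier B"
  using frac_in_B one_in_S by blast

lemma tensor_relators_subset: "tensor_relators \<subseteq> carrier F"
  unfolding tensor_relators_def
  by (auto intro!: F_diff F_frag_of B_closed incl_closed dest: grade_carrier)

lemma subgroup_rel: "subgroup rel F"
  unfolding rel_eq_generate
  by (rule group.generate_is_subgroup[OF group_free_Abelian_group tensor_relators_subset])

lemma rel_closed:
  shows "0 \<in> rel" "c \<in> rel \<Longrightarrow> c' \<in> rel \<Longrightarrow> c + c' \<in> rel" "c \<in> rel \<Longrightarrow> - c \<in> rel"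
    "c \<in> rel \<Longrightarrow> c' \<in> rel \<Longrightarrow> c - c' \<in> rel"
proof -
  have inv: "inv\<^bsub>F\<^esub> c = - c" if "c \<in> rel" for c
    using subsetD[OF subgroup.subset[OF subgroup_rel] that]
    by (simp add: carrier_free_Abelian_group_iff)
  show "0 \<in> rel" using subgroup.one_closed[OF subgroup_rel] by simp
  show add: "c + c' \<in> rel" if "c \<in> rel" "c' \<in> rel" for c c'
    using subgroup.m_closed[OF subgroup_rel that] by simp
  show minus: "- c \<in> rel" if "c \<in> rel" for c
    using subgroup.m_inv_closed[OF subgroup_rel that] inv[OF that] by simp
  show "c - c' \<in> rel" if "c \<in> rel" "c' \<in> rel" for c c'
    using add[OF that(1) minus[OF that(2)]] by simp
qed

lemma rel_relators:
  shows "x \<in> carrier A \<Longrightarrow> x' \<in> carrier A \<Longrightarrow> y \<in> carrier B \<Longrightarrow>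
      frag_of (x \<oplus> x', y) - frag_of (x, y) - frag_of (x', y) \<in> rel"
    and "r \<in> grade A 0 \<Longrightarrow> x \<in> carrier A \<Longrightarrow> y \<in> carrier B \<Longrightarrow>
      frag_of (r \<otimes> x, y) - frag_of (x, incl r \<otimes>\<^bsub>B\<^esub> y) \<in> rel"
  unfolding rel_eq_generate by (rule generate.incl; fastforce simp: tensor_relators_def)+

lemma rel_zero_left:
  assumes "y \<in> carrier B" shows "frag_of (\<zero>, y) \<in> rel"
  using rel_closed(3)[OF rel_relators(1)[of \<zero> \<zero> y]] assms by simp

lemma rel_diff_left:
  assumes "x \<in> carrier A" "x' \<in> carrier A" "y \<in> carrier B"
  shows "frag_of (x, y) - frag_of (x', y) - frag_of (x \<ominus> x', y) \<in> rel"
proof -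
  have "(x \<ominus> x') \<oplus> x' = x" using assms by (simp add: a_minus_def a_assoc l_neg)
  then have "frag_of (x, y) - frag_of (x \<ominus> x', y) - frag_of (x', y) \<in> rel"
    using rel_relators(1)[of "x \<ominus> x'" x' y] assms by simp
  then show ?thesis by (simp add: algebra_simps)
qed

text \<open>In \<open>S\<^sup>-\<^sup>1 A\<^sup>0\<close> one has \<open>1/s = t \<cdot> 1/(s t)\<close>, and the scalar \<open>t\<close> moves across the tensor sign. So two
pure tensors can be given the same right factor.\<close>
lemma rel_expand:
  assumes "x \<in> carrier A" "s \<in> S" "t \<in> S"
  shows "frag_of (t \<otimes> x, loc_frac D S \<one> (s \<otimes> t)) - frag_of (x, loc_frac D S \<one> s) \<in> rel"
proof -
  have "incl t \<otimes>\<^bsub>B\<^esub> loc_frac D S \<one> (s \<otimes> t) = loc_frac D S (\<one> \<otimes> t) (s \<otimes> t)"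
    using assms D.loc_mult[of t \<one> \<one> "s \<otimes> t"] one_in_S mult_in_S grade_one
    by (simp add: degree0_simps)
  also have "\<dots> = loc_frac D S \<one> s"
    using D.frac_cancel[of \<one> s t] assms grade_one by (simp add: degree0_simps)
  finally show ?thesis
    using rel_relators(2)[of t x "loc_frac D S \<one> (s \<otimes> t)"] assms frac_in_B[OF grade_one] mult_in_S by simp
qed

text \<open>A pure tensor \<open>x \<otimes> a/s\<close> equals \<open>a x \<otimes> 1/s\<close>, and a difference of two such tensors is brought to the
common denominator \<open>s t\<close> and combined in the left factor.\<close>
lemma rel_pure_tensor:
  assumes "c \<in> carrier F"
  shows "\<exists>x\<in>carrier A. \<exists>s\<in>S. c - frag_of (x, loc_frac D S \<one> s) \<in> rel"
  using assms
proof (induction c rule: F_induct)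
  case zero
  show ?case
    using rel_closed(3)[OF rel_zero_left[OF frac_in_B[OF grade_one one_in_S]]] one_in_S
    by (intro bexI[of _ \<zero>] bexI[of _ \<one>]) auto
next
  case (diff c c')
  then obtain x s y t where x: "x \<in> carrier A" "s \<in> S" "c - frag_of (x, loc_frac D S \<one> s) \<in> rel"
    and y: "y \<in> carrier A" "t \<in> S" "c' - frag_of (y, loc_frac D S \<one> t) \<in> rel" by blast
  let ?\<beta> = "loc_frac D S \<one> (s \<otimes> t)"
  have \<beta>: "?\<beta> \<in> carrier B" using frac_in_B[OF grade_one] mult_in_S x y by simp
  have "t \<otimes> s = s \<otimes> t" using central[of s t] x y by simp
  then have 1: "frag_of (t \<otimes> x, ?\<beta>) - frag_of (x, loc_frac D S \<one> s) \<in> rel"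
    and 2: "frag_of (s \<otimes> y, ?\<beta>) - frag_of (y, loc_frac D S \<one> t) \<in> rel"
    using rel_expand[of x s t] rel_expand[of y t s] x y by auto
  have 3: "frag_of (t \<otimes> x, ?\<beta>) - frag_of (s \<otimes> y, ?\<beta>) - frag_of (t \<otimes> x \<ominus> s \<otimes> y, ?\<beta>) \<in> rel"
    using rel_diff_left[OF _ _ \<beta>, of "t \<otimes> x" "s \<otimes> y"] x y by simp
  \<comment> \<open>The relation for \<open>c - c'\<close> is the difference of the two induction hypotheses, corrected by
      the two changes of denominator and by additivity in the left factor.\<close>
  have "c - c' - frag_of (t \<otimes> x \<ominus> s \<otimes> y, ?\<beta>) =
      ((c - frag_of (x, loc_frac D S \<one> s)) - (c' - frag_of (y, loc_frac D S \<one> t)))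
      - (frag_of (t \<otimes> x, ?\<beta>) - frag_of (x, loc_frac D S \<one> s))
      + (frag_of (s \<otimes> y, ?\<beta>) - frag_of (y, loc_frac D S \<one> t))
      + (frag_of (t \<otimes> x, ?\<beta>) - frag_of (s \<otimes> y, ?\<beta>) - frag_of (t \<otimes> x \<ominus> s \<otimes> y, ?\<beta>))"
    by simp
  also have "\<dots> \<in> rel"
    by (intro rel_closed(2,4) x(3) y(3) 1 2 3)
  finally have "c - c' - frag_of (t \<otimes> x \<ominus> s \<otimes> y, ?\<beta>) \<in> rel" .
  moreover have "t \<otimes> x \<ominus> s \<otimes> y \<in> carrier A" "s \<otimes> t \<in> S" using x y mult_in_S by auto
  ultimately show ?case by blast
next
  case (frag x \<beta>)
  then obtain a s where a: "a \<in> grade A 0" "s \<in> S" "\<beta> = loc_frac D S a s" by (auto simp: B_carrier)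
  have "incl a \<otimes>\<^bsub>B\<^esub> loc_frac D S \<one> s = \<beta>"
    using D.loc_mult[of a \<one> \<one> s] a one_in_S grade_one grade_carrier[OF a(1)] by (simp add: degree0_simps)
  then have "frag_of (a \<otimes> x, loc_frac D S \<one> s) - frag_of (x, \<beta>) \<in> rel"
    using rel_relators(2)[OF a(1) frag(1) frac_in_B[OF grade_one a(2)]] by simp
  from rel_closed(3)[OF this] have "frag_of (x, \<beta>) - frag_of (a \<otimes> x, loc_frac D S \<one> s) \<in> rel" by simp
  then show ?case using a frag grade_carrier by blast
qed

lemma tensor_eval_rel:
  assumes "c \<in> rel" shows "tensor_eval c = \<zero>\<^bsub>L\<^esub>"
proof -
  interpret L: comm_dg_ring L by (rule comm_dg_ring_L)
  interpret e: group_hom F "add_monoid L" tensor_eval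
    by (intro group_hom.intro group_hom_axioms.intro group_free_Abelian_group L.add.group_axioms tensor_eval_spec(1))
  have "tensor_relators \<subseteq> kernel F (add_monoid L) tensor_eval"
  proof
    fix g assume g: "g \<in> tensor_relators"
    then have gF: "g \<in> carrier F" using tensor_relators_subset by auto
    from g have "tensor_eval g = \<zero>\<^bsub>L\<^esub>"
      unfolding tensor_relators_def
    proof (elim UnE CollectE exE conjE)
      fix x x' y
      assume *: "g = frag_of (x \<oplus> x', y) - frag_of (x, y) - frag_of (x', y)"
        "x \<in> carrier A" "x' \<in> carrier A" "y \<in> carrier B"
      then show ?thesis
        using scalar_action_closed by (simp add: tensor_eval_diff tensor_eval_spec(2) scalar_action_add_left L.minus_eq L.a_ac L.minus_add L.r_neg
            L.r_neg1 L.r_neg2)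
    next
      fix x y y'
      assume *: "g = frag_of (x, y \<oplus>\<^bsub>B\<^esub> y') - frag_of (x, y) - frag_of (x, y')"
        "x \<in> carrier A" "y \<in> carrier B" "y' \<in> carrier B"
      then show ?thesis
        using scalar_action_closed by (simp add: tensor_eval_diff tensor_eval_spec(2) scalar_action_add_right B_closed L.minus_eq L.a_ac L.minus_add
            L.r_neg L.r_neg1 L.r_neg2)
    next
      fix r x y
      assume *: "g = frag_of (r \<otimes> x, y) - frag_of (x, incl r \<otimes>\<^bsub>B\<^esub> y)"
        "r \<in> grade A 0" "x \<in> carrier A" "y \<in> carrier B"
      then show ?thesis
        using scalar_action_closed by (simp add: tensor_eval_diff tensor_eval_spec(2) scalar_action_balanced B_closed incl_closed grade_carrier
            L.minus_eq L.r_neg)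
    qed
    then show "g \<in> kernel F (add_monoid L) tensor_eval" using gF by (simp add: kernel_def)
  qed
  then have "rel \<subseteq> kernel F (add_monoid L) tensor_eval"
    unfolding rel_eq_generate by (rule group.generate_subgroup_incl[OF group_free_Abelian_group _ e.subgroup_kernel])
  then show ?thesis using assms by (auto simp: kernel_def)
qed

text \<open>By reduction to a pure tensor only \<open>x \<otimes> 1/s\<close> has to be considered. If \<open>x / s\<close> vanishes then \<open>u x = 0\<close> for
some \<open>u\<close> in \<open>S\<close>, and \<open>x \<otimes> 1/s = u x \<otimes> 1/(s u)\<close> is zero already in the tensor product. In other
words, the tensor product with a localization has no more relations than the fractions have.\<close>
lemma tensor_eval_eq_zero_iff:
  assumes c: "c \<in> carrier F"
  shows "tensor_eval c = \<zero>\<^bsub>L\<^esub> \<longleftrightarrow> c \<in> rel"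
proof
  interpret L: comm_dg_ring L by (rule comm_dg_ring_L)
  assume 0: "tensor_eval c = \<zero>\<^bsub>L\<^esub>"
  obtain x s where x: "x \<in> carrier A" "s \<in> S" and cx: "c - frag_of (x, loc_frac D S \<one> s) \<in> rel"
    using rel_pure_tensor[OF c] by blast
  have \<beta>: "loc_frac D S \<one> t \<in> carrier B" if "t \<in> S" for t using frac_in_B[OF grade_one that] .
  have "tensor_eval (c - frag_of (x, loc_frac D S \<one> s)) = \<zero>\<^bsub>L\<^esub>" by (rule tensor_eval_rel[OF cx])
  then have "\<ominus>\<^bsub>L\<^esub> scalar_action x (loc_frac D S \<one> s) = \<zero>\<^bsub>L\<^esub>"
    using 0 x \<beta> c scalar_action_closed by (simp add: tensor_eval_diff tensor_eval_spec(2) L.minus_eq)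
  then have "scalar_action x (loc_frac D S \<one> s) = \<zero>\<^bsub>L\<^esub>"
    using L.minus_minus[OF scalar_action_closed[OF x(1) \<beta>[OF x(2)]]] by simp
  then obtain u where u: "u \<in> S" "u \<otimes> x = \<zero>"
    using x frac_eq_zero_iff[of x s] grade_one by (auto simp: scalar_action_frac dg_loc_simps)
  have "frag_of (\<zero>, loc_frac D S \<one> (s \<otimes> u)) - frag_of (x, loc_frac D S \<one> s) \<in> rel"
    using rel_expand[OF x u(1)] u(2) by simp
  from rel_closed(2)[OF rel_closed(4)[OF cx this] rel_zero_left[OF \<beta>[OF mult_in_S[OF x(2) u(1)]]]]
  show "c \<in> rel" by simp
qed (rule tensor_eval_rel)

lemma rel_subset: "rel \<subseteq> carrier F"
  by (rule subgroup.subset[OF subgroup_rel])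

text \<open>Elements of the tensor product are thus the fibres of the evaluation, and its operations,
which are unions over representatives, are well defined as soon as the evaluation of the result
depends only on the evaluation of the arguments.\<close>
lemma mem_cls:
  assumes c: "c \<in> carrier F"
  shows "c' \<in> cls c \<longleftrightarrow> c' \<in> carrier F \<and> tensor_eval c' = tensor_eval c"
proof -
  interpret L: ring L by (rule ring_L)
  have "cls c = {r + c | r. r \<in> rel}" by (auto simp: tensor_class_def r_coset_def)
  then have "c' \<in> cls c \<longleftrightarrow> c' - c \<in> rel" by (force simp: algebra_simps)
  also have "\<dots> \<longleftrightarrow> c' \<in> carrier F \<and> tensor_eval c' = tensor_eval c"
  proof
    assume r: "c' - c \<in> rel"
    then have c': "c' \<in> carrier F" using F_add[of "c' - c" c] rel_subset c by auto
    have "tensor_eval c' \<ominus>\<^bsub>L\<^esub> tensor_eval c = \<zero>\<^bsub>L\<^esub>" using tensor_eval_rel[OF r] tensor_eval_diff[OF c' c] by simp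
    then show "c' \<in> carrier F \<and> tensor_eval c' = tensor_eval c" using c' c tensor_eval_closed by simp
  next
    assume c': "c' \<in> carrier F \<and> tensor_eval c' = tensor_eval c"
    then have "tensor_eval (c' - c) = \<zero>\<^bsub>L\<^esub>" using c tensor_eval_closed by (simp add: tensor_eval_diff L.r_right_minus_eq)
    then show "c' - c \<in> rel" using tensor_eval_eq_zero_iff c c' by simp
  qed
  finally show ?thesis .
qed

lemma cls_eqI: "c \<in> carrier F \<Longrightarrow> c' \<in> carrier F \<Longrightarrow> tensor_eval c = tensor_eval c' \<Longrightarrow> cls c = cls c'"
  by (auto simp: mem_cls)

lemma UN_cls:
  assumes "c \<in> carrier F" "\<And>c'. c' \<in> carrier F \<Longrightarrow> tensor_eval c' = tensor_eval c \<Longrightarrow> G c' = G c"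
  shows "(\<Union>c'\<in>cls c. G c') = G c"
proof -
  have "G c' = G c" if "c' \<in> cls c" for c'
    using assms(2)[of c'] that mem_cls[OF assms(1)] by blast
  moreover have "c \<in> cls c" using assms(1) by (simp add: mem_cls)
  ultimately show ?thesis by blast
qed

definition tensor_value :: "('a \<times> ('a \<times> 'a) set \<Rightarrow>\<^sub>0 int) set \<Rightarrow> ('a \<times> 'a) set" where
  "tensor_value X = tensor_eval (SOME c. c \<in> X)"

lemma tensor_value_cls:
  assumes "c \<in> carrier F" shows "tensor_value (cls c) = tensor_eval c"
proof -
  have "c \<in> cls c" using assms by (simp add: mem_cls)
  then have "(SOME c'. c' \<in> cls c) \<in> cls c" by (rule someI)
  then show ?thesis using assms by (simp add: mem_cls tensor_value_def)
qed

definition tensor_product where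
  "tensor_product c c' = frag_extend (\<lambda>(x, y). frag_extend (\<lambda>(x', y'). frag_of (x \<otimes> x', y \<otimes>\<^bsub>B\<^esub> y')) c') c"

definition tensor_differential where
  "tensor_differential c = frag_extend (\<lambda>(x, y). frag_of (diff A x, y)) c"

lemma T_simps:
  "carrier T = carrier (F Mod rel)"
  "X \<otimes>\<^bsub>T\<^esub> Y = (\<Union>c\<in>X. \<Union>c'\<in>Y. cls (tensor_product c c'))"
  "\<one>\<^bsub>T\<^esub> = cls (frag_of (\<one>, \<one>\<^bsub>B\<^esub>))"
  "\<zero>\<^bsub>T\<^esub> = rel"
  "X \<oplus>\<^bsub>T\<^esub> Y = X <#>\<^bsub>F\<^esub> Y"
  "grade T n = cls ` carrier (free_Abelian_group (grade A n \<times> carrier B))"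
  "diff T X = (\<Union>c\<in>X. cls (tensor_differential c))"
  by (simp_all add: dg_base_change_def Let_def ring.extend_def dg_ring.fields_def tensor_ring_def
      tensor_product_def tensor_differential_def) (simp_all add: algebra_via_def FactGroup_def)

lemma T_carrier: "X \<in> carrier T \<longleftrightarrow> (\<exists>c\<in>carrier F. X = cls c)"
  by (auto simp: T_simps FactGroup_def RCOSETS_def tensor_class_def)

lemma cls_in_T: "c \<in> carrier F \<Longrightarrow> cls c \<in> carrier T"
  by (auto simp: T_carrier)

lemma T_zero: "\<zero>\<^bsub>T\<^esub> = cls 0"
  using subgroup.subset[OF subgroup_rel] by (auto simp: T_simps mem_cls tensor_eval_zero tensor_eval_eq_zero_iff)

lemma T_add:
  assumes "c \<in> carrier F" "c' \<in> carrier F"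
  shows "cls c \<oplus>\<^bsub>T\<^esub> cls c' = cls (c + c')"
proof -
  have "rel \<lhd> F" by (rule comm_group.subgroup_imp_normal[OF abelian_free_Abelian_group subgroup_rel])
  from normal.rcos_sum[OF this assms] show ?thesis by (simp add: T_simps tensor_class_def)
qed

lemma one_B: "\<one>\<^bsub>B\<^esub> = loc_frac D S \<one> \<one>" "\<one>\<^bsub>B\<^esub> \<in> carrier B"
  using D.loc_one frac_in_B[OF grade_one one_in_S] by (simp_all add: degree0_simps)

lemma tensor_product_pure:
  assumes x: "x \<in> carrier A" "\<beta> \<in> carrier B" and "c \<in> carrier F"
  shows "tensor_product (frag_of (x, \<beta>)) c \<in> carrier F \<and> tensor_eval (tensor_product (frag_of (x, \<beta>)) c) = scalar_action x \<beta> \<otimes>\<^bsub>L\<^esub> tensor_eval c"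
  using assms(3)
proof (induction c rule: F_induct)
  interpret L: comm_dg_ring L by (rule comm_dg_ring_L)
  case zero
  show ?case using scalar_action_closed[OF x] by (simp add: tensor_product_def tensor_eval_zero)
next
  interpret L: comm_dg_ring L by (rule comm_dg_ring_L)
  case (diff c c')
  then have eq: "tensor_product (frag_of (x, \<beta>)) (c - c') = tensor_product (frag_of (x, \<beta>)) c - tensor_product (frag_of (x, \<beta>)) c'"
    by (simp add: tensor_product_def frag_extend_diff)
  show ?case unfolding eq using diff scalar_action_closed[OF x] tensor_eval_closed
    by (simp add: tensor_eval_diff L.minus_eq L.r_distr L.r_minus)
next
  case (frag y \<gamma>)
  then show ?case using x by (simp add: tensor_product_def B_closed tensor_eval_spec(2) scalar_action_mult)
qed

lemma tensor_eval_product: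
  assumes "c \<in> carrier F" and c': "c' \<in> carrier F"
  shows "tensor_product c c' \<in> carrier F \<and> tensor_eval (tensor_product c c') = tensor_eval c \<otimes>\<^bsub>L\<^esub> tensor_eval c'"
  using assms(1)
proof (induction c rule: F_induct)
  interpret L: comm_dg_ring L by (rule comm_dg_ring_L)
  case zero
  show ?case using tensor_eval_closed[OF c'] by (simp add: tensor_product_def tensor_eval_zero)
next
  interpret L: comm_dg_ring L by (rule comm_dg_ring_L)
  case (diff c d)
  then have eq: "tensor_product (c - d) c' = tensor_product c c' - tensor_product d c'"
    by (simp add: tensor_product_def frag_extend_diff)
  show ?case unfolding eq using diff tensor_eval_closed c'
    by (simp add: tensor_eval_diff L.minus_eq L.l_distr L.l_minus)
next
  case (frag y \<gamma>)
  then show ?case using tensor_product_pure[OF frag c'] by (simp add: tensor_eval_spec(2))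
qed

lemma T_mult:
  assumes "c \<in> carrier F" "c' \<in> carrier F"
  shows "cls c \<otimes>\<^bsub>T\<^esub> cls c' = cls (tensor_product c c')"
proof -
  have "(\<Union>b'\<in>cls c'. cls (tensor_product b b')) = cls (tensor_product b c')" if "b \<in> cls c" for b
    using assms that by (intro UN_cls cls_eqI) (auto simp: mem_cls tensor_eval_product)
  then have "cls c \<otimes>\<^bsub>T\<^esub> cls c' = (\<Union>b\<in>cls c. cls (tensor_product b c'))" by (simp add: T_simps)
  also have "\<dots> = cls (tensor_product c c')"
    using assms by (intro UN_cls cls_eqI) (auto simp: tensor_eval_product)
  finally show ?thesis .
qed

lemma tensor_eval_differential:
  assumes "c \<in> carrier F"
  shows "tensor_differential c \<in> carrier F \<and> tensor_eval (tensor_differential c) = diff L (tensor_eval c)"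
  using assms
proof (induction c rule: F_induct)
  interpret L: comm_dg_ring L by (rule comm_dg_ring_L)
  case zero
  show ?case by (simp add: tensor_differential_def tensor_eval_zero)
next
  interpret L: comm_dg_ring L by (rule comm_dg_ring_L)
  interpret d: group_hom "add_monoid L" "add_monoid L" "diff L"
    using L.diff_hom by unfold_locales
  case (diff c c')
  have eq: "tensor_differential (c - c') = tensor_differential c - tensor_differential c'"
    by (simp add: tensor_differential_def frag_extend_diff)
  have "diff L (\<ominus>\<^bsub>L\<^esub> tensor_eval c') = \<ominus>\<^bsub>L\<^esub> diff L (tensor_eval c')"
    using d.hom_inv[of "tensor_eval c'"] tensor_eval_closed[OF diff(2)] by (simp add: a_inv_def)
  then show ?case unfolding eq using diff tensor_eval_closed
    by (simp add: tensor_eval_diff L.minus_eq L.diff_add)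
next
  case (frag x \<beta>)
  then show ?case by (simp add: tensor_differential_def tensor_eval_spec(2) scalar_action_diff)
qed

lemma T_diff: "c \<in> carrier F \<Longrightarrow> diff T (cls c) = cls (tensor_differential c)"
  unfolding T_simps by (intro UN_cls cls_eqI) (auto simp: tensor_eval_differential)

lemma tensor_eval_pure: "x \<in> carrier A \<Longrightarrow> s \<in> S \<Longrightarrow> tensor_eval (frag_of (x, loc_frac D S \<one> s)) = loc_frac A S x s"
  by (simp add: tensor_eval_spec(2) frac_in_B grade_one scalar_action_frac)

text \<open>The grading of the tensor product consists of the classes of formal sums with left factors of degree
\<open>n\<close>. Such a sum evaluates to a fraction of degree \<open>n\<close>; conversely the class of a formal sum with
value \<open>a / s\<close> also contains \<open>(a, 1/s)\<close>.\<close>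
lemma T_grade: "X \<in> grade T n \<longleftrightarrow> X \<in> carrier T \<and> tensor_value X \<in> grade L n"
proof
  interpret L: comm_dg_ring L by (rule comm_dg_ring_L)
  assume "X \<in> grade T n"
  then obtain c where c: "Poly_Mapping.keys c \<subseteq> grade A n \<times> carrier B" "X = cls c"
    by (auto simp: T_simps carrier_free_Abelian_group_iff)
  have F: "b \<in> carrier F" if "Poly_Mapping.keys b \<subseteq> grade A n \<times> carrier B" for b
    using that grade_carrier unfolding F_carrier by blast
  have "tensor_eval c \<in> grade L n"
    using c(1)
  proof (rule free_Abelian_group_induct)
    show "tensor_eval 0 \<in> grade L n" by (simp add: tensor_eval_zero)
  next
    fix b b' assume "Poly_Mapping.keys b \<subseteq> grade A n \<times> carrier B" "Poly_Mapping.keys b' \<subseteq> grade A n \<times> carrier B"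
      and "tensor_eval b \<in> grade L n" "tensor_eval b' \<in> grade L n"
    then show "tensor_eval (b - b') \<in> grade L n"
      using F[of b] F[of b'] by (simp add: tensor_eval_diff L.minus_eq L.grade_add L.grade_a_inv)
  next
    fix p assume "p \<in> grade A n \<times> carrier B"
    then obtain x \<beta> where p: "p = (x, \<beta>)" "x \<in> grade A n" "\<beta> \<in> carrier B" by auto
    then obtain a s where a: "a \<in> grade A 0" "s \<in> S" "\<beta> = loc_frac D S a s" by (auto simp: B_carrier)
    then show "tensor_eval (frag_of p) \<in> grade L n"
      using p frac_in_L_grade[of "x \<otimes> a" n s] grade_mult[of x n a 0]
      by (simp add: tensor_eval_spec(2) scalar_action_frac grade_carrier)
  qed
  then show "X \<in> carrier T \<and> tensor_value X \<in> grade L n"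
    using F[OF c(1)] c(2) by (simp add: tensor_value_cls cls_in_T)
next
  assume X: "X \<in> carrier T \<and> tensor_value X \<in> grade L n"
  then obtain c where c: "c \<in> carrier F" "X = cls c" by (auto simp: T_carrier)
  then obtain a s where a: "a \<in> grade A n" "s \<in> S" "tensor_eval c = loc_frac A S a s"
    using X by (auto simp: L_grade tensor_value_cls)
  have "X = cls (frag_of (a, loc_frac D S \<one> s))"
    unfolding c(2) using a c(1) by (intro cls_eqI) (simp_all add: tensor_eval_pure frac_in_B grade_one grade_carrier)
  moreover have "frag_of (a, loc_frac D S \<one> s) \<in> carrier (free_Abelian_group (grade A n \<times> carrier B))"
    using a by (simp add: frag_of_in_free_Abelian_group frac_in_B grade_one)
  ultimately show "X \<in> grade T n" unfolding T_simps by blast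
qed

lemma bij_tensor_value: "bij_betw tensor_value (carrier T) (carrier L)"
  unfolding bij_betw_def
proof
  show "inj_on tensor_value (carrier T)"
  proof (rule inj_onI)
    fix X Y assume "X \<in> carrier T" "Y \<in> carrier T" and eq: "tensor_value X = tensor_value Y"
    then obtain c d where cd: "c \<in> carrier F" "X = cls c" "d \<in> carrier F" "Y = cls d"
      by (auto simp: T_carrier)
    then have "tensor_eval c = tensor_eval d" using eq by (simp add: tensor_value_cls)
    then show "X = Y" using cls_eqI[OF cd(1,3)] cd by simp
  qed
  show "tensor_value ` carrier T = carrier L"
  proof
    show "tensor_value ` carrier T \<subseteq> carrier L" by (auto simp: T_carrier tensor_value_cls tensor_eval_closed)
    show "carrier L \<subseteq> tensor_value ` carrier T"
    proof
      fix Y assume "Y \<in> carrier L"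
      then obtain x s where x: "x \<in> carrier A" "s \<in> S" "Y = loc_frac A S x s" by (auto simp: L_carrier)
      then have c: "frag_of (x, loc_frac D S \<one> s) \<in> carrier F" by (simp add: frac_in_B grade_one)
      have "Y = tensor_value (cls (frag_of (x, loc_frac D S \<one> s)))"
        using x by (simp add: tensor_value_cls[OF c] tensor_eval_pure)
      then show "Y \<in> tensor_value ` carrier T" using cls_in_T[OF c] by blast
    qed
  qed
qed

lemma dg_transport_T: "dg_transport L T tensor_value"
proof (intro dg_transport.intro dg_transport_axioms.intro comm_dg_ring_L bij_tensor_value T_grade)
  fix X Y assume X: "X \<in> carrier T"
  then obtain c where c: "c \<in> carrier F" "X = cls c" by (auto simp: T_carrier)
  then show "diff T X \<in> carrier T" "tensor_value (diff T X) = diff L (tensor_value X)"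
    using tensor_eval_differential[OF c(1)] by (auto simp: T_diff tensor_value_cls cls_in_T)
  assume "Y \<in> carrier T"
  then obtain d where d: "d \<in> carrier F" "Y = cls d" by (auto simp: T_carrier)
  show "X \<otimes>\<^bsub>T\<^esub> Y \<in> carrier T" "tensor_value (X \<otimes>\<^bsub>T\<^esub> Y) = tensor_value X \<otimes>\<^bsub>L\<^esub> tensor_value Y"
    using c d tensor_eval_product[OF c(1) d(1)] by (auto simp: T_mult tensor_value_cls cls_in_T)
  show "X \<oplus>\<^bsub>T\<^esub> Y \<in> carrier T" "tensor_value (X \<oplus>\<^bsub>T\<^esub> Y) = tensor_value X \<oplus>\<^bsub>L\<^esub> tensor_value Y"
    using c d by (auto simp: T_add tensor_value_cls cls_in_T tensor_eval_add)
next
  have one: "frag_of (\<one>, \<one>\<^bsub>B\<^esub>) \<in> carrier F" using one_B by simp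
  show "\<one>\<^bsub>T\<^esub> \<in> carrier T" using cls_in_T[OF one] by (simp add: T_simps)
  show "tensor_value \<one>\<^bsub>T\<^esub> = \<one>\<^bsub>L\<^esub>"
    using tensor_value_cls[OF one] tensor_eval_pure[OF one_closed one_in_S] L_one by (simp add: T_simps one_B)
  show "\<zero>\<^bsub>T\<^esub> \<in> carrier T" "tensor_value \<zero>\<^bsub>T\<^esub> = \<zero>\<^bsub>L\<^esub>"
    by (simp_all add: T_zero cls_in_T tensor_value_cls tensor_eval_zero)
qed

theorem has_quasi_iso_T_L: "has_quasi_iso T L"
  using dg_transport.comm_dg_ring_T[OF dg_transport_T] dg_transport.quasi_iso_v[OF dg_transport_T]
    comm_dg_ring_L by (auto simp: has_quasi_iso_def)

end

section \<open>Cohomology of the localization\<close>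

context comm_dg_ring
begin

lemma coboundaries_0_subset: "coboundaries A 0 \<subseteq> grade A 0"
  using coboundaries_cocycles[of 0] by (simp add: cocycles_0)

lemma degree0_mult_coboundary:
  assumes "s \<in> grade A 0" "b \<in> coboundaries A n"
  shows "s \<otimes> b \<in> coboundaries A n"
proof -
  obtain c where c: "c \<in> grade A (n - 1)" "b = diff A c" using assms by (auto simp: coboundaries_def)
  have "diff A (s \<otimes> c) = s \<otimes> b" using c assms by (simp add: diff_degree0_mult grade_carrier)
  moreover have "s \<otimes> c \<in> grade A (n - 1)" using grade_mult[OF assms(1) c(1)] by simp
  ultimately show ?thesis unfolding coboundaries_def by (metis image_eqI)
qed

lemma coboundary_mult_cocycle:
  assumes "b \<in> coboundaries A 0" "z \<in> cocycles A n"
  shows "b \<otimes> z \<in> coboundaries A n"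
proof -
  obtain c where c: "c \<in> grade A (-1)" "b = diff A c" using assms by (auto simp: coboundaries_def)
  have zc: "z \<in> carrier A" "diff A z = \<zero>" using assms cocycles_carrier by (auto simp: cocycles_def)
  have cc: "c \<in> carrier A" "b \<in> carrier A" using c grade_carrier by auto
  have "diff A (c \<otimes> z) = b \<otimes> z"
    using leibniz[OF c(1) zc(1)] c(2) zc cc by (simp add: sign_mult_def)
  moreover have "c \<otimes> z \<in> grade A (n - 1)"
    using grade_mult[OF c(1), of z n] assms by (simp add: cocycles_def)
  ultimately show ?thesis unfolding coboundaries_def by (metis image_eqI)
qed

text \<open>Well-definedness: changing \<open>s\<close> and \<open>z\<close> by coboundaries changes the product by a coboundary,
since a coboundary times a cocycle is the differential of a product.\<close>
lemma cohomology_smult: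
  assumes s: "s \<in> grade A 0" and z: "z \<in> cocycles A n"
  shows "(coboundaries A 0 +> s) \<odot>\<^bsub>cohomology A n\<^esub> (coboundaries A n +> z) = coboundaries A n +> (s \<otimes> z)"
proof -
  interpret B: abelian_subgroup "coboundaries A n" A by (rule abelian_subgroup_coboundaries)
  interpret B0: abelian_subgroup "coboundaries A 0" A by (rule abelian_subgroup_coboundaries)
  have sz: "s \<in> carrier A" "z \<in> carrier A" using s z grade_carrier cocycles_carrier by auto
  have "coboundaries A n +> (x \<otimes> y) = coboundaries A n +> (s \<otimes> z)"
    if xy: "x \<in> coboundaries A 0 +> s" "y \<in> coboundaries A n +> z" for x y
  proof -
    obtain b c where b: "b \<in> coboundaries A 0" "x = b \<oplus> s" and c: "c \<in> coboundaries A n" "y = c \<oplus> z"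
      using xy by (auto simp: a_r_coset_def')
    have bc: "b \<in> carrier A" "c \<in> carrier A" using b c coboundaries_carrier by auto
    have y: "y \<in> cocycles A n"
      using c z coboundaries_cocycles subgroup.m_closed[OF subgroup_cocycles[of n], of c z] by auto
    have "x \<otimes> y = (b \<otimes> y \<oplus> s \<otimes> c) \<oplus> s \<otimes> z"
      using b c bc sz by (simp add: l_distr r_distr a_ac)
    moreover have "b \<otimes> y \<oplus> s \<otimes> c \<in> coboundaries A n"
      using coboundary_mult_cocycle[OF b(1) y] degree0_mult_coboundary[OF s c(1)] by (rule B.a_closed)
    ultimately have "x \<otimes> y \<in> coboundaries A n +> (s \<otimes> z)" by (auto simp: a_r_coset_def')
    then show ?thesis using B.a_repr_independence'[of "x \<otimes> y" "s \<otimes> z"] sz by simp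
  qed
  moreover have "s \<in> coboundaries A 0 +> s" "z \<in> coboundaries A n +> z"
    using B.a_rcos_self B0.a_rcos_self sz by auto
  ultimately show ?thesis unfolding cohomology_def rcoset_mult_def module.simps by blast
qed

lemma H0_projection_degree0: "s \<in> grade A 0 \<Longrightarrow> H0_projection A s = coboundaries A 0 +> s"
  by (simp add: H0_projection_def component_homogeneous)

end

context degree0_mult_set
begin

text \<open>Exactness of localization in elementary form. A cocycle \<open>z / s\<close> satisfies \<open>u (d z) = 0\<close> for some \<open>u\<close> in
\<open>S\<close>, so that \<open>u z\<close> is a cocycle of \<open>A\<close> with \<open>z / s = (u z) / (u s)\<close>; multiplying by elements of
\<open>S\<close> then moves coboundaries back and forth.\<close>
lemma L_cohomology_trivial_iff:
  "cocycles L n \<subseteq> coboundaries L n \<longleftrightarrow> (\<forall>z\<in>cocycles A n. \<exists>s\<in>S. s \<otimes> z \<in> coboundaries A n)"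
proof
  assume triv: "cocycles L n \<subseteq> coboundaries L n"
  show "\<forall>z\<in>cocycles A n. \<exists>s\<in>S. s \<otimes> z \<in> coboundaries A n"
  proof
    fix z assume z: "z \<in> cocycles A n"
    then have zn: "z \<in> grade A n" "z \<in> carrier A" "diff A z = \<zero>"
      using cocycles_carrier by (auto simp: cocycles_def)
    have "loc_frac A S z \<one> \<in> cocycles L n"
      using zn one_in_S frac_in_L_grade[of z n \<one>] by (simp add: cocycles_def L_diff L_zero[of \<one>])
    then obtain Y where "Y \<in> grade L (n - 1)" "loc_frac A S z \<one> = diff L Y"
      using triv by (auto simp: coboundaries_def)
    then obtain y t where y: "y \<in> grade A (n - 1)" "t \<in> S" "loc_frac A S z \<one> = loc_frac A S (diff A y) t"
      by (auto simp: L_grade L_diff grade_carrier)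
    have yc: "y \<in> carrier A" using y grade_carrier by auto
    obtain u where u: "u \<in> S" "u \<otimes> (z \<otimes> t) = u \<otimes> (diff A y \<otimes> \<one>)"
      using y(2,3) zn yc one_in_S by (auto simp: frac_eq_iff)
    have "(u \<otimes> t) \<otimes> z = diff A (u \<otimes> y)"
      using u y(2) zn yc by (simp add: diff_degree0_mult m_assoc central[of t z])
    moreover have "u \<otimes> y \<in> grade A (n - 1)" using grade_mult[of u 0 y "n - 1"] u y by simp
    ultimately have "(u \<otimes> t) \<otimes> z \<in> coboundaries A n" unfolding coboundaries_def by (metis image_eqI)
    then show "\<exists>s\<in>S. s \<otimes> z \<in> coboundaries A n" using u y mult_in_S by blast
  qed
next
  assume kill: "\<forall>z\<in>cocycles A n. \<exists>s\<in>S. s \<otimes> z \<in> coboundaries A n"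
  show "cocycles L n \<subseteq> coboundaries L n"
  proof
    fix Z assume "Z \<in> cocycles L n"
    then have "Z \<in> grade L n" "diff L Z = \<zero>\<^bsub>L\<^esub>" by (auto simp: cocycles_def)
    then obtain z s where z: "z \<in> grade A n" "s \<in> S" "Z = loc_frac A S z s"
      and dz: "loc_frac A S (diff A z) s = \<zero>\<^bsub>L\<^esub>"
      by (auto simp: L_grade L_diff grade_carrier)
    have zc: "z \<in> carrier A" using z grade_carrier by auto
    obtain u where u: "u \<in> S" "u \<otimes> diff A z = \<zero>"
      using dz z zc frac_eq_zero_iff[of "diff A z" s] by (auto simp: dg_loc_simps)
    have "u \<otimes> z \<in> cocycles A n"
      using u z(1) zc grade_mult[of u 0 z n] by (simp add: cocycles_def diff_degree0_mult)
    then obtain t where t: "t \<in> S" "t \<otimes> (u \<otimes> z) \<in> coboundaries A n" using kill by blast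
    then obtain y where y: "y \<in> grade A (n - 1)" "t \<otimes> (u \<otimes> z) = diff A y" by (auto simp: coboundaries_def)
    have yc: "y \<in> carrier A" using y grade_carrier by auto
    have "Z = loc_frac A S (z \<otimes> (t \<otimes> u)) (s \<otimes> (t \<otimes> u))"
      using z zc t u by (simp add: frac_cancel)
    also have "z \<otimes> (t \<otimes> u) = diff A y"
      using central[of "t \<otimes> u" z] t(1) u(1) zc y(2) by (simp add: m_assoc)
    also have "loc_frac A S (diff A y) (s \<otimes> (t \<otimes> u)) = diff L (loc_frac A S y (s \<otimes> (t \<otimes> u)))"
      using yc z t u by (simp add: L_diff)
    finally show "Z \<in> coboundaries L n"
      using frac_in_L_grade[OF y(1), of "s \<otimes> (t \<otimes> u)"] z t u by (auto simp: coboundaries_def)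
  qed
qed

abbreviation S_bar where "S_bar \<equiv> H0_projection A ` S"

lemma H0_projection_hom:
  shows "x \<in> carrier A \<Longrightarrow> H0_projection A x \<in> carrier (H0 A)"
    and "x \<in> carrier A \<Longrightarrow> y \<in> carrier A \<Longrightarrow>
      H0_projection A (x \<otimes> y) = H0_projection A x \<otimes>\<^bsub>H0 A\<^esub> H0_projection A y"
    and "x \<in> carrier A \<Longrightarrow> y \<in> carrier A \<Longrightarrow>
      H0_projection A (x \<oplus> y) = H0_projection A x \<oplus>\<^bsub>H0 A\<^esub> H0_projection A y"
    and "H0_projection A \<one> = \<one>\<^bsub>H0 A\<^esub>"
  using ring_hom_memE[OF H0_projection_ring_hom] by auto

lemma central_mult_set_H0: "central_mult_set (H0 A) S_bar"
proof -
  interpret H: cring "H0 A" by (rule cring_H0)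
  show ?thesis
  proof
    show "S_bar \<subseteq> carrier (H0 A)" using H0_projection_hom(1) by auto
    show "\<one>\<^bsub>H0 A\<^esub> \<in> S_bar" using H0_projection_hom(4) one_in_S by (metis image_eqI)
    fix s t assume "s \<in> S_bar" "t \<in> S_bar"
    then obtain s' t' where "s' \<in> S" "t' \<in> S" "s = H0_projection A s'" "t = H0_projection A t'" by auto
    then show "s \<otimes>\<^bsub>H0 A\<^esub> t \<in> S_bar"
      using H0_projection_hom(2)[of s' t'] mult_in_S by (metis S_carrier image_eqI)
  next
    fix s x assume "s \<in> S_bar" "x \<in> carrier (H0 A)"
    then show "x \<otimes>\<^bsub>H0 A\<^esub> s = s \<otimes>\<^bsub>H0 A\<^esub> x" using H0_projection_hom(1) H.m_comm by auto
  qed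
qed

text \<open>The map \<open>a / s \<mapsto> [a] / [s]\<close>, defined on all fractions so that it can be built from the ring
homomorphism from \<open>A\<close> to \<open>H\<^sup>0(A)\<close>.\<close>
definition H0_localization_map where
  "H0_localization_map = loc_map (H0 A) S_bar (H0_projection A) (H0_projection A)"

lemma H0_localization_map_frac:
  "a \<in> carrier A \<Longrightarrow> s \<in> S \<Longrightarrow>
    H0_localization_map (loc_frac A S a s) = loc_frac (H0 A) S_bar (H0_projection A a) (H0_projection A s)"
  unfolding H0_localization_map_def
  by (intro loc_map_frac[OF central_mult_set_axioms central_mult_set_H0])
    (auto simp: H0_projection_hom)

lemma degree0_L_carrier: "X \<in> carrier (degree0 L) \<longleftrightarrow> (\<exists>a\<in>grade A 0. \<exists>s\<in>S. X = loc_frac A S a s)"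
  by (simp add: degree0_def L_grade)

text \<open>The first isomorphism theorem for \<open>a / s \<mapsto> [a] / [s]\<close> on the degree \<open>0\<close> part. The image of
\<open>a / s\<close> vanishes if and only if \<open>u a\<close> is a coboundary for some \<open>u\<close> in \<open>S\<close>, which is the
condition for \<open>a / s\<close> to be a coboundary of fractions.\<close>
lemma H0_L_iso: "H0 L \<simeq> loc (H0 A) S_bar"
proof -
  interpret LL: comm_dg_ring L by (rule comm_dg_ring_L)
  interpret LD: cring "degree0 L" by (rule LL.cring_degree0)
  interpret Q: central_mult_set "H0 A" S_bar by (rule central_mult_set_H0)
  interpret QL: ring "loc (H0 A) S_bar" by (rule Q.ring_loc)
  let ?q = "H0_projection A"
  have ops: "X \<otimes>\<^bsub>degree0 L\<^esub> Y = X \<otimes>\<^bsub>L\<^esub> Y" "X \<oplus>\<^bsub>degree0 L\<^esub> Y = X \<oplus>\<^bsub>L\<^esub> Y" "\<one>\<^bsub>degree0 L\<^esub> = \<one>\<^bsub>L\<^esub>"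
    for X Y by (simp_all add: degree0_def)
  have hom: "H0_localization_map \<in> ring_hom (degree0 L) (loc (H0 A) S_bar)"
  proof (rule ring_hom_memI)
    fix X assume X: "X \<in> carrier (degree0 L)"
    then obtain a s where "a \<in> grade A 0" "s \<in> S" "X = loc_frac A S a s" by (auto simp: degree0_L_carrier)
    then show "H0_localization_map X \<in> carrier (loc (H0 A) S_bar)"
      by (simp add: H0_localization_map_frac grade_carrier H0_projection_hom)
    fix Y assume Y: "Y \<in> carrier (degree0 L)"
    have "X \<in> grade L 0" "Y \<in> grade L 0" using X Y by (simp_all add: degree0_def)
    then obtain a b s where ab: "a \<in> grade A 0" "b \<in> grade A 0" "s \<in> S" "X = loc_frac A S a s" "Y = loc_frac A S b s"
      by (rule L_common_denominator)
    then show "H0_localization_map (X \<otimes>\<^bsub>degree0 L\<^esub> Y) = H0_localization_map X \<otimes>\<^bsub>loc (H0 A) S_bar\<^esub> H0_localization_map Y"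
      "H0_localization_map (X \<oplus>\<^bsub>degree0 L\<^esub> Y) = H0_localization_map X \<oplus>\<^bsub>loc (H0 A) S_bar\<^esub> H0_localization_map Y"
      by (simp_all add: ops H0_localization_map_frac L_mult L_add Q.loc_mult Q.loc_add grade_carrier H0_projection_hom)
  next
    show "H0_localization_map \<one>\<^bsub>degree0 L\<^esub> = \<one>\<^bsub>loc (H0 A) S_bar\<^esub>"
      using H0_localization_map_frac[OF one_closed one_in_S] by (simp add: ops L_one Q.loc_one H0_projection_hom)
  qed
  interpret H0_localization_map: ring_hom_ring "degree0 L" "loc (H0 A) S_bar" H0_localization_map
    by (intro ring_hom_ringI2 LD.ring_axioms QL.ring_axioms hom)
  have surj: "H0_localization_map ` carrier (degree0 L) = carrier (loc (H0 A) S_bar)"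
  proof
    show "carrier (loc (H0 A) S_bar) \<subseteq> H0_localization_map ` carrier (degree0 L)"
    proof
      fix Y assume "Y \<in> carrier (loc (H0 A) S_bar)"
      then obtain X s where X: "X \<in> carrier (H0 A)" "s \<in> S" "Y = loc_frac (H0 A) S_bar X (?q s)"
        by (auto simp: Q.loc_carrier)
      then obtain a where a: "a \<in> grade A 0" "X = ?q a" by (auto simp: H0_carrier H0_projection_degree0)
      then have "Y = H0_localization_map (loc_frac A S a s)" using X by (simp add: H0_localization_map_frac grade_carrier)
      moreover have "loc_frac A S a s \<in> carrier (degree0 L)" using a X by (auto simp: degree0_L_carrier)
      ultimately show "Y \<in> H0_localization_map ` carrier (degree0 L)" by blast
    qed
  qed auto
  have ker: "H0_localization_map (loc_frac A S a s) = \<zero>\<^bsub>loc (H0 A) S_bar\<^esub> \<longleftrightarrow> loc_frac A S a s \<in> coboundaries L 0"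
    if a: "a \<in> grade A 0" "s \<in> S" for a s
  proof -
    have q0: "?q x = \<zero>\<^bsub>H0 A\<^esub> \<longleftrightarrow> x \<in> coboundaries A 0" if "x \<in> grade A 0" for x
      using that by (simp add: H0_projection_degree0 H0_zero coboundaries_coset_eq_iff grade_carrier a_minus_def)
    have "H0_localization_map (loc_frac A S a s) = \<zero>\<^bsub>loc (H0 A) S_bar\<^esub> \<longleftrightarrow> (\<exists>u\<in>S. ?q u \<otimes>\<^bsub>H0 A\<^esub> ?q a = \<zero>\<^bsub>H0 A\<^esub>)"
      using a by (simp add: H0_localization_map_frac grade_carrier H0_projection_hom Q.frac_eq_zero_iff)
    also have "\<dots> \<longleftrightarrow> (\<exists>u\<in>S. u \<otimes> a \<in> coboundaries A 0)"
    proof (rule bex_cong[OF refl])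
      fix u assume "u \<in> S"
      then show "?q u \<otimes>\<^bsub>H0 A\<^esub> ?q a = \<zero>\<^bsub>H0 A\<^esub> \<longleftrightarrow> u \<otimes> a \<in> coboundaries A 0"
        using a q0[of "u \<otimes> a"] grade_mult[of u 0 a 0] by (simp add: H0_projection_hom(2)[symmetric] grade_carrier)
    qed
    also have "\<dots> \<longleftrightarrow> loc_frac A S a s \<in> coboundaries L 0"
    proof
      assume "\<exists>u\<in>S. u \<otimes> a \<in> coboundaries A 0"
      then obtain u y where u: "u \<in> S" "y \<in> grade A (-1)" "u \<otimes> a = diff A y"
        by (auto simp: coboundaries_def)
      have "loc_frac A S a s = loc_frac A S (a \<otimes> u) (s \<otimes> u)" using a u by (simp add: frac_cancel grade_carrier)
      also have "a \<otimes> u = diff A y" using u a central[of u a] by (simp add: grade_carrier)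
      also have "loc_frac A S (diff A y) (s \<otimes> u) = diff L (loc_frac A S y (s \<otimes> u))"
        using u a by (simp add: L_diff grade_carrier)
      finally show "loc_frac A S a s \<in> coboundaries L 0"
        using frac_in_L_grade[OF u(2), of "s \<otimes> u"] a u by (auto simp: coboundaries_def)
    next
      assume "loc_frac A S a s \<in> coboundaries L 0"
      then obtain Y where "Y \<in> grade L (-1)" "loc_frac A S a s = diff L Y" by (auto simp: coboundaries_def)
      then obtain y t where y: "y \<in> grade A (-1)" "t \<in> S" "loc_frac A S a s = loc_frac A S (diff A y) t"
        by (auto simp: L_grade L_diff grade_carrier)
      have c: "y \<in> carrier A" "a \<in> carrier A" using y a grade_carrier by auto
      obtain v where v: "v \<in> S" "v \<otimes> (a \<otimes> t) = v \<otimes> (diff A y \<otimes> s)"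
        using y(2,3) a c by (auto simp: frac_eq_iff)
      have "(v \<otimes> t) \<otimes> a = v \<otimes> (a \<otimes> t)" using v(1) y(2) c by (simp add: m_assoc central[of t a])
      also have "\<dots> = diff A ((v \<otimes> s) \<otimes> y)"
        unfolding v(2) using v(1) a c by (simp add: diff_degree0_mult m_assoc central[of s "diff A y"])
      finally have "(v \<otimes> t) \<otimes> a = diff A ((v \<otimes> s) \<otimes> y)" .
      moreover have "(v \<otimes> s) \<otimes> y \<in> grade A (-1)"
        using grade_mult[of "v \<otimes> s" 0 y "-1"] v a y by simp
      ultimately have "(v \<otimes> t) \<otimes> a \<in> coboundaries A 0" by (auto simp: coboundaries_def)
      then show "\<exists>u\<in>S. u \<otimes> a \<in> coboundaries A 0" using v y mult_in_S by blast
    qed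
    finally show ?thesis .
  qed
  have "X \<in> a_kernel (degree0 L) (loc (H0 A) S_bar) H0_localization_map \<longleftrightarrow> X \<in> coboundaries L 0" for X
  proof (cases "X \<in> carrier (degree0 L)")
    case True
    then obtain a s where X: "a \<in> grade A 0" "s \<in> S" "X = loc_frac A S a s" by (auto simp: degree0_L_carrier)
    have "X \<in> a_kernel (degree0 L) (loc (H0 A) S_bar) H0_localization_map \<longleftrightarrow> H0_localization_map X = \<zero>\<^bsub>loc (H0 A) S_bar\<^esub>"
      unfolding a_kernel_def' using True by blast
    then show ?thesis using ker[OF X(1,2)] X(3) by blast
  next
    case False
    have "carrier (degree0 L) = grade L 0" by (simp add: degree0_def)
    then have "X \<notin> coboundaries L 0" using False LL.coboundaries_0_subset by blast
    then show ?thesis unfolding a_kernel_def' using False by blast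
  qed
  then have "a_kernel (degree0 L) (loc (H0 A) S_bar) H0_localization_map = coboundaries L 0" by blast
  then show ?thesis using H0_localization_map.FactRing_iso[OF surj] by (simp add: H0_def)
qed

end

section \<open>Openness of the regular locus\<close>

lemma (in comm_dg_ring) primeideal_prime_preimage:
  assumes "primeideal P (H0 A)"
  shows "primeideal (prime_preimage A P) (degree0 A)"
proof -
  interpret D: cring "degree0 A" by (rule cring_degree0)
  interpret H: cring "H0 A" by (rule cring_H0)
  interpret q: ring_hom_ring "degree0 A" "H0 A" "\<lambda>a. coboundaries A 0 +> a"
    by (intro ring_hom_ringI D.ring_axioms H.ring_axioms)
      (auto simp: degree0_def H0_coset H0_mult H0_add H0_one)
  show ?thesis
    using q.primeideal_vimage[OF cring_degree0 assms]
    by (simp add: prime_preimage_def degree0_def)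
qed

lemma (in comm_dg_ring) degree0_mult_set_prime:
  assumes P: "primeideal P (H0 A)"
  shows "degree0_mult_set A (grade A 0 - prime_preimage A P)"
proof -
  interpret D: cring "degree0 A" by (rule cring_degree0)
  interpret S: central_mult_set "degree0 A" "carrier (degree0 A) - prime_preimage A P"
    by (rule D.central_mult_set_prime_complement[OF primeideal_prime_preimage[OF P]])
  show ?thesis
    using S.one_S S.mult_S by unfold_locales (auto simp: degree0_def)
qed

text \<open>The primes \<open>P\<close> with \<open>H\<^sup>n(A)\<^sub>P = 0\<close>, expressed by cocycles that are killed up to coboundaries by an
element outside of \<open>P\<close>.\<close>
definition vanishing_locus :: "('a, 'm) dg_ring_scheme \<Rightarrow> int \<Rightarrow> 'a set set set" where
  "vanishing_locus A n = {P \<in> Spec (H0 A). \<forall>z\<in>cocycles A n.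
     \<exists>s\<in>grade A 0 - prime_preimage A P. s \<otimes>\<^bsub>A\<^esub> z \<in> coboundaries A n}"

lemma (in comm_dg_ring) acyclic_regular_dg_localization_iff:
  assumes P: "P \<in> Spec (H0 A)"
  shows "comm_dg_ring (dg_localization A P)"
    and "acyclic_regular (dg_localization A P) \<longleftrightarrow>
      P \<in> reg_locus (H0 A) \<and> (\<forall>n<0. P \<in> vanishing_locus A n)"
proof -
  let ?S = "grade A 0 - prime_preimage A P"
  have prime: "primeideal P (H0 A)" using P by (simp add: Spec_def)
  interpret S: degree0_mult_set A ?S by (rule degree0_mult_set_prime[OF prime])
  interpret LL: comm_dg_ring S.L by (rule S.comm_dg_ring_L)
  have T: "dg_localization A P = S.T"
    by (simp only: dg_localization_def Let_def fraction_eq_frac localization_eq_loc S.degree0_simps(1))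
  have qi: "has_quasi_iso (dg_localization A P) S.L"
    unfolding T by (rule S.has_quasi_iso_T_L)
  then show "comm_dg_ring (dg_localization A P)" by (simp add: has_quasi_iso_def)
  have "S.S_bar = (\<lambda>s. coboundaries A 0 +> s) ` ?S"
    by (intro image_cong refl) (simp add: H0_projection_degree0)
  also have "\<dots> = carrier (H0 A) - P"
  proof (rule Set.set_eqI)
    fix X
    show "X \<in> (\<lambda>s. coboundaries A 0 +> s) ` ?S \<longleftrightarrow> X \<in> carrier (H0 A) - P"
      unfolding prime_preimage_def Diff_iff H0_carrier by blast
  qed
  finally have S_bar: "S.S_bar = carrier (H0 A) - P" .
  have iso: "H0 S.L \<simeq> localization (H0 A) P"
    using S.H0_L_iso unfolding S_bar localization_eq_loc .
  have "regular_local_ring (H0 S.L) \<longleftrightarrow> P \<in> reg_locus (H0 A)"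
    using regular_local_ring_cong_ring_iso[OF LL.cring_H0 cring_localization[OF cring_H0 prime] iso] P
    by (simp add: reg_locus_def)
  moreover have "cocycles S.L n \<subseteq> coboundaries S.L n \<longleftrightarrow> P \<in> vanishing_locus A n" for n
    unfolding S.L_cohomology_trivial_iff vanishing_locus_def using P by blast
  ultimately have "acyclic_regular S.L \<longleftrightarrow>
      P \<in> reg_locus (H0 A) \<and> (\<forall>n<0. P \<in> vanishing_locus A n)"
    unfolding acyclic_regular_def by blast
  then show "acyclic_regular (dg_localization A P) \<longleftrightarrow>
      P \<in> reg_locus (H0 A) \<and> (\<forall>n<0. P \<in> vanishing_locus A n)"
    using acyclic_regular_cong[OF qi] by simp
qed

lemma (in comm_dg_ring) dg_reg_locus_eq:
  "dg_reg_locus TYPE('v) A = {P \<in> reg_locus (H0 A). \<forall>n<0. P \<in> vanishing_locus A n}"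
proof -
  have "(\<exists>R :: ('a dg_loc + 'v) ring. regular_local_ring R \<and>
      quasi_isomorphic (dg_localization A P) (concentrated R)) \<longleftrightarrow>
      P \<in> reg_locus (H0 A) \<and> (\<forall>n<0. P \<in> vanishing_locus A n)" if "P \<in> Spec (H0 A)" for P
    using quasi_isomorphic_regular_iff[OF acyclic_regular_dg_localization_iff(1)[OF that]]
      acyclic_regular_dg_localization_iff(2)[OF that] by blast
  then show ?thesis by (auto simp: dg_reg_locus_def reg_locus_def)
qed

text \<open>Each of the finitely many generators is killed by an element outside of \<open>P\<close>. The product of these
elements kills the module and avoids \<open>P\<close> because \<open>P\<close> is prime.\<close>
lemma (in module) annihilator_avoiding_prime:
  assumes fg: "fin_gen_module R M" and P: "primeideal P R"
    and kill: "\<And>x. x \<in> carrier M \<Longrightarrow> \<exists>a\<in>carrier R - P. a \<odot>\<^bsub>M\<^esub> x = \<zero>\<^bsub>M\<^esub>"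
  shows "\<exists>a\<in>carrier R - P. \<forall>x\<in>carrier M. a \<odot>\<^bsub>M\<^esub> x = \<zero>\<^bsub>M\<^esub>"
proof -
  interpret P: primeideal P R by fact
  obtain G where G: "G \<subseteq> carrier M" "finite G"
    "\<And>x. x \<in> carrier M \<Longrightarrow> \<exists>c \<in> G \<rightarrow> carrier R. x = (\<Oplus>\<^bsub>M\<^esub>s\<in>G. c s \<odot>\<^bsub>M\<^esub> s)"
    using fg unfolding fin_gen_module_def by blast
  have "\<exists>a\<in>carrier R - P. \<forall>x\<in>G'. a \<odot>\<^bsub>M\<^esub> x = \<zero>\<^bsub>M\<^esub>" if "finite G'" "G' \<subseteq> G" for G'
    using that
  proof (induction G')
    case empty
    have "\<one> \<notin> P" using P.I_notcarr P.one_imp_carrier by auto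
    then show ?case by auto
  next
    case (insert g G')
    then obtain a where a: "a \<in> carrier R - P" "\<forall>x\<in>G'. a \<odot>\<^bsub>M\<^esub> x = \<zero>\<^bsub>M\<^esub>" by auto
    have g: "g \<in> carrier M" using insert G by auto
    obtain b where b: "b \<in> carrier R - P" "b \<odot>\<^bsub>M\<^esub> g = \<zero>\<^bsub>M\<^esub>" using kill[OF g] by auto
    have "a \<otimes> b \<in> carrier R - P" using a b P.I_prime by auto
    moreover have "(a \<otimes> b) \<odot>\<^bsub>M\<^esub> x = \<zero>\<^bsub>M\<^esub>" if x: "x \<in> insert g G'" for x
    proof (cases "x = g")
      case True
      then show ?thesis using a b g by (simp add: smult_assoc1)
    next
      case False
      then have "x \<in> G'" "x \<in> carrier M" using x insert G by auto
      then show ?thesis using a b by (simp add: smult_assoc1 m_comm[of a b])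
    qed
    ultimately show ?case by blast
  qed
  then obtain a where a: "a \<in> carrier R - P" "\<forall>x\<in>G. a \<odot>\<^bsub>M\<^esub> x = \<zero>\<^bsub>M\<^esub>" using G(2) by blast
  have "a \<odot>\<^bsub>M\<^esub> x = \<zero>\<^bsub>M\<^esub>" if x: "x \<in> carrier M" for x
  proof -
    obtain c where c: "c \<in> G \<rightarrow> carrier R" "x = (\<Oplus>\<^bsub>M\<^esub>s\<in>G. c s \<odot>\<^bsub>M\<^esub> s)" using G(3)[OF x] by blast
    have "a \<odot>\<^bsub>M\<^esub> x = (\<Oplus>\<^bsub>M\<^esub>s\<in>G. a \<odot>\<^bsub>M\<^esub> (c s \<odot>\<^bsub>M\<^esub> s))"
      unfolding c(2) using a c G by (intro finsum_smult_ldistr) auto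
    also have "\<dots> = (\<Oplus>\<^bsub>M\<^esub>s\<in>G. \<zero>\<^bsub>M\<^esub>)"
    proof (intro M.finsum_cong' refl)
      fix s assume s: "s \<in> G"
      then have sc: "s \<in> carrier M" "c s \<in> carrier R" "a \<in> carrier R" using G c a by auto
      have "a \<odot>\<^bsub>M\<^esub> (c s \<odot>\<^bsub>M\<^esub> s) = c s \<odot>\<^bsub>M\<^esub> (a \<odot>\<^bsub>M\<^esub> s)"
        using sc by (simp add: smult_assoc1[symmetric] m_comm)
      then show "a \<odot>\<^bsub>M\<^esub> (c s \<odot>\<^bsub>M\<^esub> s) = \<zero>\<^bsub>M\<^esub>" using a s sc by simp
    qed auto
    finally show ?thesis by simp
  qed
  then show ?thesis using a by blast
qed

text \<open>The support of a finitely generated module is the closed set defined by its annihilator.\<close>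
lemma (in comm_dg_ring) openin_vanishing_locus:
  assumes fg: "fin_gen_module (H0 A) (cohomology A n)"
  shows "openin (zariski (H0 A)) (vanishing_locus A n)"
proof -
  interpret M: module "H0 A" "cohomology A n" by (rule module_cohomology)
  interpret B: abelian_subgroup "coboundaries A n" A by (rule abelian_subgroup_coboundaries)
  let ?Ann = "{a \<in> carrier (H0 A). \<forall>x\<in>carrier (cohomology A n).
      a \<odot>\<^bsub>cohomology A n\<^esub> x = \<zero>\<^bsub>cohomology A n\<^esub>}"
  have zero: "\<zero>\<^bsub>cohomology A n\<^esub> = coboundaries A n +> \<zero>"
    using B.a_subset by (simp add: cohomology_def)
  have smult_zero: "(coboundaries A 0 +> s) \<odot>\<^bsub>cohomology A n\<^esub> (coboundaries A n +> z) = \<zero>\<^bsub>cohomology A n\<^esub>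
      \<longleftrightarrow> s \<otimes> z \<in> coboundaries A n" if "s \<in> grade A 0" "z \<in> cocycles A n" for s z
    using that by (simp add: cohomology_smult zero coboundaries_coset_eq_iff grade_carrier cocycles_carrier
        a_minus_def)
  have mem: "P \<in> vanishing_locus A n \<longleftrightarrow> \<not> ?Ann \<subseteq> P" if P: "P \<in> Spec (H0 A)" for P
  proof
    assume V: "P \<in> vanishing_locus A n"
    have "\<exists>a\<in>carrier (H0 A) - P. a \<odot>\<^bsub>cohomology A n\<^esub> x = \<zero>\<^bsub>cohomology A n\<^esub>"
      if x: "x \<in> carrier (cohomology A n)" for x
    proof -
      obtain z where z: "z \<in> cocycles A n" "x = coboundaries A n +> z"
        using x by (auto simp: cohomology_carrier)
      obtain s where s: "s \<in> grade A 0 - prime_preimage A P" "s \<otimes> z \<in> coboundaries A n"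
        using V z(1) by (auto simp: vanishing_locus_def)
      then have "coboundaries A 0 +> s \<in> carrier (H0 A) - P"
        by (auto simp: prime_preimage_def H0_coset)
      moreover have "(coboundaries A 0 +> s) \<odot>\<^bsub>cohomology A n\<^esub> x = \<zero>\<^bsub>cohomology A n\<^esub>"
        using smult_zero[of s z] s z by simp
      ultimately show ?thesis by blast
    qed
    then show "\<not> ?Ann \<subseteq> P"
      using M.annihilator_avoiding_prime[OF fg, of P] P by (auto simp: Spec_def)
  next
    assume "\<not> ?Ann \<subseteq> P"
    then obtain a where a: "a \<in> carrier (H0 A)" "a \<notin> P"
      "\<And>x. x \<in> carrier (cohomology A n) \<Longrightarrow> a \<odot>\<^bsub>cohomology A n\<^esub> x = \<zero>\<^bsub>cohomology A n\<^esub>"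
      by blast
    then obtain s where s: "s \<in> grade A 0" "a = coboundaries A 0 +> s" by (auto simp: H0_carrier)
    then have "s \<in> grade A 0 - prime_preimage A P" using a by (simp add: prime_preimage_def)
    moreover have "s \<otimes> z \<in> coboundaries A n" if "z \<in> cocycles A n" for z
      using a(3)[of "coboundaries A n +> z"] smult_zero[OF s(1) that] s(2) that
      by (auto simp: cohomology_carrier)
    ultimately show "P \<in> vanishing_locus A n" using P by (auto simp: vanishing_locus_def)
  qed
  have "vanishing_locus A n = {P \<in> Spec (H0 A). \<not> ?Ann \<subseteq> P}"
  proof (rule Set.set_eqI)
    fix P
    have "P \<in> vanishing_locus A n \<Longrightarrow> P \<in> Spec (H0 A)" by (simp add: vanishing_locus_def)
    then show "P \<in> vanishing_locus A n \<longleftrightarrow> P \<in> {P \<in> Spec (H0 A). \<not> ?Ann \<subseteq> P}"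
      using mem[of P] by blast
  qed
  then show ?thesis unfolding openin_zariski[OF cring_H0] by (intro exI[of _ ?Ann]) auto
qed

text \<open>If there is any cohomology, its top degree is not \<open>-\<infinity>\<close>, so a bottom degree \<open>-\<infinity>\<close> would make the
amplitude infinite.\<close>
lemma (in comm_dg_ring) cohomology_bounded_below:
  assumes "amp A < \<infinity>"
  shows "\<exists>N. \<forall>n<N. cocycles A n \<subseteq> coboundaries A n"
proof (cases "cohomology_support A = {}")
  case True
  then show ?thesis by (auto simp: cohomology_support_def cohomology_trivial_iff)
next
  case False
  let ?I = "INF n\<in>cohomology_support A. ereal (of_int n)"
  let ?S = "SUP n\<in>cohomology_support A. ereal (of_int n)"
  obtain m where m: "m \<in> cohomology_support A" using False by auto
  have "ereal (of_int m) \<le> ?S" using m by (intro SUP_upper)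
  then have S: "?S \<noteq> -\<infinity>" by auto
  have "?I \<le> ereal (of_int m)" using m by (intro INF_lower)
  then have I: "?I \<noteq> \<infinity>" by auto
  have "?I \<noteq> -\<infinity>"
    using assms S unfolding amp_def by (cases ?S) auto
  with I obtain r where r: "?I = ereal r" by (cases ?I) auto
  have "cocycles A n \<subseteq> coboundaries A n" if "n < \<lfloor>r\<rfloor>" for n
  proof (rule ccontr)
    assume "\<not> ?thesis"
    then have "n \<in> cohomology_support A" by (simp add: cohomology_support_def cohomology_trivial_iff)
    then have "ereal r \<le> ereal (of_int n)" unfolding r[symmetric] by (rule INF_lower)
    then show False using that by (simp add: floor_less_iff) linarith
  qed
  then show ?thesis by blast
qed

theorem proposition7:
  fixes A :: "'a dg_ring"
  assumes "comm_dg_ring A"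
    and "dg_noetherian A"
    and "amp A < \<infinity>"
    and "openin (zariski (H0 A)) (reg_locus (H0 A))"
  shows "openin (zariski (H0 A)) (dg_reg_locus TYPE('v) A)"
proof -
  interpret comm_dg_ring A by fact
  obtain N where N: "\<And>n. n < N \<Longrightarrow> cocycles A n \<subseteq> coboundaries A n"
    using cohomology_bounded_below[OF assms(3)] by blast
  have trivial: "P \<in> vanishing_locus A n" if "n < N" "P \<in> Spec (H0 A)" for P n
  proof -
    interpret S: degree0_mult_set A "grade A 0 - prime_preimage A P"
      using that(2) by (intro degree0_mult_set_prime) (simp add: Spec_def)
    have "\<one>\<^bsub>A\<^esub> \<otimes>\<^bsub>A\<^esub> z \<in> coboundaries A n" if "z \<in> cocycles A n" for z
      using N[OF \<open>n < N\<close>] that cocycles_carrier[OF that] by auto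
    then show ?thesis using S.one_in_S that(2) by (auto simp: vanishing_locus_def)
  qed
  have "openin (zariski (H0 A)) {P \<in> reg_locus (H0 A). \<forall>n\<in>I. P \<in> vanishing_locus A n}"
    if "finite I" "I \<subseteq> {..<0}" for I
    using that
  proof (induction I)
    case empty
    then show ?case using assms(4) by simp
  next
    case (insert n I)
    have "fin_gen_module (H0 A) (cohomology A n)"
      using assms(2) insert.prems by (simp add: dg_noetherian_def)
    then have "openin (zariski (H0 A))
        ({P \<in> reg_locus (H0 A). \<forall>n\<in>I. P \<in> vanishing_locus A n} \<inter> vanishing_locus A n)"
      using insert by (intro openin_Int openin_vanishing_locus) auto
    moreover have "{P \<in> reg_locus (H0 A). \<forall>n\<in>I. P \<in> vanishing_locus A n} \<inter> vanishing_locus A n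
        = {P \<in> reg_locus (H0 A). \<forall>n\<in>insert n I. P \<in> vanishing_locus A n}" by auto
    ultimately show ?case by simp
  qed
  \<comment> \<open>Below \<open>N\<close> the cohomology of \<open>A\<close> itself vanishes and imposes no condition, so finitely many
      degrees remain.\<close>
  then have "openin (zariski (H0 A)) {P \<in> reg_locus (H0 A). \<forall>n\<in>{N..<0}. P \<in> vanishing_locus A n}"
    by (simp add: subset_iff)
  moreover have "{P \<in> reg_locus (H0 A). \<forall>n\<in>{N..<0}. P \<in> vanishing_locus A n} = dg_reg_locus TYPE('v) A"
    unfolding dg_reg_locus_eq using trivial by (force simp: reg_locus_def not_less)
  ultimately show ?thesis by simp
qed

end
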